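(* There exist an infinite dimensional separable Hilbert space $\mathcal{E}$ and a function $B\in H^\infty_1(L(\mathcal{E}))$ such that for every $\alpha>-1$, $$\mathcal{A}_\alpha(B)\approx\mathcal{A}_\alpha(B^* )\approx A^2_{\alpha-1,\mathcal{E}},$$ while $B$ is not a finite Blaschke-Potapov product. In addition, $\|B(0)\|<1$ and $B^*(z)B(z)=B(z)B^*(z)=I_{\mathcal{E}}$ for a.e. $|z|=1$. Here $X\approx Y$ means that $X$ and $Y$ are equal as sets (of $\mathcal{E}$-valued analytic functions on the unit disk).
   Context: Hilbert spaces are complex; $\mathbb{D}$ is the open unit disk. $L(\mathcal{E})$ is the algebra of bounded linear operators on $\mathcal{E}$, and $H^\infty_1(L(\mathcal{E}))$ is the set of analytic functions $B:\mathbb{D}\to L(\mathcal{E})$ with $\|B(z)\|\le 1$ for all $z\in\mathbb{D}$. For $|z|=1$, $B(z)$ denotes the radial boundary value of $B$ (a strong operator limit, existing for a.e. $|z|=1$), and $B^*(z)=B(z)^*$. For $\beta>-2$, $A^2_{\beta,\mathcal{E}}$ is the reproducing kernel Hilbert space of $\mathcal{E}$-valued analytic functions on $\mathbb{D}$ with kernel $\frac{I_{\mathcal{E}}}{(1-z\overline{w})^{\beta+2}}$. Explicitly, with $c_{n,\beta}=\frac{\Gamma(n+\beta+2)}{n!\,\Gamma(\beta+2)}$, it consists of all $f(z)=\sum_{n\ge0}f_nz^n$, $f_n\in\mathcal{E}$, with $\sum_{n\ge 0}\|f_n\|^2/c_{n,\beta}<\infty$. For a contraction $A$ from a Hilbert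 space $\mathcal{H}$ to a Hilbert space $\mathcal{K}$, $\mathcal{M}(A)$ denotes the range of $A$ with the Hilbert space structure $\langle Ah_1,Ah_2\rangle_{\mathcal{M}(A)}=\langle h_1,h_2\rangle_{\mathcal{H}}$ for $h_1\in(\ker A)^\perp$, $h_2\in\mathcal{H}$. For $\alpha>-1$, $T_B$ is the operator of multiplication by $B$ on $A^2_{\alpha,\mathcal{E}}$; it is a contraction. Define $$\mathcal{A}_\alpha(B)=\mathcal{M}\bigl((I-T_BT_B^* )^{1/2}\bigr),\qquad \mathcal{A}_\alpha(B^* )=\mathcal{M}\bigl((I-T_B^*T_B)^{1/2}\bigr).$$ For $a\in\mathbb{D}$ and a closed subspace $\mathcal{F}\subsetneq\mathcal{E}$ with orthogonal projection $P_{\mathcal{F}}$, the Blaschke-Potapov factor is $Q(z,a,\mathcal{F},\mathcal{E})=\varphi_a(z)(I_{\mathcal{E}}-P_{\mathcal{F}})+P_{\mathcal{F}}$, where $\varphi_a(z)=\frac{z-a}{1-\overline{a}z}$. $B$ is a finite Blaschke-Potapov product if there are finitely many closed subspaces $\mathcal{F}_i\subsetneq\mathcal{E}$, points $a_i\in\mathbb{D}$, $i=1,\dots,n$, and a unitary operator $U\in L(\mathcal{E})$ such that $B(z)=U\prod_{i=1}^nQ(z,a_i,\mathcal{F}_i,\mathcal{E})$. *)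

theory Defs
  imports "HOL-Analysis.Analysis" "HOL-Library.Function_Algebras"
begin

section \<open>Complex vector spaces\<close>

class complex_vector = ab_group_add +
  fixes scaleC :: "complex \<Rightarrow> 'a \<Rightarrow> 'a"  (infixr \<open>*\<^sub>C\<close> 75)
  assumes scaleC_add_right: "c *\<^sub>C (x + y) = c *\<^sub>C x + c *\<^sub>C y"
    and scaleC_add_left: "(c + d) *\<^sub>C x = c *\<^sub>C x + d *\<^sub>C x"
    and scaleC_scaleC: "c *\<^sub>C d *\<^sub>C x = (c * d) *\<^sub>C x"
    and scaleC_one: "1 *\<^sub>C x = x"

global_interpretation cvec: vector_space "scaleC :: complex \<Rightarrow> 'a \<Rightarrow> 'a::complex_vector"
  by unfold_locales (rule scaleC_add_right scaleC_add_left scaleC_scaleC scaleC_one)+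

instantiation complex :: complex_vector
begin
definition scaleC_complex :: "complex \<Rightarrow> complex \<Rightarrow> complex"
  where "scaleC_complex c x = c * x"
instance by standard (simp_all add: scaleC_complex_def algebra_simps)
end

instantiation "fun" :: (type, complex_vector) complex_vector
begin
definition scaleC_fun :: "complex \<Rightarrow> ('a \<Rightarrow> 'b) \<Rightarrow> 'a \<Rightarrow> 'b"
  where "scaleC_fun c f = (\<lambda>x. c *\<^sub>C f x)"
instance
  by standard (simp_all add: scaleC_fun_def fun_eq_iff
      scaleC_add_right scaleC_add_left scaleC_scaleC scaleC_one)
end


section \<open>Complex Hilbert spaces with explicit carrier\<close>

text \<open>
  A Hilbert space is a linear subspace of an ambient complex vector space, together with an
  inner product of its own. The carrier is a term and not a type, because the spaces of
  analytic functions below depend on a real parameter and because the theorem quantifies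
  existentially over a Hilbert space.  Inner products are linear in the first argument.
\<close>

record 'a hilbert =
  hcarrier :: "'a set"
  hinner :: "'a \<Rightarrow> 'a \<Rightarrow> complex"

definition hnorm :: "'a hilbert \<Rightarrow> 'a \<Rightarrow> real"
  where "hnorm E x = sqrt (Re (hinner E x x))"

text \<open>The value 0 off the carrier is there because \<^locale>\<open>Metric_space\<close> requires nonnegativity
  and symmetry everywhere.\<close>

definition hdist :: "'a::complex_vector hilbert \<Rightarrow> 'a \<Rightarrow> 'a \<Rightarrow> real"
  where "hdist E x y = (if x \<in> hcarrier E \<and> y \<in> hcarrier E then hnorm E (x - y) else 0)"

definition htopology :: "'a::complex_vector hilbert \<Rightarrow> 'a topology"
  where "htopology E = Metric_space.mtopology (hcarrier E) (hdist E)"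

locale pre_hilbert_space =
  fixes E :: "'a::complex_vector hilbert"
  assumes subspace: "cvec.subspace (hcarrier E)"
    and inner_add_left: "\<lbrakk>x \<in> hcarrier E; y \<in> hcarrier E; z \<in> hcarrier E\<rbrakk> \<Longrightarrow>
          hinner E (x + y) z = hinner E x z + hinner E y z"
    and inner_scaleC_left: "\<lbrakk>x \<in> hcarrier E; y \<in> hcarrier E\<rbrakk> \<Longrightarrow>
          hinner E (c *\<^sub>C x) y = c * hinner E x y"
    and inner_commute: "\<lbrakk>x \<in> hcarrier E; y \<in> hcarrier E\<rbrakk> \<Longrightarrow>
          hinner E y x = cnj (hinner E x y)"
    and inner_nonneg: "x \<in> hcarrier E \<Longrightarrow> 0 \<le> Re (hinner E x x)"
    and inner_eq_zero: "\<lbrakk>x \<in> hcarrier E; hinner E x x = 0\<rbrakk> \<Longrightarrow> x = 0"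

locale hilbert_space = pre_hilbert_space +
  assumes complete: "Metric_space.mcomplete (hcarrier E) (hdist E)"

definition infinite_dimensional :: "'a::complex_vector hilbert \<Rightarrow> bool"
  where "infinite_dimensional E \<longleftrightarrow> \<not> (\<exists>S. finite S \<and> hcarrier E \<subseteq> cvec.span S)"

definition closed_subspace :: "'a::complex_vector hilbert \<Rightarrow> 'a set \<Rightarrow> bool"
  where "closed_subspace E F \<longleftrightarrow>
    F \<subseteq> hcarrier E \<and> cvec.subspace F \<and> closedin (htopology E) F"

context pre_hilbert_space
begin

lemma diff_carrier: "x \<in> hcarrier E \<Longrightarrow> y \<in> hcarrier E \<Longrightarrow> x - y \<in> hcarrier E"
  using subspace by (rule cvec.subspace_diff)

lemma scaleC_carrier: "x \<in> hcarrier E \<Longrightarrow> c *\<^sub>C x \<in> hcarrier E"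
  using subspace by (rule cvec.subspace_scale)

lemma add_carrier: "x \<in> hcarrier E \<Longrightarrow> y \<in> hcarrier E \<Longrightarrow> x + y \<in> hcarrier E"
  using subspace by (rule cvec.subspace_add)

lemma inner_add_right: "\<lbrakk>x \<in> hcarrier E; y \<in> hcarrier E; z \<in> hcarrier E\<rbrakk> \<Longrightarrow>
    hinner E z (x + y) = hinner E z x + hinner E z y"
  by (metis inner_commute inner_add_left add_carrier complex_cnj_add)

lemma inner_scaleC_right: "\<lbrakk>x \<in> hcarrier E; y \<in> hcarrier E\<rbrakk> \<Longrightarrow>
    hinner E x (c *\<^sub>C y) = cnj c * hinner E x y"
  by (metis inner_commute inner_scaleC_left scaleC_carrier complex_cnj_mult)

lemma inner_self: "x \<in> hcarrier E \<Longrightarrow> hinner E x x = of_real ((hnorm E x)\<^sup>2)"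
  using inner_commute[of x x] inner_nonneg[of x]
  by (auto simp: hnorm_def complex_eq_iff)

lemma inner_lincomb:
  assumes "x \<in> hcarrier E" "y \<in> hcarrier E"
  shows "hinner E (x + c *\<^sub>C y) (x + c *\<^sub>C y) =
    hinner E x x + cnj c * hinner E x y + c * cnj (hinner E x y) + c * cnj c * hinner E y y"
  using assms inner_commute[OF assms]
  by (simp add: inner_add_left inner_add_right inner_scaleC_left inner_scaleC_right
      add_carrier scaleC_carrier algebra_simps)

lemma Cauchy_Schwarz:
  assumes x: "x \<in> hcarrier E" and y: "y \<in> hcarrier E"
  shows "cmod (hinner E x y) \<le> hnorm E x * hnorm E y"
proof (cases "y = 0")
  case True
  then have "hinner E x y = 0" "hinner E y y = 0"
    using inner_scaleC_right[OF x y, of 0] inner_scaleC_right[OF y y, of 0] by auto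
  then show ?thesis by (simp add: hnorm_def)
next
  case False
  let ?a = "(hnorm E x)\<^sup>2" and ?b = "(hnorm E y)\<^sup>2" and ?p = "hinner E x y"
  have b: "?b > 0"
    using False inner_eq_zero[OF y] inner_self[OF y] by auto
  define c where "c = - ?p / of_real ?b"
  have "hinner E (x + c *\<^sub>C y) (x + c *\<^sub>C y) = of_real (?a - (cmod ?p)\<^sup>2 / ?b)"
    unfolding inner_lincomb[OF x y] inner_self[OF x] inner_self[OF y] c_def
    using b complex_norm_square[of ?p] by (simp add: field_simps power2_eq_square)
  then have "0 \<le> ?a - (cmod ?p)\<^sup>2 / ?b"
    using inner_nonneg[of "x + c *\<^sub>C y"] x y add_carrier scaleC_carrier by simp
  then have "(cmod ?p)\<^sup>2 \<le> (hnorm E x * hnorm E y)\<^sup>2"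
    using b by (simp add: field_simps)
  moreover have "0 \<le> hnorm E x * hnorm E y"
    using inner_nonneg[OF x] inner_nonneg[OF y] by (simp add: hnorm_def)
  ultimately show ?thesis by (rule power2_le_imp_le)
qed

lemma hnorm_nonneg: "x \<in> hcarrier E \<Longrightarrow> 0 \<le> hnorm E x"
  using inner_nonneg by (simp add: hnorm_def)

lemma hnorm_triangle:
  assumes x: "x \<in> hcarrier E" and y: "y \<in> hcarrier E"
  shows "hnorm E (x + y) \<le> hnorm E x + hnorm E y"
proof (rule power2_le_imp_le)
  have "complex_of_real ((hnorm E (x + y))\<^sup>2) = hinner E (x + 1 *\<^sub>C y) (x + 1 *\<^sub>C y)"
    using inner_self[OF add_carrier[OF x y]] by (simp add: scaleC_one)
  also have "\<dots> = of_real ((hnorm E x)\<^sup>2 + 2 * Re (hinner E x y) + (hnorm E y)\<^sup>2)"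
    unfolding inner_lincomb[OF x y] inner_self[OF x] inner_self[OF y]
    by (simp add: complex_eq_iff)
  finally have "(hnorm E (x + y))\<^sup>2 = (hnorm E x)\<^sup>2 + 2 * Re (hinner E x y) + (hnorm E y)\<^sup>2"
    by (simp only: of_real_eq_iff)
  then show "(hnorm E (x + y))\<^sup>2 \<le> (hnorm E x + hnorm E y)\<^sup>2"
    using order_trans[OF complex_Re_le_cmod Cauchy_Schwarz[OF x y]]
    by (simp add: power2_sum)
qed (simp add: hnorm_nonneg x y)

lemma Metric_space: "Metric_space (hcarrier E) (hdist E)"
proof
  show "0 \<le> hdist E x y" for x y
    by (simp add: hdist_def hnorm_nonneg diff_carrier)
  show "hdist E x y = hdist E y x" for x y
  proof (cases "x \<in> hcarrier E \<and> y \<in> hcarrier E")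
    case True
    then have d: "y - x \<in> hcarrier E" by (simp add: diff_carrier)
    have "x - y = (- 1) *\<^sub>C (y - x)" by simp
    then have "hinner E (x - y) (x - y) = hinner E (y - x) (y - x)"
      using inner_scaleC_left[OF d scaleC_carrier[OF d], of "-1" "-1"]
        inner_scaleC_right[OF d d, of "-1"] by simp
    then show ?thesis using True by (simp add: hdist_def hnorm_def)
  qed (auto simp: hdist_def)
  show "hdist E x y = 0 \<longleftrightarrow> x = y" if "x \<in> hcarrier E" "y \<in> hcarrier E" for x y
  proof -
    have "hinner E 0 0 = 0"
      using inner_scaleC_left[of 0 0 0] cvec.subspace_0[OF subspace] by simp
    then show ?thesis
      using that inner_self[OF diff_carrier[OF that]] inner_eq_zero[OF diff_carrier[OF that]]
      by (auto simp: hdist_def hnorm_def)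
  qed
  show "hdist E x z \<le> hdist E x y + hdist E y z"
    if "x \<in> hcarrier E" "y \<in> hcarrier E" "z \<in> hcarrier E" for x y z
    using that hnorm_triangle[of "x - y" "y - z"] by (simp add: hdist_def diff_carrier)
qed

end


section \<open>Bounded operators\<close>

text \<open>Only the values of an operator on the carrier of its domain are meaningful.\<close>

definition bounded_op :: "'a::complex_vector hilbert \<Rightarrow> 'b::complex_vector hilbert \<Rightarrow> ('a \<Rightarrow> 'b) \<Rightarrow> bool"
  where "bounded_op E K A \<longleftrightarrow>
    (\<forall>x\<in>hcarrier E. A x \<in> hcarrier K) \<and>
    (\<forall>x\<in>hcarrier E. \<forall>y\<in>hcarrier E. A (x + y) = A x + A y) \<and>
    (\<forall>c. \<forall>x\<in>hcarrier E. A (c *\<^sub>C x) = c *\<^sub>C A x) \<and>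
    (\<exists>M. \<forall>x\<in>hcarrier E. hnorm K (A x) \<le> M * hnorm E x)"

definition op_norm :: "'a::complex_vector hilbert \<Rightarrow> 'b::complex_vector hilbert \<Rightarrow> ('a \<Rightarrow> 'b) \<Rightarrow> real"
  where "op_norm E K A = Sup {hnorm K (A x) |x. x \<in> hcarrier E \<and> hnorm E x \<le> 1}"

definition adjoint_op :: "'a::complex_vector hilbert \<Rightarrow> 'b::complex_vector hilbert \<Rightarrow> ('a \<Rightarrow> 'b) \<Rightarrow> 'b \<Rightarrow> 'a"
  where "adjoint_op E K A y =
    (if y \<in> hcarrier K
     then THE x. x \<in> hcarrier E \<and> (\<forall>u\<in>hcarrier E. hinner K (A u) y = hinner E u x)
     else 0)"

definition positive_op :: "'a::complex_vector hilbert \<Rightarrow> ('a \<Rightarrow> 'a) \<Rightarrow> bool"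
  where "positive_op E A \<longleftrightarrow>
    bounded_op E E A \<and> (\<forall>x\<in>hcarrier E. hinner E (A x) x \<in> \<real>\<^sub>\<ge>\<^sub>0)"

text \<open>The condition off the carrier makes the positive square root unique as a HOL function.\<close>

definition sqrt_op :: "'a::complex_vector hilbert \<Rightarrow> ('a \<Rightarrow> 'a) \<Rightarrow> 'a \<Rightarrow> 'a"
  where "sqrt_op E A = (THE S. positive_op E S \<and>
    (\<forall>x\<in>hcarrier E. S (S x) = A x) \<and> (\<forall>x. x \<notin> hcarrier E \<longrightarrow> S x = 0))"

definition unitary_op :: "'a::complex_vector hilbert \<Rightarrow> ('a \<Rightarrow> 'a) \<Rightarrow> bool"
  where "unitary_op E U \<longleftrightarrow> bounded_op E E U \<and>
    (\<forall>x\<in>hcarrier E. adjoint_op E E U (U x) = x \<and> U (adjoint_op E E U x) = x)"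

definition proj_op :: "'a::complex_vector hilbert \<Rightarrow> 'a set \<Rightarrow> 'a \<Rightarrow> 'a"
  where "proj_op E F x = (THE y. y \<in> F \<and> (\<forall>v\<in>F. hinner E (x - y) v = 0))"

definition orth_kernel :: "'a::complex_vector hilbert \<Rightarrow> ('a \<Rightarrow> 'b::complex_vector) \<Rightarrow> 'a set"
  where "orth_kernel H A = {h \<in> hcarrier H. \<forall>k\<in>hcarrier H. A k = 0 \<longrightarrow> hinner H h k = 0}"

definition range_space :: "'a::complex_vector hilbert \<Rightarrow> ('a \<Rightarrow> 'b::complex_vector) \<Rightarrow> 'b hilbert"
  where "range_space H A =
    \<lparr> hcarrier = A ` hcarrier H,
      hinner = (\<lambda>u v. THE c. \<exists>h1\<in>orth_kernel H A. \<exists>h2\<in>hcarrier H.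
                  A h1 = u \<and> A h2 = v \<and> c = hinner H h1 h2) \<rparr>"


section \<open>Vector-valued weighted Bergman spaces\<close>

abbreviation unit_disk :: "complex set"
  where "unit_disk \<equiv> ball 0 1"

definition has_power_series ::
    "'a::complex_vector hilbert \<Rightarrow> (complex \<Rightarrow> 'a) \<Rightarrow> (nat \<Rightarrow> 'a) \<Rightarrow> bool"
  where "has_power_series E f a \<longleftrightarrow> (\<forall>n. a n \<in> hcarrier E) \<and>
    (\<forall>z\<in>unit_disk. limitin (htopology E) (\<lambda>N. \<Sum>n<N. z ^ n *\<^sub>C a n) (f z) sequentially)"

definition taylor_coeffs :: "'a::complex_vector hilbert \<Rightarrow> (complex \<Rightarrow> 'a) \<Rightarrow> nat \<Rightarrow> 'a"
  where "taylor_coeffs E f = (THE a. has_power_series E f a)"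

definition bergman_coeff :: "real \<Rightarrow> nat \<Rightarrow> real"
  where "bergman_coeff \<beta> n = Gamma (real n + \<beta> + 2) / (fact n * Gamma (\<beta> + 2))"

text \<open>These are the Taylor coefficients of the reproducing kernel, as a function of
  $w = z \overline{\zeta}$.\<close>

lemma bergman_coeff_sums:
  assumes "\<beta> > -2" "norm (w::complex) < 1"
  shows "(\<lambda>n. of_real (bergman_coeff \<beta> n) * w ^ n) sums ((1 - w) powr (- of_real (\<beta> + 2)))"
proof -
  let ?b = "complex_of_real (\<beta> + 2)"
  have "of_real (bergman_coeff \<beta> n) * w ^ n = (- ?b gchoose n) * (- w) ^ n" for n
  proof -
    have "\<beta> + 2 \<notin> \<int>\<^sub>\<le>\<^sub>0"
      using assms(1) by (auto elim!: nonpos_Ints_cases)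
    then have "bergman_coeff \<beta> n = pochhammer (\<beta> + 2) n / fact n"
      by (simp add: bergman_coeff_def pochhammer_Gamma add_ac)
    then have "complex_of_real (bergman_coeff \<beta> n) = pochhammer ?b n / fact n"
      by (simp only: pochhammer_of_real of_real_divide of_real_fact)
    also have "\<dots> = (- 1) ^ n * (- ?b gchoose n)"
      by (simp add: gbinomial_pochhammer add.commute)
    finally show ?thesis
      by (simp add: power_minus[of w] ac_simps)
  qed
  then show ?thesis
    using gen_binomial_complex[of "- w" "- ?b"] assms(2) by simp
qed

text \<open>
  Functions on the disk are represented by functions on the whole plane that vanish off the disk.
  Since the coefficients of the reproducing kernel are those above, the inner product
  that it determines is the weighted sum of the inner products of the Taylor coefficients.
\<close>

definition bergman_space :: "real \<Rightarrow> 'a::complex_vector hilbert \<Rightarrow> (complex \<Rightarrow> 'a) hilbert"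
  where "bergman_space \<beta> E =
    \<lparr> hcarrier = {f. (\<forall>z. z \<notin> unit_disk \<longrightarrow> f z = 0) \<and>
        (\<exists>a. has_power_series E f a \<and> summable (\<lambda>n. (hnorm E (a n))\<^sup>2 / bergman_coeff \<beta> n))},
      hinner = (\<lambda>f g. \<Sum>n. hinner E (taylor_coeffs E f n) (taylor_coeffs E g n) /
                            of_real (bergman_coeff \<beta> n)) \<rparr>"


section \<open>Contractive analytic operator functions\<close>

definition schur_class :: "'a::complex_vector hilbert \<Rightarrow> (complex \<Rightarrow> 'a \<Rightarrow> 'a) \<Rightarrow> bool"
  where "schur_class E B \<longleftrightarrow>
    (\<forall>z\<in>unit_disk. bounded_op E E (B z) \<and> op_norm E E (B z) \<le> 1) \<and>
    (\<forall>z\<in>unit_disk. \<exists>D. bounded_op E E D \<and>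
       ((\<lambda>w. op_norm E E (\<lambda>x. (1 / (w - z)) *\<^sub>C (B w x - B z x) - D x)) \<longlongrightarrow> 0) (at z))"

definition has_radial_limit ::
    "'a::complex_vector hilbert \<Rightarrow> (complex \<Rightarrow> 'a \<Rightarrow> 'a) \<Rightarrow> complex \<Rightarrow> ('a \<Rightarrow> 'a) \<Rightarrow> bool"
  where "has_radial_limit E B z T \<longleftrightarrow> bounded_op E E T \<and>
    (\<forall>x\<in>hcarrier E. limitin (htopology E) (\<lambda>r. B (of_real r * z) x) (T x) (at_left (1::real)))"

definition mult_op ::
    "(complex \<Rightarrow> 'a \<Rightarrow> 'a) \<Rightarrow> (complex \<Rightarrow> 'a::complex_vector) \<Rightarrow> complex \<Rightarrow> 'a"
  where "mult_op B f = (\<lambda>z. if z \<in> unit_disk then B z (f z) else 0)"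

definition mult_op_adj :: "real \<Rightarrow> 'a::complex_vector hilbert \<Rightarrow> (complex \<Rightarrow> 'a \<Rightarrow> 'a) \<Rightarrow>
    (complex \<Rightarrow> 'a) \<Rightarrow> complex \<Rightarrow> 'a"
  where "mult_op_adj \<alpha> E B = adjoint_op (bergman_space \<alpha> E) (bergman_space \<alpha> E) (mult_op B)"

definition sub_bergman :: "real \<Rightarrow> 'a::complex_vector hilbert \<Rightarrow> (complex \<Rightarrow> 'a \<Rightarrow> 'a) \<Rightarrow>
    (complex \<Rightarrow> 'a) hilbert"
  where "sub_bergman \<alpha> E B =
    range_space (bergman_space \<alpha> E)
      (sqrt_op (bergman_space \<alpha> E) (\<lambda>f. f - mult_op B (mult_op_adj \<alpha> E B f)))"

definition sub_bergman_star :: "real \<Rightarrow> 'a::complex_vector hilbert \<Rightarrow> (complex \<Rightarrow> 'a \<Rightarrow> 'a) \<Rightarrow>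
    (complex \<Rightarrow> 'a) hilbert"
  where "sub_bergman_star \<alpha> E B =
    range_space (bergman_space \<alpha> E)
      (sqrt_op (bergman_space \<alpha> E) (\<lambda>f. f - mult_op_adj \<alpha> E B (mult_op B f)))"


section \<open>Finite Blaschke-Potapov products\<close>

definition blaschke :: "complex \<Rightarrow> complex \<Rightarrow> complex"
  where "blaschke a z = (z - a) / (1 - cnj a * z)"

definition bp_factor ::
    "'a::complex_vector hilbert \<Rightarrow> complex \<Rightarrow> 'a set \<Rightarrow> complex \<Rightarrow> 'a \<Rightarrow> 'a"
  where "bp_factor E a F z x = blaschke a z *\<^sub>C (x - proj_op E F x) + proj_op E F x"

text \<open>The list \<open>ps\<close> holds the pairs \<open>(a\<^sub>i, F\<^sub>i)\<close>; \<^const>\<open>foldr\<close> multiplies the factors from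
  left to right. The empty product, a constant unitary, is included.\<close>

definition finite_bp_product :: "'a::complex_vector hilbert \<Rightarrow> (complex \<Rightarrow> 'a \<Rightarrow> 'a) \<Rightarrow> bool"
  where "finite_bp_product E B \<longleftrightarrow>
    (\<exists>U ps. unitary_op E U \<and>
       (\<forall>(a, F)\<in>set ps. a \<in> unit_disk \<and> closed_subspace E F \<and> F \<noteq> hcarrier E) \<and>
       (\<forall>z\<in>unit_disk. \<forall>x\<in>hcarrier E.
          B z x = U (foldr (\<lambda>(a, F). bp_factor E a F z) ps x)))"

end

theory Submission
  imports Defs
begin

text \<open>
  The space is \<open>\<ell>\<^sup>2\<close> and \<open>B(z)\<close> is the diagonal operator whose entries are the Blaschke factors
  with the zeros \<open>a\<^sub>n = 1/(n+2)\<close>. Everything but the two descriptions of ranges is then checked entry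
  by entry, with bounds that are uniform because the zeros stay in the disk of radius \<open>1/2\<close>. The
  operator \<open>B(a\<^sub>n)\<close> kills the \<open>n\<close>-th unit vector, whereas a finite Blaschke-Potapov product is injective
  at all but finitely many points (\<open>finite_bp_product_injective\<close>); there are infinitely many zeros,
  so \<open>B\<close> is not such a product.

  For the ranges, let \<open>A\<close> be the diagonal operator with entries \<open>a\<^sub>n\<close>. It is self-adjoint of norm at
  most \<open>1/2\<close>, and \<open>B(z) = (z - A)(1 - zA)\<^sup>-\<^sup>1\<close>. The equalities of sets hold
  over every Hilbert space \<open>E\<close> and for every such \<open>A\<close> (\<open>sub_bergman_carrier\<close>). Let \<open>Z\<close> be
  multiplication by \<open>z\<close> on \<open>A\<^sup>2\<^sub>\<alpha>\<close>, so that \<open>T = T\<^sub>B = (Z - A)(1 - AZ)\<^sup>-\<^sup>1\<close>, and \<open>T\<^sup>*\<close> is the same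
  expression in \<open>Z\<^sup>*\<close>. Two ideas carry the proof.

  First, for a positive contraction \<open>P\<close> the range of \<open>P\<^sup>1\<^sup>/\<^sup>2\<close> consists of the vectors \<open>f\<close> for which
  \<open>|\<langle>f,g\<rangle>|\<^sup>2 \<le> C \<langle>Pg,g\<rangle>\<close> holds for all \<open>g\<close> with some constant \<open>C\<close> (\<open>range_sqroot\<close>). So only the
  quadratic form of \<open>P\<close> matters, and only up to constant factors.

  Second, for \<open>P = 1 - T\<^sup>*T\<close> the substitution \<open>g = (1 - AZ)k\<close> cancels the mixed terms:
  \<open>\<langle>Pg,g\<rangle> = (\<parallel>k\<parallel>\<^sup>2 - \<parallel>Zk\<parallel>\<^sup>2) - (\<parallel>Ak\<parallel>\<^sup>2 - \<parallel>ZAk\<parallel>\<^sup>2)\<close> (\<open>moebius_defect\<close>). The second bracket is at most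
  a quarter of the first, and the first is diagonal in the Taylor coefficients: with
  \<open>c\<^sub>n = bergman_coeff \<alpha> n\<close> it equals \<open>\<Sum> \<parallel>k\<^sub>n\<parallel>\<^sup>2 (1/c\<^sub>n - 1/c\<^sub>n\<^sub>+\<^sub>1)\<close>, where the weights are comparable to
  \<open>1/((n+1) c\<^sub>n)\<close>. Since \<open>\<langle>f,g\<rangle> = \<langle>(1 - AZ\<^sup>*)f,k\<rangle>\<close>, the Cauchy-Schwarz inequality, which is sharp for
  diagonal forms, shows that \<open>f\<close> lies in the range iff \<open>\<Sum> \<parallel>h\<^sub>n\<parallel>\<^sup>2 (n+1)/c\<^sub>n\<close> is finite for
  \<open>h = (1 - AZ\<^sup>*)f\<close>, that is, iff \<open>h\<close> belongs to \<open>A\<^sup>2\<^sub>\<alpha>\<^sub>-\<^sub>1\<close>. The equation \<open>h = f - AZ\<^sup>*f\<close> is a recursion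
  for the coefficients with ratio at most \<open>1/2\<close>, and it transports this summability between \<open>f\<close> and
  \<open>h\<close> (\<open>backward_iff\<close>). For \<open>1 - TT\<^sup>*\<close> the roles of \<open>Z\<close> and \<open>Z\<^sup>*\<close> are exchanged (\<open>forward_iff\<close>).
\<close>

section \<open>Hilbert spaces given by a carrier\<close>

context pre_hilbert_space
begin

lemma zero_carrier [simp]: "0 \<in> hcarrier E"
  using subspace by (rule cvec.subspace_0)

lemma sum_carrier: "(\<And>i. i \<in> I \<Longrightarrow> f i \<in> hcarrier E) \<Longrightarrow> sum f I \<in> hcarrier E"
  using subspace by (rule cvec.subspace_sum)

declare add_carrier [simp] diff_carrier [simp] scaleC_carrier [simp]

lemma inner_zero_left [simp]: "x \<in> hcarrier E \<Longrightarrow> hinner E 0 x = 0"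
  using inner_scaleC_left[of 0 x 0] by simp

lemma inner_zero_right [simp]: "x \<in> hcarrier E \<Longrightarrow> hinner E x 0 = 0"
  using inner_scaleC_right[of x 0 0] by simp

lemma inner_diff_left:
  assumes "x \<in> hcarrier E" "y \<in> hcarrier E" "z \<in> hcarrier E"
  shows "hinner E (x - y) z = hinner E x z - hinner E y z"
  using inner_add_left[of "x - y" y z] assms by simp

lemma inner_diff_right:
  assumes "x \<in> hcarrier E" "y \<in> hcarrier E" "z \<in> hcarrier E"
  shows "hinner E z (x - y) = hinner E z x - hinner E z y"
  using inner_add_right[of "x - y" y z] assms by simp

lemma inner_sum_left:
  assumes "\<And>i. i \<in> I \<Longrightarrow> f i \<in> hcarrier E" "z \<in> hcarrier E"
  shows "hinner E (sum f I) z = (\<Sum>i\<in>I. hinner E (f i) z)"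
  using assms
  by (induction I rule: infinite_finite_induct) (auto simp: inner_add_left sum_carrier)

lemma inner_sum_right:
  assumes "\<And>i. i \<in> I \<Longrightarrow> f i \<in> hcarrier E" "z \<in> hcarrier E"
  shows "hinner E z (sum f I) = (\<Sum>i\<in>I. hinner E z (f i))"
  using assms
  by (induction I rule: infinite_finite_induct) (auto simp: inner_add_right sum_carrier)

lemma hnorm_sq: "x \<in> hcarrier E \<Longrightarrow> (hnorm E x)\<^sup>2 = Re (hinner E x x)"
  using inner_nonneg by (simp add: hnorm_def)

lemma hnorm_zero [simp]: "hnorm E 0 = 0"
  by (simp add: hnorm_def)

lemma hnorm_eq_0_iff: "x \<in> hcarrier E \<Longrightarrow> hnorm E x = 0 \<longleftrightarrow> x = 0"
  using inner_self inner_eq_zero by fastforce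

lemma hnorm_scaleC: "x \<in> hcarrier E \<Longrightarrow> hnorm E (c *\<^sub>C x) = cmod c * hnorm E x"
proof -
  assume x: "x \<in> hcarrier E"
  have "hinner E (c *\<^sub>C x) (c *\<^sub>C x) = (c * cnj c) * hinner E x x"
    using x by (simp add: inner_scaleC_left inner_scaleC_right)
  also have "\<dots> = of_real ((cmod c * hnorm E x)\<^sup>2)"
    using x by (simp add: inner_self complex_norm_square[symmetric] power_mult_distrib)
  finally show ?thesis
    using hnorm_nonneg[OF x] by (simp add: hnorm_def real_sqrt_mult)
qed

lemma hnorm_commute:
  "x \<in> hcarrier E \<Longrightarrow> y \<in> hcarrier E \<Longrightarrow> hnorm E (x - y) = hnorm E (y - x)"
  using hnorm_scaleC[of "y - x" "-1"] by simp

lemma hnorm_diff_triangle: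
  assumes "x \<in> hcarrier E" "y \<in> hcarrier E"
  shows "hnorm E (x - y) \<le> hnorm E x + hnorm E y"
  using hnorm_triangle[of x "- 1 *\<^sub>C y"] hnorm_scaleC[of y "-1"] scaleC_carrier[of y "-1"] assms by simp

lemma hnorm_sum_le:
  assumes "\<And>i. i \<in> I \<Longrightarrow> f i \<in> hcarrier E"
  shows "hnorm E (sum f I) \<le> (\<Sum>i\<in>I. hnorm E (f i))"
  using assms
proof (induction I rule: infinite_finite_induct)
  case (insert i I)
  have "hnorm E (f i + sum f I) \<le> hnorm E (f i) + hnorm E (sum f I)"
    using insert by (intro hnorm_triangle sum_carrier) auto
  then show ?case using insert by fastforce
qed auto

lemma hnorm_add_sq:
  assumes "x \<in> hcarrier E" "y \<in> hcarrier E"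
  shows "(hnorm E (x + y))\<^sup>2 = (hnorm E x)\<^sup>2 + 2 * Re (hinner E x y) + (hnorm E y)\<^sup>2"
  using assms inner_commute[OF assms]
  by (simp add: hnorm_sq inner_add_left inner_add_right)

lemma hnorm_diff_sq:
  assumes "x \<in> hcarrier E" "y \<in> hcarrier E"
  shows "(hnorm E (x - y))\<^sup>2 = (hnorm E x)\<^sup>2 - 2 * Re (hinner E x y) + (hnorm E y)\<^sup>2"
  using assms inner_commute[OF assms]
  by (simp add: hnorm_sq inner_diff_left inner_diff_right)

lemma inner_eqI:
  assumes "x \<in> hcarrier E" "y \<in> hcarrier E"
    and "\<And>v. v \<in> hcarrier E \<Longrightarrow> hinner E x v = hinner E y v"
  shows "x = y"
  using inner_eq_zero[of "x - y"] assms by (simp add: inner_diff_left)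

lemma inner_eqI_right:
  assumes "x \<in> hcarrier E" "y \<in> hcarrier E"
    and "\<And>v. v \<in> hcarrier E \<Longrightarrow> hinner E v x = hinner E v y"
  shows "x = y"
  using inner_eq_zero[of "x - y"] assms by (simp add: inner_diff_right)

lemma limitin_iff:
  "limitin (htopology E) f l F \<longleftrightarrow>
     l \<in> hcarrier E \<and> (\<forall>\<^sub>F n in F. f n \<in> hcarrier E) \<and> ((\<lambda>n. hnorm E (f n - l)) \<longlongrightarrow> 0) F"
proof -
  interpret M: Metric_space "hcarrier E" "hdist E" by (rule Metric_space)
  have "((\<lambda>n. hdist E (f n) l) \<longlongrightarrow> 0) F \<longleftrightarrow> ((\<lambda>n. hnorm E (f n - l)) \<longlongrightarrow> 0) F"
    if "l \<in> hcarrier E" "\<forall>\<^sub>F n in F. f n \<in> hcarrier E"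
    using that by (intro tendsto_cong) (auto elim!: eventually_mono simp: hdist_def)
  then show ?thesis
    unfolding htopology_def M.limitin_metric_dist_null by blast
qed

lemma limitinI:
  assumes "l \<in> hcarrier E" "\<And>n. f n \<in> hcarrier E" "((\<lambda>n. hnorm E (f n - l)) \<longlongrightarrow> 0) F"
  shows "limitin (htopology E) f l F"
  using assms by (simp add: limitin_iff)

lemma limitin_carrier: "limitin (htopology E) f l F \<Longrightarrow> l \<in> hcarrier E"
  by (simp add: limitin_iff)

lemma limitin_inner_left:
  assumes f: "limitin (htopology E) f l F" and y: "y \<in> hcarrier E"
  shows "((\<lambda>n. hinner E (f n) y) \<longlongrightarrow> hinner E l y) F"
proof -
  have "((\<lambda>n. hnorm E (f n - l) * hnorm E y) \<longlongrightarrow> 0) F"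
    using f by (auto simp: limitin_iff intro: tendsto_mult_left_zero)
  moreover have "\<forall>\<^sub>F n in F. norm (hinner E (f n) y - hinner E l y) \<le> hnorm E (f n - l) * hnorm E y"
    using f y by (auto simp: limitin_iff inner_diff_left[symmetric] Cauchy_Schwarz elim!: eventually_mono)
  ultimately have "((\<lambda>n. hinner E (f n) y - hinner E l y) \<longlongrightarrow> 0) F"
    by (rule Lim_null_comparison[rotated])
  then show ?thesis by (simp add: LIM_zero_iff)
qed

lemma limit_unique:
  assumes "limitin (htopology E) f l F" "limitin (htopology E) f l' F" "F \<noteq> bot"
  shows "l = l'"
  using limitin_Hausdorff_unique assms Metric_space.Hausdorff_space_mtopology[OF Metric_space]
  unfolding htopology_def by metis

lemma limitin_add:
  assumes f: "limitin (htopology E) f l F" and g: "limitin (htopology E) g m F"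
  shows "limitin (htopology E) (\<lambda>n. f n + g n) (l + m) F"
proof -
  have ev: "\<forall>\<^sub>F n in F. f n \<in> hcarrier E \<and> g n \<in> hcarrier E"
    and lm: "l \<in> hcarrier E" "m \<in> hcarrier E"
    using f g by (auto simp: limitin_iff eventually_conj)
  have "((\<lambda>n. hnorm E (f n - l) + hnorm E (g n - m)) \<longlongrightarrow> 0) F"
    using tendsto_add[of "\<lambda>n. hnorm E (f n - l)" 0 F "\<lambda>n. hnorm E (g n - m)" 0] f g
    by (auto simp: limitin_iff)
  moreover have "\<forall>\<^sub>F n in F. norm (hnorm E (f n + g n - (l + m))) \<le> hnorm E (f n - l) + hnorm E (g n - m)"
    using ev
  proof (rule eventually_mono)
    fix n assume n: "f n \<in> hcarrier E \<and> g n \<in> hcarrier E"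
    have "f n + g n - (l + m) = (f n - l) + (g n - m)" by simp
    then show "norm (hnorm E (f n + g n - (l + m))) \<le> hnorm E (f n - l) + hnorm E (g n - m)"
      using hnorm_triangle[of "f n - l" "g n - m"] n lm by (simp only:) (simp add: hnorm_nonneg del: add_diff_eq)
  qed
  ultimately have "((\<lambda>n. hnorm E (f n + g n - (l + m))) \<longlongrightarrow> 0) F"
    by (rule Lim_null_comparison[rotated])
  then show ?thesis using ev lm by (auto simp: limitin_iff elim: eventually_mono)
qed

lemma limitin_hnorm:
  assumes f: "limitin (htopology E) f l F"
  shows "((\<lambda>n. hnorm E (f n)) \<longlongrightarrow> hnorm E l) F"
proof -
  have ev: "\<forall>\<^sub>F n in F. f n \<in> hcarrier E" and l: "l \<in> hcarrier E"
    using f by (auto simp: limitin_iff)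
  have "\<forall>\<^sub>F n in F. norm (hnorm E (f n) - hnorm E l) \<le> hnorm E (f n - l)"
    using ev
  proof (rule eventually_mono)
    fix n assume n: "f n \<in> hcarrier E"
    show "norm (hnorm E (f n) - hnorm E l) \<le> hnorm E (f n - l)"
      using hnorm_triangle[of "f n - l" l] hnorm_triangle[of "l - f n" "f n"]
        hnorm_commute[of l "f n"] n l by (simp add: abs_if)
  qed
  then have "((\<lambda>n. hnorm E (f n) - hnorm E l) \<longlongrightarrow> 0) F"
    using f by (auto simp: limitin_iff intro: Lim_null_comparison)
  then show ?thesis by (simp add: LIM_zero_iff)
qed

end

lemma bounded_opD:
  assumes "bounded_op E K A"
  shows "x \<in> hcarrier E \<Longrightarrow> A x \<in> hcarrier K"
    and "x \<in> hcarrier E \<Longrightarrow> y \<in> hcarrier E \<Longrightarrow> A (x + y) = A x + A y"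
    and "x \<in> hcarrier E \<Longrightarrow> A (c *\<^sub>C x) = c *\<^sub>C A x"
  using assms by (auto simp: bounded_op_def)

context pre_hilbert_space
begin

lemma op_zero: "bounded_op E K A \<Longrightarrow> A 0 = 0"
  using bounded_opD(3)[of E K A 0 0] by simp

lemma op_diff:
  assumes "bounded_op E K A" "x \<in> hcarrier E" "y \<in> hcarrier E"
  shows "A (x - y) = A x - A y"
  using bounded_opD(2)[OF assms(1), of "x - y" y] assms by simp

lemma op_sum:
  assumes "bounded_op E K A" "\<And>i. i \<in> I \<Longrightarrow> f i \<in> hcarrier E"
  shows "A (sum f I) = (\<Sum>i\<in>I. A (f i))"
  using assms(2)
  by (induction I rule: infinite_finite_induct)
     (auto simp: op_zero[OF assms(1)] bounded_opD(2)[OF assms(1)] sum_carrier)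

lemma limitin_op:
  assumes A: "bounded_op E E A" and f: "limitin (htopology E) f l F"
  shows "limitin (htopology E) (\<lambda>n. A (f n)) (A l) F"
proof -
  obtain M where M: "\<And>x. x \<in> hcarrier E \<Longrightarrow> hnorm E (A x) \<le> M * hnorm E x"
    using A unfolding bounded_op_def by blast
  have l: "l \<in> hcarrier E" and ev: "\<forall>\<^sub>F n in F. f n \<in> hcarrier E"
    using f by (auto simp: limitin_iff)
  have "((\<lambda>n. M * hnorm E (f n - l)) \<longlongrightarrow> 0) F"
    using f by (auto simp: limitin_iff intro: tendsto_mult_right_zero)
  moreover have "\<forall>\<^sub>F n in F. norm (hnorm E (A (f n) - A l)) \<le> M * hnorm E (f n - l)"
    using ev
    by eventually_elim (use M[of "_ - l"] l A in \<open>simp add: op_diff[OF A, symmetric] hnorm_nonneg bounded_opD(1)[OF A]\<close>)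
  ultimately have "((\<lambda>n. hnorm E (A (f n) - A l)) \<longlongrightarrow> 0) F"
    by (rule Lim_null_comparison[rotated])
  then show ?thesis
    using l ev by (auto simp: limitin_iff bounded_opD(1)[OF A] elim: eventually_mono)
qed

lemma adjoint_op_eqI:
  assumes "y \<in> hcarrier K" "x \<in> hcarrier E"
    and "\<And>u. u \<in> hcarrier E \<Longrightarrow> hinner K (A u) y = hinner E u x"
  shows "adjoint_op E K A y = x"
proof -
  have "(THE x. x \<in> hcarrier E \<and> (\<forall>u\<in>hcarrier E. hinner K (A u) y = hinner E u x)) = x"
    by (rule the_equality) (use assms in \<open>auto intro!: inner_eqI_right\<close>)
  then show ?thesis using assms by (simp add: adjoint_op_def)
qed

end

context hilbert_space
begin

lemma complete_limit:
  assumes x: "\<And>n. x n \<in> hcarrier E"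
    and cauchy: "\<And>e. e > 0 \<Longrightarrow> \<exists>N. \<forall>n\<ge>N. \<forall>m\<ge>n. hnorm E (x m - x n) < e"
  shows "\<exists>l. limitin (htopology E) x l sequentially"
proof -
  interpret M: Metric_space "hcarrier E" "hdist E" by (rule Metric_space)
  have "M.MCauchy x"
    unfolding M.MCauchy_def
  proof (intro conjI allI impI)
    fix e :: real assume "e > 0"
    then obtain N where N: "\<And>m n. N \<le> n \<Longrightarrow> n \<le> m \<Longrightarrow> hnorm E (x m - x n) < e"
      using cauchy by blast
    have "hdist E (x n) (x m) < e" if "N \<le> n" "N \<le> m" for n m
      using N[of n m] N[of m n] hnorm_commute[OF x x, of n m] that x
      by (cases "n \<le> m") (auto simp: hdist_def)
    then show "\<exists>N. \<forall>n m. N \<le> n \<longrightarrow> N \<le> m \<longrightarrow> hdist E (x n) (x m) < e" by blast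
  qed (use x in auto)
  then show ?thesis
    using complete unfolding M.mcomplete_def htopology_def by blast
qed

lemma summable_hnorm_limit:
  assumes x: "\<And>n. x n \<in> hcarrier E" and sm: "summable (\<lambda>n. hnorm E (x n))"
  shows "\<exists>l. limitin (htopology E) (\<lambda>N. \<Sum>n<N. x n) l sequentially"
proof (rule complete_limit)
  show "(\<Sum>n<N. x n) \<in> hcarrier E" for N using x by (intro sum_carrier)
  fix e :: real assume "e > 0"
  then obtain N where N: "\<And>m n. m \<ge> N \<Longrightarrow> norm (sum (\<lambda>n. hnorm E (x n)) {m..<n}) < e"
    using sm unfolding summable_Cauchy by blast
  have *: "hnorm E ((\<Sum>i<n. x i) - (\<Sum>i<m. x i)) < e" if "m \<ge> N" "m \<le> n" for m n
  proof -
    have "(\<Sum>i<n. x i) - (\<Sum>i<m. x i) = (\<Sum>i=m..<n. x i)"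
      using that by (simp add: lessThan_atLeast0 sum_diff_nat_ivl)
    then have "hnorm E ((\<Sum>i<n. x i) - (\<Sum>i<m. x i)) \<le> (\<Sum>i=m..<n. hnorm E (x i))"
      using hnorm_sum_le x by metis
    also have "\<dots> < e" using N[OF that(1), of n] by (simp add: abs_less_iff)
    finally show ?thesis .
  qed
  then show "\<exists>N. \<forall>n\<ge>N. \<forall>m\<ge>n. hnorm E ((\<Sum>i<m. x i) - (\<Sum>i<n. x i)) < e" by blast
qed

text \<open>A minimizing sequence for the distance from \<open>x\<close> to \<open>F\<close> is Cauchy by the parallelogram law. The
  theorem is what gives \<^const>\<open>proj_op\<close> its meaning.\<close>

lemma projection_exists:
  assumes F: "closed_subspace E F" and x: "x \<in> hcarrier E"
  shows "\<exists>!y. y \<in> F \<and> (\<forall>v\<in>F. hinner E (x - y) v = 0)"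
proof -
  have FE: "F \<subseteq> hcarrier E" and sub: "cvec.subspace F" and cl: "closedin (htopology E) F"
    using F by (auto simp: closed_subspace_def)
  have [simp]: "v \<in> hcarrier E" if "v \<in> F" for v using FE that by blast
  define d where "d = (INF y\<in>F. (hnorm E (x - y))\<^sup>2)"
  have F0: "0 \<in> F" using sub by (rule cvec.subspace_0)
  have bdd: "bdd_below ((\<lambda>y. (hnorm E (x - y))\<^sup>2) ` F)" by (rule bdd_belowI[of _ 0]) auto
  have d_le: "d \<le> (hnorm E (x - y))\<^sup>2" if "y \<in> F" for y
    unfolding d_def using bdd that by (rule cINF_lower)
  have "\<exists>y\<in>F. (hnorm E (x - y))\<^sup>2 < d + inverse (real (Suc n))" for n
    using cInf_lessD[of "(\<lambda>y. (hnorm E (x - y))\<^sup>2) ` F" "d + inverse (real (Suc n))"] F0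
    unfolding d_def by auto
  then obtain y where yF: "\<And>n. y n \<in> F"
    and y: "\<And>n. (hnorm E (x - y n))\<^sup>2 < d + inverse (real (Suc n))" by metis
  have par: "(hnorm E (y m - y n))\<^sup>2 \<le> 2 * inverse (real (Suc m)) + 2 * inverse (real (Suc n))" for m n
  proof -
    let ?u = "x - y m" and ?v = "x - y n"
    let ?w = "(1/2) *\<^sub>C (y m + y n)"
    have wF: "?w \<in> F" using yF by (intro cvec.subspace_scale[OF sub] cvec.subspace_add[OF sub])
    have "x + x = 2 *\<^sub>C x" using scaleC_add_left[of 1 1 x] by (simp add: scaleC_one)
    then have "?u + ?v = 2 *\<^sub>C (x - ?w)"
      by (simp add: cvec.scale_right_diff_distrib scaleC_scaleC scaleC_one algebra_simps)
    then have "(hnorm E (?u + ?v))\<^sup>2 = 4 * (hnorm E (x - ?w))\<^sup>2"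
      using hnorm_scaleC[of "x - ?w" 2] x wF by (simp add: power_mult_distrib)
    then have "(hnorm E (?u + ?v))\<^sup>2 \<ge> 4 * d" using d_le[OF wF] by simp
    moreover have "(hnorm E (?u + ?v))\<^sup>2 + (hnorm E (?u - ?v))\<^sup>2 = 2 * (hnorm E ?u)\<^sup>2 + 2 * (hnorm E ?v)\<^sup>2"
      using hnorm_add_sq[of ?u ?v] hnorm_diff_sq[of ?u ?v] x yF by simp
    moreover have "hnorm E (?u - ?v) = hnorm E (y m - y n)"
      using hnorm_commute[of "y m" "y n"] yF by simp
    ultimately show ?thesis using y[of m] y[of n] by simp
  qed
  have "\<exists>l. limitin (htopology E) y l sequentially"
  proof (rule complete_limit)
    fix e :: real assume "e > 0"
    then obtain N where N: "inverse (real (Suc N)) < e\<^sup>2 / 4"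
      using reals_Archimedean[of "e\<^sup>2 / 4"] by auto
    show "\<exists>N. \<forall>n\<ge>N. \<forall>m\<ge>n. hnorm E (y m - y n) < e"
    proof (intro exI allI impI)
      fix n m assume mn: "n \<ge> N" "m \<ge> n"
      have "inverse (real (Suc m)) \<le> inverse (real (Suc N))" "inverse (real (Suc n)) \<le> inverse (real (Suc N))"
        using mn by (auto intro!: le_imp_inverse_le)
      then have "(hnorm E (y m - y n))\<^sup>2 < e\<^sup>2" using par[of m n] N by linarith
      then show "hnorm E (y m - y n) < e" using \<open>e > 0\<close> power_less_imp_less_base by fastforce
    qed
  qed (use yF in auto)
  then obtain l where l: "limitin (htopology E) y l sequentially" by blast
  then have lF: "l \<in> F"
    using limitin_closedin[OF l cl] yF by simp
  have "limitin (htopology E) (\<lambda>n. x - y n) (x - l) sequentially"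
  proof (rule limitinI)
    have lE: "l \<in> hcarrier E" using l by (rule limitin_carrier)
    then show "x - l \<in> hcarrier E" "x - y n \<in> hcarrier E" for n using x yF by auto
    have "hnorm E (x - y n - (x - l)) = hnorm E (y n - l)" for n
      using hnorm_commute[OF lE, of "y n"] yF by simp
    then show "(\<lambda>n. hnorm E (x - y n - (x - l))) \<longlonglongrightarrow> 0"
      using l by (simp only: limitin_iff)
  qed
  then have "(\<lambda>n. hnorm E (x - y n)) \<longlonglongrightarrow> hnorm E (x - l)" by (rule limitin_hnorm)
  then have lim: "(\<lambda>n. (hnorm E (x - y n))\<^sup>2) \<longlonglongrightarrow> (hnorm E (x - l))\<^sup>2" by (rule tendsto_power)
  have "(\<lambda>n. d + inverse (real (Suc n))) \<longlonglongrightarrow> d + 0"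
    by (intro tendsto_intros LIMSEQ_inverse_real_of_nat)
  then have le: "(hnorm E (x - l))\<^sup>2 \<le> d"
    using LIMSEQ_le[OF lim] y by (simp add: less_imp_le)
  have orth: "hinner E (x - l) v = 0" if v: "v \<in> F" for v
  proof (rule ccontr)
    assume ne: "hinner E (x - l) v \<noteq> 0"
    let ?p = "hinner E (x - l) v" and ?b = "(hnorm E v)\<^sup>2"
    have "v \<noteq> 0" using ne x lF by auto
    then have b: "?b > 0" using hnorm_eq_0_iff[of v] v by simp
    define c where "c = ?p / of_real ?b"
    have "l + c *\<^sub>C v \<in> F"
      using lF v by (intro cvec.subspace_add[OF sub] cvec.subspace_scale[OF sub])
    then have "d \<le> (hnorm E (x - l - c *\<^sub>C v))\<^sup>2" using d_le by (simp add: diff_diff_eq)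
    also have "\<dots> = (hnorm E (x - l))\<^sup>2 - 2 * Re (cnj c * ?p) + (cmod c)\<^sup>2 * ?b"
      using x lF v by (subst hnorm_diff_sq) (auto simp: inner_scaleC_right hnorm_scaleC power_mult_distrib)
    also have "Re (cnj c * ?p) = (cmod ?p)\<^sup>2 / ?b"
    proof -
      have "cnj c * ?p = (?p * cnj ?p) / of_real ?b"
        by (simp add: c_def)
      also have "\<dots> = of_real ((cmod ?p)\<^sup>2 / ?b)"
        by (simp only: complex_norm_square of_real_divide)
      finally show ?thesis by (simp only: Re_complex_of_real)
    qed
    also have "(cmod c)\<^sup>2 * ?b = (cmod ?p)\<^sup>2 / ?b"
      using b by (simp only: c_def norm_divide power_divide norm_of_real) (simp add: power2_eq_square)
    finally have "(cmod ?p)\<^sup>2 / ?b \<le> 0" using le by simp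
    then show False using b ne by (simp add: divide_le_0_iff)
  qed
  show ?thesis
  proof (rule ex1I[of _ l])
    show "l \<in> F \<and> (\<forall>v\<in>F. hinner E (x - l) v = 0)" using lF orth by blast
    fix y assume y: "y \<in> F \<and> (\<forall>v\<in>F. hinner E (x - y) v = 0)"
    have yl: "y - l \<in> F" using y lF cvec.subspace_diff[OF sub] by blast
    have "hinner E ((x - l) - (x - y)) (y - l) = 0"
      using inner_diff_left[of "x - l" "x - y" "y - l"] x y lF yl orth by simp
    then have "hinner E (y - l) (y - l) = 0" by simp
    then show "y = l" using inner_eq_zero[of "y - l"] yl by simp
  qed
qed

end

section \<open>Square roots of positive contractions\<close>

text \<open>
  The square root of \<open>1 - Y\<close>, where \<open>0 \<le> Y \<le> 1\<close>, is the binomial series \<open>\<Sum> s\<^sub>k Y\<^sup>k\<close> with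
  \<open>\<Sum> s\<^sub>k t\<^sup>k = (1 - t)\<^sup>1\<^sup>/\<^sup>2\<close>. All coefficients but \<open>s\<^sub>0 = 1\<close> are nonpositive and the partial sums
  \<open>\<Sum> s\<^sub>k\<close> are nonnegative. Both facts together give absolute convergence and, since
  \<open>\<langle>Y\<^sup>k x, x\<rangle> \<le> \<parallel>x\<parallel>\<^sup>2\<close>, positivity of the limit.
\<close>

definition sqrt_coeff :: "nat \<Rightarrow> real"
  where "sqrt_coeff k = (- 1) ^ k * (1/2 gchoose k)"

lemma sqrt_coeff_0 [simp]: "sqrt_coeff 0 = 1"
  by (simp add: sqrt_coeff_def)

lemma sqrt_coeff_nonpos: "k > 0 \<Longrightarrow> sqrt_coeff k \<le> 0"
proof -
  assume "k > 0"
  then obtain j where k: "k = Suc j" using gr0_conv_Suc by blast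
  have "sqrt_coeff k = pochhammer (- (1/2)) k / fact k"
    by (simp add: sqrt_coeff_def gbinomial_pochhammer)
  also have "pochhammer (- (1/2) :: real) k = - (1/2) * pochhammer (1/2) j"
    unfolding k pochhammer_rec by simp
  finally show ?thesis
    by (simp add: pochhammer_nonneg divide_nonneg_pos)
qed

text \<open>The partial sums are the coefficients of \<open>(1 - t)\<^sup>1\<^sup>/\<^sup>2 / (1 - t) = (1 - t)\<^sup>-\<^sup>1\<^sup>/\<^sup>2\<close>, which are
  positive.\<close>

lemma sum_sqrt_coeff_nonneg: "0 \<le> (\<Sum>k<n. sqrt_coeff k)"
proof (cases n)
  case (Suc m)
  have "(\<Sum>k\<le>m. sqrt_coeff k) = (- 1) ^ m * (1/2 - 1 gchoose m)"
    using gbinomial_sum_lower_neg[of "1/2::real" m] by (simp add: sqrt_coeff_def mult.commute)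
  also have "\<dots> = pochhammer (1/2) m / fact m"
    by (simp add: gbinomial_pochhammer)
  also have "\<dots> \<ge> 0" by (simp add: pochhammer_nonneg)
  finally show ?thesis by (simp add: Suc lessThan_Suc_atMost)
qed simp

lemma sum_abs_sqrt_coeff_le: "(\<Sum>k<n. \<bar>sqrt_coeff k\<bar>) \<le> 2"
proof (cases n)
  case (Suc m)
  have "(\<Sum>k<n. \<bar>sqrt_coeff k\<bar>) + (\<Sum>k<n. sqrt_coeff k) = (\<Sum>k<n. if k = 0 then 2 else 0)"
    unfolding sum.distrib[symmetric] by (intro sum.cong) (auto simp: sqrt_coeff_nonpos)
  also have "\<dots> = 2" using Suc by (simp add: sum.delta)
  finally show ?thesis using sum_sqrt_coeff_nonneg[of n] by linarith
qed simp

lemma summable_abs_sqrt_coeff: "summable (\<lambda>k. \<bar>sqrt_coeff k\<bar>)"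
  by (rule summableI_nonneg_bounded[OF _ sum_abs_sqrt_coeff_le]) auto

lemma sqrt_coeff_convolution:
  "(\<Sum>i\<le>n. sqrt_coeff i * sqrt_coeff (n - i)) = (if n = 0 then 1 else if n = 1 then -1 else 0)"
proof -
  have "(\<Sum>i\<le>n. sqrt_coeff i * sqrt_coeff (n - i))
      = (\<Sum>i\<le>n. (- 1) ^ n * ((1/2 gchoose i) * (1/2 gchoose (n - i))))"
  proof (intro sum.cong refl)
    fix i assume "i \<in> {..n}"
    then have "(- 1 :: real) ^ n = (- 1) ^ i * (- 1) ^ (n - i)"
      by (simp add: power_add[symmetric])
    then show "sqrt_coeff i * sqrt_coeff (n - i) = (- 1) ^ n * ((1/2 gchoose i) * (1/2 gchoose (n - i)))"
      by (simp add: sqrt_coeff_def)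
  qed
  also have "\<dots> = (- 1) ^ n * ((1/2 + 1/2 :: real) gchoose n)"
    unfolding gbinomial_Vandermonde[symmetric] sum_distrib_left[symmetric] by (simp add: atLeast0AtMost)
  also have "(1/2 + 1/2 :: real) gchoose n = of_nat (1 choose n)"
    by (simp add: binomial_gbinomial)
  finally show ?thesis
    by (cases n rule: nat.exhaust) (auto simp: binomial_eq_0_iff)
qed

text \<open>A Cauchy product in which the term \<open>a\<^sub>i b\<^sub>j\<close> carries the factor \<open>m\<^sub>i\<^sub>+\<^sub>j\<close>. With
  \<open>m\<^sub>k = \<langle>Y\<^sup>k x, y\<rangle>\<close> it multiplies two power series in an operator.\<close>

lemma sums_diagonal:
  fixes a b m :: "nat \<Rightarrow> complex"
  assumes a: "summable (\<lambda>i. norm (a i))" and b: "summable (\<lambda>i. norm (b i))"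
    and m: "\<And>k. norm (m k) \<le> M"
    and g: "\<And>i. (\<lambda>j. b j * m (i + j)) sums g i" and S: "(\<lambda>i. a i * g i) sums S"
  shows "(\<lambda>n. (\<Sum>i\<le>n. a i * b (n - i)) * m n) sums S"
proof -
  let ?F = "\<lambda>(i, j). a i * b j * m (i + j)"
  have M: "0 \<le> M" using m[of 0] norm_ge_zero order_trans by blast
  have bm: "summable (\<lambda>j. norm (b j * m (i + j)))" for i
    by (rule summable_comparison_test'[of "\<lambda>j. norm (b j) * M" 0])
       (auto simp: norm_mult intro!: mult_left_mono m summable_mult2 b)
  have rowb: "(\<Sum>j. norm (b j * m (i + j))) \<le> (\<Sum>j. norm (b j)) * M" for i
    unfolding suminf_mult2[OF b]
    by (rule suminf_le[OF _ bm summable_mult2[OF b]]) (auto simp: norm_mult intro!: mult_left_mono m)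
  have gb: "norm (g i) \<le> (\<Sum>j. norm (b j)) * M" for i
    using summable_norm[OF bm[of i]] sums_unique[OF g[of i]] rowb[of i] by simp
  have row: "((\<lambda>j. ?F (i, j)) has_sum (a i * g i)) UNIV" for i
    using norm_summable_imp_has_sum[OF bm g, of i] has_sum_cmult_right[of _ UNIV "g i" "a i"]
    by (simp add: mult.assoc)
  have ag: "((\<lambda>i. a i * g i) has_sum S) UNIV"
  proof (rule norm_summable_imp_has_sum[OF _ S])
    show "summable (\<lambda>i. norm (a i * g i))"
      by (rule summable_comparison_test'[of "\<lambda>i. norm (a i) * ((\<Sum>j. norm (b j)) * M)" 0])
         (auto simp: norm_mult intro!: mult_left_mono gb summable_mult2 a)
  qed
  have "(\<lambda>p. norm (?F p)) summable_on (UNIV \<times> UNIV)"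
    unfolding Infinite_Sum.abs_summable_on_Sigma_iff
  proof (intro conjI ballI)
    show "(\<lambda>j. norm (?F (i, j))) summable_on UNIV" for i
      using summable_mult[OF bm[of i], of "norm (a i)"]
      by (intro norm_summable_imp_summable_on) (simp add: norm_mult mult.assoc)
    have "(\<Sum>\<^sub>\<infinity>j. norm (?F (i, j))) = norm (a i) * (\<Sum>j. norm (b j * m (i + j)))" for i
    proof (rule infsumI)
      have "((\<lambda>j. norm (b j * m (i + j))) has_sum (\<Sum>j. norm (b j * m (i + j)))) UNIV"
        using bm[of i] by (intro norm_summable_imp_has_sum) (auto simp: summable_sums)
      from has_sum_cmult_right[OF this, of "norm (a i)"]
      show "((\<lambda>j. norm (?F (i, j))) has_sum norm (a i) * (\<Sum>j. norm (b j * m (i + j)))) UNIV"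
        by (simp add: norm_mult mult.assoc)
    qed
    moreover have bd: "\<bar>\<Sum>j. norm (b j * m (i + j))\<bar> \<le> (\<Sum>j. norm (b j)) * M" for i
      using rowb[of i] suminf_nonneg[OF bm[of i]] by simp
    have "norm (norm (norm (a i) * (\<Sum>j. norm (b j * m (i + j))))) \<le> norm (a i) * ((\<Sum>j. norm (b j)) * M)" for i
      unfolding real_norm_def abs_abs abs_mult[of "norm (a i)"] abs_norm_cancel
      by (rule mult_left_mono[OF bd norm_ge_zero])
    then have "summable (\<lambda>i. norm (norm (a i) * (\<Sum>j. norm (b j * m (i + j)))))"
      by (rule summable_comparison_test'[of "\<lambda>i. norm (a i) * ((\<Sum>j. norm (b j)) * M)" 0, OF summable_mult2[OF a]])
    ultimately show "(\<lambda>i. norm (\<Sum>\<^sub>\<infinity>j. norm (?F (i, j)))) summable_on UNIV"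
      by (simp only:) (auto intro!: norm_summable_imp_summable_on)
  qed
  then have "?F summable_on (UNIV \<times> UNIV)" by (rule abs_summable_summable)
  then obtain T where T: "(?F has_sum T) (UNIV \<times> UNIV)" by (auto simp: summable_on_def)
  have "T = S"
    using has_sum_SigmaD[OF T row] ag has_sum_unique by blast
  moreover have "((\<lambda>(n, i). a i * b (n - i) * m n) has_sum T) (Sigma UNIV (\<lambda>n. {..n}))
      \<longleftrightarrow> (?F has_sum T) (UNIV \<times> UNIV)"
    by (rule has_sum_reindex_bij_witness[where i = "\<lambda>(i, j). (i + j, i)" and j = "\<lambda>(n, i). (i, n - i)"])
       auto
  ultimately have "((\<lambda>n. \<Sum>i\<le>n. a i * b (n - i) * m n) has_sum S) UNIV"
    using has_sum_SigmaD[where f = "\<lambda>(n, i). a i * b (n - i) * m n" and A = UNIV and B = "\<lambda>n. {..n}"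
        and g = "\<lambda>n. \<Sum>i\<le>n. a i * b (n - i) * m n" and S = T] T by (simp add: has_sum_finite)
  then show ?thesis
    by (simp add: has_sum_imp_sums sum_distrib_right)
qed

text \<open>The quadratic form \<open>q\<close> dominates the functional \<open>\<langle>f, \<cdot>\<rangle>\<close>. If \<open>q g = \<langle>Pg, g\<rangle>\<close>, this describes the
  range of \<open>P\<^sup>1\<^sup>/\<^sup>2\<close>.\<close>

definition dominated :: "'a hilbert \<Rightarrow> 'a \<Rightarrow> ('a \<Rightarrow> real) \<Rightarrow> bool"
  where "dominated E f q \<longleftrightarrow> (\<exists>C\<ge>0. \<forall>g\<in>hcarrier E. (cmod (hinner E f g))\<^sup>2 \<le> C * q g)"

context pre_hilbert_space
begin

text \<open>Polarization: the form is real at \<open>x + y\<close> and at \<open>x + \<i>y\<close>.\<close>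

lemma positive_op_selfadjoint:
  assumes A: "positive_op E A" and x: "x \<in> hcarrier E" and y: "y \<in> hcarrier E"
  shows "hinner E (A x) y = hinner E x (A y)"
proof -
  have b: "bounded_op E E A" and r: "\<And>u. u \<in> hcarrier E \<Longrightarrow> Im (hinner E (A u) u) = 0"
    using A by (auto simp: positive_op_def complex_nonneg_Reals_iff)
  note [simp] = bounded_opD[OF b] x y
  have "Im (hinner E (A x) y) + Im (hinner E (A y) x) = 0"
    using r[of "x + y"] r[of x] r[of y] by (simp add: inner_add_left inner_add_right)
  moreover have "Re (hinner E (A y) x) = Re (hinner E (A x) y)"
    using r[of "x + \<i> *\<^sub>C y"] r[of x] r[of y]
    by (simp add: inner_add_left inner_add_right inner_scaleC_left inner_scaleC_right)
  ultimately have "hinner E (A y) x = cnj (hinner E (A x) y)"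
    by (simp add: complex_eq_iff)
  then show ?thesis using inner_commute[of "A y" x] by simp
qed

text \<open>The quadratic polynomial \<open>\<langle>A(y + tAy), y + tAy\<rangle>\<close> in \<open>t\<close> has no constant term and the linear
  coefficient \<open>2\<parallel>Ay\<parallel>\<^sup>2\<close>, so it would be negative for small \<open>t < 0\<close>.\<close>

lemma positive_op_inner_eq_0:
  assumes A: "positive_op E A" and y: "y \<in> hcarrier E" and 0: "hinner E (A y) y = 0"
  shows "A y = 0"
proof (rule ccontr)
  assume ne: "A y \<noteq> 0"
  have b: "bounded_op E E A" and r: "\<And>u. u \<in> hcarrier E \<Longrightarrow> 0 \<le> Re (hinner E (A u) u)"
    using A by (auto simp: positive_op_def complex_nonneg_Reals_iff)
  note [simp] = bounded_opD[OF b] y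
  define n where "n = (hnorm E (A y))\<^sup>2"
  define K where "K = Re (hinner E (A (A y)) (A y))"
  define t where "t = - n / (K + 1)"
  have n: "n > 0" using ne hnorm_eq_0_iff[of "A y"] by (simp add: n_def)
  have K: "K \<ge> 0" using r[of "A y"] by (simp add: K_def)
  have "hinner E (A (A y)) y = hinner E (A y) (A y)"
    using positive_op_selfadjoint[OF A, of "A y" y] by simp
  then have "Re (hinner E (A (y + of_real t *\<^sub>C A y)) (y + of_real t *\<^sub>C A y)) = 2 * t * n + t\<^sup>2 * K"
    using 0 by (simp add: inner_add_left inner_add_right inner_scaleC_left inner_scaleC_right
        n_def K_def hnorm_sq) (simp add: power2_eq_square algebra_simps)
  then have "0 \<le> t * (2 * n + t * K)"
    using r[of "y + of_real t *\<^sub>C A y"] by (simp add: power2_eq_square algebra_simps)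
  moreover have "t < 0" using n K by (simp add: t_def divide_neg_pos)
  ultimately have "2 * n + t * K \<le> 0" by (simp add: zero_le_mult_iff)
  moreover have "t * K \<ge> - n" using n K by (simp add: t_def field_simps)
  ultimately show False using n by linarith
qed

text \<open>For \<open>y = (S - R)x\<close> the vector \<open>(S + R)y = (S\<^sup>2 - R\<^sup>2)x\<close> vanishes. Both forms are nonnegative at
  \<open>y\<close>, hence \<open>Sy = Ry = 0\<close> and \<open>\<parallel>y\<parallel>\<^sup>2 = \<langle>x, (S - R)y\<rangle> = 0\<close>.\<close>

lemma positive_op_unique:
  assumes S: "positive_op E S" and R: "positive_op E R"
    and eq: "\<And>x. x \<in> hcarrier E \<Longrightarrow> S (S x) = R (R x)"
    and comm: "\<And>x. x \<in> hcarrier E \<Longrightarrow> S (R x) = R (S x)"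
    and x: "x \<in> hcarrier E"
  shows "S x = R x"
proof -
  have bS: "bounded_op E E S" and bR: "bounded_op E E R"
    using S R by (auto simp: positive_op_def)
  note [simp] = bounded_opD(1)[OF bS] bounded_opD(1)[OF bR] x
  define y where "y = S x - R x"
  have y [simp]: "y \<in> hcarrier E" by (simp add: y_def)
  have "S y + R y = 0"
    by (simp add: y_def op_diff[OF bS] op_diff[OF bR] eq comm)
  then have "hinner E (S y) y + hinner E (R y) y = 0"
    by (simp add: inner_add_left[symmetric])
  moreover have "0 \<le> Re (hinner E (S y) y)" "Im (hinner E (S y) y) = 0"
    "0 \<le> Re (hinner E (R y) y)" "Im (hinner E (R y) y) = 0"
    using S R y by (auto simp: positive_op_def complex_nonneg_Reals_iff)
  ultimately have "hinner E (S y) y = 0" "hinner E (R y) y = 0"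
    by (auto simp: complex_eq_iff)
  then have 0: "S y = 0" "R y = 0"
    using positive_op_inner_eq_0[OF S y] positive_op_inner_eq_0[OF R y] by auto
  have "hinner E y y = hinner E (S x) y - hinner E (R x) y"
    by (simp add: y_def inner_diff_left)
  also have "\<dots> = 0"
    using positive_op_selfadjoint[OF S x y] positive_op_selfadjoint[OF R x y] 0 by simp
  finally have "y = 0" using inner_eq_zero[OF y] by simp
  then show ?thesis by (simp add: y_def)
qed

end

locale positive_contraction = hilbert_space E for E :: "'a::complex_vector hilbert" +
  fixes Y :: "'a \<Rightarrow> 'a"
  assumes Y_bounded: "bounded_op E E Y"
    and Y_contraction: "x \<in> hcarrier E \<Longrightarrow> hnorm E (Y x) \<le> hnorm E x"
    and Y_selfadjoint: "x \<in> hcarrier E \<Longrightarrow> y \<in> hcarrier E \<Longrightarrow> hinner E (Y x) y = hinner E x (Y y)"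
    and Y_nonneg: "x \<in> hcarrier E \<Longrightarrow> 0 \<le> Re (hinner E (Y x) x)"
begin

lemma pow_carrier [simp]: "x \<in> hcarrier E \<Longrightarrow> (Y ^^ k) x \<in> hcarrier E"
  by (induction k) (auto simp: bounded_opD(1)[OF Y_bounded])

lemma pow_add: "x \<in> hcarrier E \<Longrightarrow> y \<in> hcarrier E \<Longrightarrow> (Y ^^ k) (x + y) = (Y ^^ k) x + (Y ^^ k) y"
  by (induction k) (auto simp: bounded_opD(2)[OF Y_bounded])

lemma pow_scaleC: "x \<in> hcarrier E \<Longrightarrow> (Y ^^ k) (c *\<^sub>C x) = c *\<^sub>C (Y ^^ k) x"
  by (induction k) (auto simp: bounded_opD(3)[OF Y_bounded])

lemma pow_contraction: "x \<in> hcarrier E \<Longrightarrow> hnorm E ((Y ^^ k) x) \<le> hnorm E x"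
proof (induction k)
  case (Suc k)
  then show ?case using Y_contraction[of "(Y ^^ k) x"] by simp
qed simp

lemma pow_bounded: "bounded_op E E (Y ^^ k)"
  unfolding bounded_op_def
  by (auto simp: pow_add pow_scaleC intro!: exI[of _ 1] pow_contraction)

lemma inner_pow_left:
  "x \<in> hcarrier E \<Longrightarrow> y \<in> hcarrier E \<Longrightarrow> hinner E ((Y ^^ k) x) y = hinner E x ((Y ^^ k) y)"
proof (induction k arbitrary: y)
  case (Suc k)
  have "hinner E ((Y ^^ Suc k) x) y = hinner E ((Y ^^ k) x) (Y y)"
    using Y_selfadjoint Suc.prems by simp
  also have "\<dots> = hinner E x ((Y ^^ Suc k) y)"
    using Suc.IH[of "Y y"] Suc.prems bounded_opD(1)[OF Y_bounded] by (simp add: funpow_swap1)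
  finally show ?case .
qed simp

lemma inner_pow_pow:
  assumes "x \<in> hcarrier E" "y \<in> hcarrier E"
  shows "hinner E ((Y ^^ i) x) ((Y ^^ j) y) = hinner E ((Y ^^ (i + j)) x) y"
  using inner_pow_left[of "(Y ^^ i) x" y j] assms
  by (simp add: funpow_add add.commute[of i j])

lemma pow_nonneg:
  assumes x: "x \<in> hcarrier E"
  shows "0 \<le> Re (hinner E ((Y ^^ k) x) x)"
proof (cases "even k")
  case True
  then obtain j where "k = j + j" by (metis evenE mult_2)
  then show ?thesis using inner_pow_pow[OF x x, of j j] inner_nonneg[of "(Y ^^ j) x"] x by simp
next
  case False
  then obtain j where "k = Suc (j + j)" by (metis oddE mult_2 Suc_eq_plus1)
  then show ?thesis
    using inner_pow_pow[OF x x, of "Suc j" j] Y_nonneg[of "(Y ^^ j) x"] x by simp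
qed

abbreviation partial :: "'a \<Rightarrow> nat \<Rightarrow> 'a"
  where "partial x \<equiv> (\<lambda>N. \<Sum>k<N. of_real (sqrt_coeff k) *\<^sub>C (Y ^^ k) x)"

definition sqroot :: "'a \<Rightarrow> 'a" where
  "sqroot x = (if x \<in> hcarrier E
     then THE l. limitin (htopology E) (partial x) l sequentially
     else 0)"

lemma sqroot_limit:
  assumes x: "x \<in> hcarrier E"
  shows "limitin (htopology E) (partial x) (sqroot x) sequentially"
proof -
  have "summable (\<lambda>k. hnorm E (of_real (sqrt_coeff k) *\<^sub>C (Y ^^ k) x))"
    by (rule summable_comparison_test'[of "\<lambda>k. \<bar>sqrt_coeff k\<bar> * hnorm E x" 0])
       (auto simp: hnorm_scaleC x hnorm_nonneg abs_mult
         intro!: mult_left_mono pow_contraction summable_mult2 summable_abs_sqrt_coeff)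
  then have "\<exists>l. limitin (htopology E) (partial x) l sequentially"
    using x by (intro summable_hnorm_limit) auto
  then have "\<exists>!l. limitin (htopology E) (partial x) l sequentially"
    using limit_unique trivial_limit_sequentially by blast
  from theI'[OF this] show ?thesis using x by (simp add: sqroot_def)
qed

lemma sqroot_carrier [simp]: "x \<in> hcarrier E \<Longrightarrow> sqroot x \<in> hcarrier E"
  using sqroot_limit limitin_carrier by blast

lemma sqroot_inner:
  assumes "x \<in> hcarrier E" "y \<in> hcarrier E"
  shows "(\<lambda>k. of_real (sqrt_coeff k) * hinner E ((Y ^^ k) x) y) sums hinner E (sqroot x) y"
  using limitin_inner_left[OF sqroot_limit] assms
  by (simp add: sums_def inner_sum_left inner_scaleC_left)

lemma sqroot_selfadjoint:
  assumes x: "x \<in> hcarrier E" and y: "y \<in> hcarrier E"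
  shows "hinner E (sqroot x) y = hinner E x (sqroot y)"
proof -
  have "(\<lambda>k. cnj (of_real (sqrt_coeff k) * hinner E ((Y ^^ k) y) x)) sums cnj (hinner E (sqroot y) x)"
    using sqroot_inner[OF y x] by (simp only: sums_cnj)
  moreover have "cnj (hinner E ((Y ^^ k) y) x) = hinner E ((Y ^^ k) x) y" for k
    using inner_commute[of "(Y ^^ k) y" x] inner_pow_left[OF x y] x y by simp
  ultimately have "(\<lambda>k. of_real (sqrt_coeff k) * hinner E ((Y ^^ k) x) y) sums hinner E x (sqroot y)"
    using inner_commute[of "sqroot y" x] x y by simp
  then show ?thesis using sqroot_inner[OF x y] sums_unique2 by blast
qed

lemma sqroot_bounded: "bounded_op E E sqroot"
  unfolding bounded_op_def
proof (intro conjI ballI allI exI)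
  fix x assume x: "x \<in> hcarrier E"
  show "sqroot x \<in> hcarrier E" using x by simp
  show "hnorm E (sqroot x) \<le> 2 * hnorm E x"
  proof (rule LIMSEQ_le_const2[OF limitin_hnorm[OF sqroot_limit[OF x]]], intro exI allI impI)
    fix N
    have "hnorm E (partial x N)
        \<le> (\<Sum>k<N. hnorm E (of_real (sqrt_coeff k) *\<^sub>C (Y ^^ k) x))"
      using x by (intro hnorm_sum_le) auto
    also have "\<dots> \<le> (\<Sum>k<N. \<bar>sqrt_coeff k\<bar> * hnorm E x)"
      using x by (intro sum_mono) (auto simp: hnorm_scaleC intro!: mult_left_mono pow_contraction)
    also have "\<dots> \<le> 2 * hnorm E x"
      unfolding sum_distrib_right[symmetric]
      by (intro mult_right_mono sum_abs_sqrt_coeff_le hnorm_nonneg x)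
    finally show "hnorm E (partial x N) \<le> 2 * hnorm E x" .
  qed
  show "sqroot (x + y) = sqroot x + sqroot y" if y: "y \<in> hcarrier E" for y
  proof (rule inner_eqI_right)
    fix v assume v: "v \<in> hcarrier E"
    show "hinner E v (sqroot (x + y)) = hinner E v (sqroot x + sqroot y)"
      using x y v sqroot_selfadjoint[of v x] sqroot_selfadjoint[of v y] sqroot_selfadjoint[of v "x + y"]
      by (simp add: inner_add_right)
  qed (use x y in auto)
  show "sqroot (c *\<^sub>C x) = c *\<^sub>C sqroot x" for c
  proof (rule inner_eqI_right)
    fix v assume v: "v \<in> hcarrier E"
    show "hinner E v (sqroot (c *\<^sub>C x)) = hinner E v (c *\<^sub>C sqroot x)"
      using x v sqroot_selfadjoint[of v x] sqroot_selfadjoint[of v "c *\<^sub>C x"]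
      by (simp add: inner_scaleC_right)
  qed (use x in auto)
qed

lemma sqroot_positive: "positive_op E sqroot"
  unfolding positive_op_def complex_nonneg_Reals_iff
proof (intro conjI ballI sqroot_bounded)
  fix x assume x: "x \<in> hcarrier E"
  have "cnj (hinner E (sqroot x) x) = hinner E (sqroot x) x"
    using inner_commute[of "sqroot x" x] sqroot_selfadjoint[OF x x] x by simp
  then show "Im (hinner E (sqroot x) x) = 0" by (simp add: complex_eq_iff)
  have "(\<lambda>N. \<Sum>k<N. Re (of_real (sqrt_coeff k) * hinner E ((Y ^^ k) x) x)) \<longlonglongrightarrow> Re (hinner E (sqroot x) x)"
    using tendsto_Re[OF sqroot_inner[OF x x, unfolded sums_def]] by simp
  moreover have "0 \<le> (\<Sum>k<N. Re (of_real (sqrt_coeff k) * hinner E ((Y ^^ k) x) x))" for N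
  proof -
    have "0 \<le> (\<Sum>k<N. sqrt_coeff k) * (hnorm E x)\<^sup>2"
      using sum_sqrt_coeff_nonneg by simp
    also have "\<dots> \<le> (\<Sum>k<N. Re (of_real (sqrt_coeff k) * hinner E ((Y ^^ k) x) x))"
      unfolding sum_distrib_right
    proof (intro sum_mono)
      fix k
      show "sqrt_coeff k * (hnorm E x)\<^sup>2 \<le> Re (of_real (sqrt_coeff k) * hinner E ((Y ^^ k) x) x)"
      proof (cases "k = 0")
        case False
        have "Re (hinner E ((Y ^^ k) x) x) \<le> hnorm E ((Y ^^ k) x) * hnorm E x"
          by (rule order_trans[OF complex_Re_le_cmod Cauchy_Schwarz[OF pow_carrier[OF x] x]])
        also have "\<dots> \<le> (hnorm E x)\<^sup>2"
          using x pow_contraction[OF x] by (simp add: power2_eq_square mult_right_mono hnorm_nonneg)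
        finally show ?thesis using False by (simp add: sqrt_coeff_nonpos mult_left_mono_neg)
      qed (use x in \<open>simp add: hnorm_sq\<close>)
    qed
    finally show ?thesis .
  qed
  ultimately show "0 \<le> Re (hinner E (sqroot x) x)"
    by (intro LIMSEQ_le_const) auto
qed

lemma sqroot_sqroot:
  assumes x: "x \<in> hcarrier E"
  shows "sqroot (sqroot x) = x - Y x"
proof (rule inner_eqI)
  show "sqroot (sqroot x) \<in> hcarrier E" "x - Y x \<in> hcarrier E"
    using x by (auto simp: bounded_opD(1)[OF Y_bounded])
  fix y assume y: "y \<in> hcarrier E"
  let ?s = "\<lambda>k. complex_of_real (sqrt_coeff k)" and ?m = "\<lambda>k. hinner E ((Y ^^ k) x) y"
  have row: "(\<lambda>j. ?s j * ?m (i + j)) sums hinner E ((Y ^^ i) x) (sqroot y)" for i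
    using sqroot_inner[of "(Y ^^ i) x" y] sqroot_selfadjoint[of "(Y ^^ i) x" y] x y
    by (simp add: funpow_add add.commute)
  have "(\<lambda>n. (\<Sum>i\<le>n. ?s i * ?s (n - i)) * ?m n) sums hinner E (sqroot (sqroot x)) y"
  proof (rule sums_diagonal[OF _ _ _ row])
    show "summable (\<lambda>i. norm (?s i))" "summable (\<lambda>i. norm (?s i))"
      using summable_abs_sqrt_coeff by auto
    show "norm (?m k) \<le> hnorm E x * hnorm E y" for k
    proof -
      have "norm (?m k) \<le> hnorm E ((Y ^^ k) x) * hnorm E y" using x y by (intro Cauchy_Schwarz) auto
      also have "\<dots> \<le> hnorm E x * hnorm E y"
        by (intro mult_right_mono pow_contraction hnorm_nonneg x y)
      finally show ?thesis .
    qed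
    show "(\<lambda>i. ?s i * hinner E ((Y ^^ i) x) (sqroot y)) sums hinner E (sqroot (sqroot x)) y"
      using sqroot_inner[of x "sqroot y"] sqroot_selfadjoint[of "sqroot x" y] x y by simp
  qed
  moreover have "(\<Sum>i\<le>n. ?s i * ?s (n - i)) = (if n = 0 then 1 else if n = 1 then -1 else 0)" for n
    using arg_cong[OF sqrt_coeff_convolution[of n], of complex_of_real] by (auto split: if_splits)
  ultimately have "(\<lambda>n. (if n = 0 then 1 else if n = 1 then -1 else 0) * ?m n) sums hinner E (sqroot (sqroot x)) y"
    by simp
  moreover have "(\<lambda>n. (if n = 0 then 1 else if n = 1 then -1 else 0) * ?m n) sums
      (\<Sum>n\<in>{0, 1}. (if n = 0 then 1 else if n = 1 then -1 else 0) * ?m n)"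
    by (rule sums_finite) auto
  ultimately show "hinner E (sqroot (sqroot x)) y = hinner E (x - Y x) y"
    using x y by (auto simp: inner_diff_left bounded_opD(1)[OF Y_bounded] dest: sums_unique2)
qed

lemma sqroot_commute:
  assumes R: "bounded_op E E R" and comm: "\<And>x. x \<in> hcarrier E \<Longrightarrow> R (Y x) = Y (R x)"
    and x: "x \<in> hcarrier E"
  shows "sqroot (R x) = R (sqroot x)"
proof -
  note [simp] = bounded_opD(1)[OF R] bounded_opD(1)[OF Y_bounded] x
  have pow: "R ((Y ^^ k) x) = (Y ^^ k) (R x)" for k
    by (induction k) (auto simp: comm)
  have "R (partial x N) = (partial (R x) N)" for N
    by (subst op_sum[OF R]) (auto simp: bounded_opD(3)[OF R] pow)
  then have "limitin (htopology E) (partial (R x)) (R (sqroot x)) sequentially"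
    using limitin_op[OF R sqroot_limit[OF x]] by simp
  then show ?thesis
    using limit_unique[OF sqroot_limit] by simp
qed

text \<open>A positive square root \<open>R\<close> of \<open>1 - Y\<close> commutes with \<open>Y = 1 - R\<^sup>2\<close>, hence with every power
  series in \<open>Y\<close>, so that uniqueness for commuting square roots applies.\<close>

theorem sqrt_op_eq_sqroot:
  assumes P: "\<And>x. x \<in> hcarrier E \<Longrightarrow> P x = x - Y x"
  shows "sqrt_op E P = sqroot"
  unfolding sqrt_op_def
proof (rule the_equality)
  show "positive_op E sqroot \<and> (\<forall>x\<in>hcarrier E. sqroot (sqroot x) = P x) \<and> (\<forall>x. x \<notin> hcarrier E \<longrightarrow> sqroot x = 0)"
    using sqroot_positive sqroot_sqroot P by (auto simp: sqroot_def)
  fix R assume R: "positive_op E R \<and> (\<forall>x\<in>hcarrier E. R (R x) = P x) \<and> (\<forall>x. x \<notin> hcarrier E \<longrightarrow> R x = 0)"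
  then have b: "bounded_op E E R" by (auto simp: positive_op_def)
  note [simp] = bounded_opD(1)[OF b] bounded_opD(1)[OF Y_bounded]
  have RR: "R (R x) = x - Y x" if "x \<in> hcarrier E" for x using R P that by simp
  have comm: "R (Y x) = Y (R x)" if x: "x \<in> hcarrier E" for x
    using RR[of "R x"] op_diff[OF b, of x "Y x"] RR[OF x] x by simp
  show "R = sqroot"
  proof
    fix x show "R x = sqroot x"
    proof (cases "x \<in> hcarrier E")
      case True
      show ?thesis
        by (rule positive_op_unique[OF _ sqroot_positive _ _ True])
           (use R RR sqroot_sqroot sqroot_commute[OF b comm] in auto)
    qed (use R in \<open>auto simp: sqroot_def\<close>)
  qed
qed

lemma hnorm_sqroot_sq:
  assumes x: "x \<in> hcarrier E"
  shows "(hnorm E (sqroot x))\<^sup>2 = Re (hinner E (x - Y x) x)"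
  using sqroot_selfadjoint[of "sqroot x" x] sqroot_sqroot[OF x] x
  by (simp only: hnorm_sq sqroot_carrier)

text \<open>If \<open>f = P\<^sup>1\<^sup>/\<^sup>2 h\<close> with \<open>P = 1 - Y\<close>, then the inequality is Cauchy-Schwarz. Conversely a preimage
  of \<open>f\<close> is constructed as the limit of \<open>h\<^sub>n = (1 + Y + \<dots> + Y\<^sup>n\<^sup>-\<^sup>1) P\<^sup>1\<^sup>/\<^sup>2 f\<close>, for which
  \<open>P\<^sup>1\<^sup>/\<^sup>2 h\<^sub>n = f - Y\<^sup>n f\<close>. The domination keeps \<open>\<parallel>h\<^sub>n\<parallel>\<close> bounded; as the increments
  \<open>h\<^sub>m - h\<^sub>n\<close> have nonnegative inner product with \<open>h\<^sub>n\<close>, the sequence is Cauchy. What may be missing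
  from \<open>f\<close> is the limit \<open>u\<close> of \<open>Y\<^sup>n f\<close>, a fixed point of \<open>Y\<close>. There the form vanishes, so the
  domination makes \<open>u\<close> orthogonal to \<open>f\<close>; being orthogonal to the range as well, it is \<open>0\<close>.\<close>

theorem range_sqroot:
  "sqroot ` hcarrier E = {f \<in> hcarrier E. dominated E f (\<lambda>g. Re (hinner E (g - Y g) g))}"
  unfolding dominated_def
proof (intro equalityI subsetI CollectI conjI)
  fix f assume "f \<in> sqroot ` hcarrier E"
  then obtain h where h: "h \<in> hcarrier E" and f: "f = sqroot h" by blast
  show "f \<in> hcarrier E" using h f by simp
  have "(cmod (hinner E f g))\<^sup>2 \<le> (hnorm E h)\<^sup>2 * Re (hinner E (g - Y g) g)" if g: "g \<in> hcarrier E" for g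
  proof -
    have "cmod (hinner E f g) \<le> hnorm E h * hnorm E (sqroot g)"
      using sqroot_selfadjoint[OF h g] Cauchy_Schwarz[OF h, of "sqroot g"] f g by simp
    then have "(cmod (hinner E f g))\<^sup>2 \<le> (hnorm E h * hnorm E (sqroot g))\<^sup>2" by (simp add: power_mono)
    then show ?thesis by (simp add: power_mult_distrib hnorm_sqroot_sq[OF g])
  qed
  then show "\<exists>C\<ge>0. \<forall>g\<in>hcarrier E. (cmod (hinner E f g))\<^sup>2 \<le> C * Re (hinner E (g - Y g) g)"
    by (intro exI[of _ "(hnorm E h)\<^sup>2"]) auto
next
  fix f assume "f \<in> {f \<in> hcarrier E. \<exists>C\<ge>0. \<forall>g\<in>hcarrier E.
      (cmod (hinner E f g))\<^sup>2 \<le> C * Re (hinner E (g - Y g) g)}"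
  then obtain C where f [simp]: "f \<in> hcarrier E" and C: "C \<ge> 0"
    and dom: "\<And>g. g \<in> hcarrier E \<Longrightarrow> (cmod (hinner E f g))\<^sup>2 \<le> C * (hnorm E (sqroot g))\<^sup>2"
    by (auto simp: hnorm_sqroot_sq)
  note [simp] = bounded_opD(1)[OF Y_bounded]
  define q where "q n x = (\<Sum>k<n. (Y ^^ k) x)" for n x
  have q_carrier [simp]: "q n x \<in> hcarrier E" if "x \<in> hcarrier E" for n x
    using that by (auto simp: q_def intro!: sum_carrier)
  have q_tele: "q n x - Y (q n x) = x - (Y ^^ n) x" if "x \<in> hcarrier E" for n x
  proof -
    have "Y (q n x) = (\<Sum>k<n. (Y ^^ Suc k) x)"
      unfolding q_def by (subst op_sum[OF Y_bounded]) (use that in auto)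
    then show ?thesis
      using sum_lessThan_telescope'[of "\<lambda>k. (Y ^^ k) x" n] by (simp add: q_def sum_subtractf)
  qed
  have q_sqroot: "sqroot (q n x) = q n (sqroot x)" if x: "x \<in> hcarrier E" for n x
  proof -
    have "sqroot ((Y ^^ k) x) = (Y ^^ k) (sqroot x)" for k
      using sqroot_commute[OF pow_bounded, of k x] x by (simp add: funpow_swap1)
    then show ?thesis
      unfolding q_def by (subst op_sum[OF sqroot_bounded]) (use x in auto)
  qed
  have q_sa: "hinner E (q n x) y = hinner E x (q n y)" if "x \<in> hcarrier E" "y \<in> hcarrier E" for n x y
    using that by (simp add: q_def inner_sum_left inner_sum_right inner_pow_left)
  define v where "v = sqroot f"
  define h where "h n = q n v" for n
  have v [simp]: "v \<in> hcarrier E" by (simp add: v_def)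
  have h [simp]: "h n \<in> hcarrier E" for n by (simp add: h_def)
  have sqroot_h: "sqroot (h n) = f - (Y ^^ n) f" for n
    using sqroot_sqroot[of "q n f"] q_tele[of f n] by (simp add: h_def v_def q_sqroot[symmetric])
  (* the choice g = q n (P^(1/2) h_n) turns the inner product of f and g into the square of |h_n| *)
  have h_bound: "(hnorm E (h n))\<^sup>2 \<le> 4 * C" for n
  proof -
    let ?N = "(hnorm E (h n))\<^sup>2"
    let ?g = "q n (sqroot (h n))"
    have "hinner E (h n) (h n) = hinner E f ?g"
      using sqroot_selfadjoint[of "q n f" "h n"] q_sa[of f "sqroot (h n)" n]
      by (simp add: h_def v_def q_sqroot)
    then have N: "?N = cmod (hinner E f ?g)"
      using inner_self[of "h n"] by (metis norm_of_real abs_of_nonneg zero_le_power2 h)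
    have "sqroot ?g = q n (h n) - Y (q n (h n))"
      using sqroot_sqroot[of "q n (h n)"] by (simp add: q_sqroot)
    also have "\<dots> = h n - (Y ^^ n) (h n)" by (rule q_tele) simp
    finally have "hnorm E (sqroot ?g) \<le> 2 * hnorm E (h n)"
      using hnorm_diff_triangle[of "h n" "(Y ^^ n) (h n)"] pow_contraction[of "h n" n] by simp
    then have "(hnorm E (sqroot ?g))\<^sup>2 \<le> (2 * hnorm E (h n))\<^sup>2"
      by (intro power_mono) (auto simp: hnorm_nonneg)
    then have "C * (hnorm E (sqroot ?g))\<^sup>2 \<le> C * (4 * ?N)"
      using C by (intro mult_left_mono) (auto simp: power_mult_distrib)
    then have "?N\<^sup>2 \<le> C * (4 * ?N)"
      using dom[of ?g] N by simp
    then have *: "?N * ?N \<le> (4 * C) * ?N" by (simp add: power2_eq_square algebra_simps)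
    show ?thesis
    proof (cases "?N = 0")
      case False
      then have "?N > 0" by simp
      with * show ?thesis by (rule mult_right_le_imp_le)
    qed (use C in simp)
  qed
  have h_diff: "(hnorm E (h m - h n))\<^sup>2 \<le> (hnorm E (h m))\<^sup>2 - (hnorm E (h n))\<^sup>2" if "n \<le> m" for m n
  proof -
    have d: "h m - h n = (\<Sum>k=n..<m. (Y ^^ k) v)"
      using that by (simp add: h_def q_def lessThan_atLeast0 sum_diff_nat_ivl)
    have "hinner E (h m - h n) (h n) = (\<Sum>j<n. \<Sum>k=n..<m. hinner E ((Y ^^ (k + j)) v) v)"
      unfolding d by (simp add: h_def q_def inner_sum_left inner_sum_right inner_pow_pow sum_carrier)
    then have "0 \<le> Re (hinner E (h m - h n) (h n))"
      by (simp add: sum_nonneg pow_nonneg)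
    moreover have "(hnorm E (h m))\<^sup>2 = (hnorm E (h m - h n))\<^sup>2 + 2 * Re (hinner E (h m - h n) (h n)) + (hnorm E (h n))\<^sup>2"
      using hnorm_add_sq[of "h m - h n" "h n"] by simp
    ultimately show ?thesis by linarith
  qed
  have "convergent (\<lambda>n. (hnorm E (h n))\<^sup>2)"
  proof (rule Bseq_mono_convergent)
    show "Bseq (\<lambda>n. (hnorm E (h n))\<^sup>2)" using h_bound by (intro BseqI'[of _ "4 * C"]) auto
    show "\<forall>m n. m \<le> n \<longrightarrow> (hnorm E (h m))\<^sup>2 \<le> (hnorm E (h n))\<^sup>2"
      using h_diff zero_le_power2 by (smt (verit))
  qed
  then have cauchy: "Cauchy (\<lambda>n. (hnorm E (h n))\<^sup>2)" by (rule convergent_Cauchy)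
  have "\<exists>l. limitin (htopology E) h l sequentially"
  proof (rule complete_limit)
    fix e :: real assume e: "e > 0"
    then obtain N where N: "\<And>m n. m \<ge> N \<Longrightarrow> n \<ge> N \<Longrightarrow> \<bar>(hnorm E (h m))\<^sup>2 - (hnorm E (h n))\<^sup>2\<bar> < e\<^sup>2"
      using cauchy unfolding Cauchy_def dist_real_def by (meson zero_less_power)
    show "\<exists>N. \<forall>n\<ge>N. \<forall>m\<ge>n. hnorm E (h m - h n) < e"
    proof (intro exI allI impI)
      fix n m assume mn: "n \<ge> N" "m \<ge> n"
      then have "(hnorm E (h m - h n))\<^sup>2 < e\<^sup>2" using h_diff[OF mn(2)] N[of m n] by simp
      then show "hnorm E (h m - h n) < e" using e power_less_imp_less_base by fastforce
    qed
  qed simp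
  then obtain l where l: "limitin (htopology E) h l sequentially" by blast
  then have lE [simp]: "l \<in> hcarrier E" by (rule limitin_carrier)
  define u where "u = f - sqroot l"
  have uE [simp]: "u \<in> hcarrier E" by (simp add: u_def)
  have lim_u: "limitin (htopology E) (\<lambda>n. (Y ^^ n) f) u sequentially"
  proof (rule limitinI)
    have "limitin (htopology E) (\<lambda>n. f - (Y ^^ n) f) (sqroot l) sequentially"
      using limitin_op[OF sqroot_bounded l] by (simp add: sqroot_h)
    moreover have "hnorm E (f - (Y ^^ n) f - sqroot l) = hnorm E ((Y ^^ n) f - u)" for n
      using hnorm_commute[of "(Y ^^ n) f" u] by (simp add: u_def algebra_simps)
    ultimately show "(\<lambda>n. hnorm E ((Y ^^ n) f - u)) \<longlonglongrightarrow> 0"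
      by (simp add: limitin_iff)
  qed auto
  have "limitin (htopology E) (\<lambda>n. (Y ^^ Suc n) f) (Y u) sequentially"
    using limitin_op[OF Y_bounded lim_u] by simp
  moreover have "limitin (htopology E) (\<lambda>n. (Y ^^ Suc n) f) u sequentially"
    using lim_u unfolding limitin_iff
    using LIMSEQ_Suc[of "\<lambda>n. hnorm E ((Y ^^ n) f - u)"] by auto
  ultimately have "Y u = u" using limit_unique by (meson trivial_limit_sequentially)
  then have "(hnorm E (sqroot u))\<^sup>2 = 0" by (simp add: hnorm_sqroot_sq)
  then have ru: "sqroot u = 0" by (simp add: hnorm_eq_0_iff)
  then have "hinner E f u = 0" using dom[of u] by simp
  moreover have "hinner E (sqroot l) u = 0" using sqroot_selfadjoint[of l u] ru by simp
  ultimately have "hinner E u u = 0"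
    using inner_diff_left[of f "sqroot l" u] unfolding u_def[symmetric] by simp
  then have "u = 0" by (rule inner_eq_zero[OF uE])
  then have "f = sqroot l" by (simp add: u_def)
  then show "f \<in> sqroot ` hcarrier E" by simp
qed

end

section \<open>Moebius transforms of contractions\<close>

context hilbert_space
begin

lemma neumann_solution:
  assumes K: "bounded_op E E K" and half: "\<And>x. x \<in> hcarrier E \<Longrightarrow> hnorm E (K x) \<le> hnorm E x / 2"
    and f: "f \<in> hcarrier E"
  shows "\<exists>!k. k \<in> hcarrier E \<and> k - K k = f"
proof -
  note [simp] = bounded_opD(1)[OF K] f
  have [simp]: "(K ^^ n) f \<in> hcarrier E" for n by (induction n) auto
  have le: "hnorm E ((K ^^ n) f) \<le> (1/2) ^ n * hnorm E f" for n
  proof (induction n)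
    case (Suc n)
    then show ?case using half[of "(K ^^ n) f"] by simp
  qed simp
  have "summable (\<lambda>n. hnorm E ((K ^^ n) f))"
    by (rule summable_comparison_test'[of "\<lambda>n. (1/2) ^ n * hnorm E f" 0])
       (auto simp: hnorm_nonneg le intro!: summable_mult2 summable_geometric)
  then obtain k where k: "limitin (htopology E) (\<lambda>N. \<Sum>n<N. (K ^^ n) f) k sequentially"
    using summable_hnorm_limit by fastforce
  then have kE [simp]: "k \<in> hcarrier E" by (rule limitin_carrier)
  have "K (\<Sum>n<N. (K ^^ n) f) = (\<Sum>n<N. (K ^^ Suc n) f)" for N
    by (subst op_sum[OF K]) auto
  then have "f + K (\<Sum>n<N. (K ^^ n) f) = (\<Sum>n<Suc N. (K ^^ n) f)" for N
    by (simp add: sum.lessThan_Suc_shift del: sum.lessThan_Suc)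
  moreover have "limitin (htopology E) (\<lambda>N. f + K (\<Sum>n<N. (K ^^ n) f)) (f + K k) sequentially"
    by (intro limitin_add limitin_op[OF K k] limitinI) auto
  moreover have "limitin (htopology E) (\<lambda>N. \<Sum>n<Suc N. (K ^^ n) f) k sequentially"
    using k LIMSEQ_Suc[of "\<lambda>N. hnorm E ((\<Sum>n<N. (K ^^ n) f) - k)"]
    by (auto simp: limitin_iff sum_carrier simp del: sum.lessThan_Suc)
  ultimately have "k = f + K k"
    using limit_unique trivial_limit_sequentially by (metis (no_types, lifting) ext)
  show ?thesis
  proof (rule ex1I[of _ k])
    show "k \<in> hcarrier E \<and> k - K k = f" using \<open>k = f + K k\<close> by (simp add: algebra_simps)
    fix l assume l: "l \<in> hcarrier E \<and> l - K l = f"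
    have "l - k = (f + K l) - (f + K k)"
      using l \<open>k = f + K k\<close> by (metis diff_add_cancel add.commute)
    then have "K (l - k) = l - k"
      using op_diff[OF K, of l k] l kE by simp
    then have "hnorm E (l - k) \<le> 0" using half[of "l - k"] l by simp
    then show "l = k" using hnorm_eq_0_iff[of "l - k"] hnorm_nonneg[of "l - k"] l by simp
  qed
qed

end

text \<open>An abstraction of the multiplication \<open>Z\<close> by the independent variable and its adjoint \<open>Z'\<close>. The two
  inequalities about defects say that \<open>A\<close> shrinks the forms \<open>1 - Z\<^sup>*Z\<close> and \<open>1 - ZZ\<^sup>*\<close> by the same
  factor by which it shrinks the square of the norm. The hypotheses are invariant under exchanging
  \<open>Z\<close> and \<open>Z'\<close> (\<open>swap\<close>), so that every result comes with its adjoint version.\<close>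

locale moebius_pair = hilbert_space E for E :: "'a::complex_vector hilbert" +
  fixes Z Z' A :: "'a \<Rightarrow> 'a"
  assumes Z_bounded: "bounded_op E E Z" and Z'_bounded: "bounded_op E E Z'"
    and A_bounded: "bounded_op E E A"
    and Z_contraction: "x \<in> hcarrier E \<Longrightarrow> hnorm E (Z x) \<le> hnorm E x"
    and Z'_contraction: "x \<in> hcarrier E \<Longrightarrow> hnorm E (Z' x) \<le> hnorm E x"
    and A_half: "x \<in> hcarrier E \<Longrightarrow> hnorm E (A x) \<le> hnorm E x / 2"
    and Z_adjoint: "x \<in> hcarrier E \<Longrightarrow> y \<in> hcarrier E \<Longrightarrow> hinner E (Z x) y = hinner E x (Z' y)"
    and A_selfadjoint: "x \<in> hcarrier E \<Longrightarrow> y \<in> hcarrier E \<Longrightarrow> hinner E (A x) y = hinner E x (A y)"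
    and A_Z: "x \<in> hcarrier E \<Longrightarrow> A (Z x) = Z (A x)"
    and Z_defect: "x \<in> hcarrier E \<Longrightarrow>
      (hnorm E (A x))\<^sup>2 - (hnorm E (Z (A x)))\<^sup>2 \<le> ((hnorm E x)\<^sup>2 - (hnorm E (Z x))\<^sup>2) / 4"
    and Z'_defect: "x \<in> hcarrier E \<Longrightarrow>
      (hnorm E (A x))\<^sup>2 - (hnorm E (Z' (A x)))\<^sup>2 \<le> ((hnorm E x)\<^sup>2 - (hnorm E (Z' x))\<^sup>2) / 4"
begin

lemmas carriers [simp] = bounded_opD(1)[OF Z_bounded] bounded_opD(1)[OF Z'_bounded]
  bounded_opD(1)[OF A_bounded]

lemma Z'_adjoint: "x \<in> hcarrier E \<Longrightarrow> y \<in> hcarrier E \<Longrightarrow> hinner E (Z' x) y = hinner E x (Z y)"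
  using Z_adjoint[of y x] inner_commute[of x "Z y"] inner_commute[of "Z' x" y] carriers by simp

lemma A_Z': "x \<in> hcarrier E \<Longrightarrow> A (Z' x) = Z' (A x)"
  by (rule inner_eqI) (simp_all add: A_selfadjoint Z'_adjoint A_Z)

lemma swap: "moebius_pair E Z' Z A"
  by unfold_locales
    (fact Z_bounded Z'_bounded A_bounded Z_contraction Z'_contraction A_half Z'_adjoint
      A_selfadjoint A_Z' Z_defect Z'_defect)+

lemma solve:
  assumes f: "f \<in> hcarrier E"
  shows "\<exists>!k. k \<in> hcarrier E \<and> k - A (Z k) = f"
proof (rule neumann_solution[OF _ _ f])
  show "bounded_op E E (\<lambda>k. A (Z k))"
    unfolding bounded_op_def
  proof (intro conjI ballI allI exI)
    show "hnorm E (A (Z x)) \<le> 1 * hnorm E x" if "x \<in> hcarrier E" for x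
      using A_half[of "Z x"] Z_contraction[of x] hnorm_nonneg[of x] that carriers by simp
  qed (simp_all add: bounded_opD[OF Z_bounded] bounded_opD[OF A_bounded])
  show "hnorm E (A (Z x)) \<le> hnorm E x / 2" if "x \<in> hcarrier E" for x
    using A_half[of "Z x"] Z_contraction[of x] that carriers by simp
qed

text \<open>The operator \<open>(Z - A)(1 - AZ)\<^sup>-\<^sup>1\<close>.\<close>

definition moebius :: "'a \<Rightarrow> 'a"
  where "moebius f = (let k = THE k. k \<in> hcarrier E \<and> k - A (Z k) = f in Z k - A k)"

lemma moebius_eq: "k \<in> hcarrier E \<Longrightarrow> moebius (k - A (Z k)) = Z k - A k"
proof -
  assume k: "k \<in> hcarrier E"
  have "(THE l. l \<in> hcarrier E \<and> l - A (Z l) = k - A (Z k)) = k"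
    by (rule the1_equality[OF solve]) (use k in auto)
  then show ?thesis by (simp add: moebius_def)
qed

lemma moebius_eqI:
  assumes "\<And>k. k \<in> hcarrier E \<Longrightarrow> T (k - A (Z k)) = Z k - A k" and "f \<in> hcarrier E"
  shows "T f = moebius f"
  using solve[OF assms(2)] assms(1) moebius_eq by metis

lemma moebius_carrier [simp]: "f \<in> hcarrier E \<Longrightarrow> moebius f \<in> hcarrier E"
  using solve[of f] moebius_eq by (metis carriers(1) carriers(3) diff_carrier)

text \<open>The mixed terms \<open>\<langle>k, AZk\<rangle>\<close> and \<open>\<langle>Zk, Ak\<rangle>\<close> have the same real part because \<open>A\<close> is self-adjoint.\<close>

lemma moebius_defect:
  assumes k: "k \<in> hcarrier E"
  shows "(hnorm E (k - A (Z k)))\<^sup>2 - (hnorm E (moebius (k - A (Z k))))\<^sup>2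
    = ((hnorm E k)\<^sup>2 - (hnorm E (Z k))\<^sup>2) - ((hnorm E (A k))\<^sup>2 - (hnorm E (Z (A k)))\<^sup>2)"
proof -
  have "hinner E (Z k) (A k) = cnj (hinner E k (A (Z k)))"
    using inner_commute[of "A k" "Z k"] A_selfadjoint[of k "Z k"] k by simp
  then show ?thesis
    using k by (simp add: moebius_eq hnorm_diff_sq A_Z[symmetric])
qed

lemma moebius_contraction:
  assumes f: "f \<in> hcarrier E"
  shows "hnorm E (moebius f) \<le> hnorm E f"
proof -
  obtain k where k: "k \<in> hcarrier E" "f = k - A (Z k)" using solve[OF f] by metis
  have "(hnorm E (Z k))\<^sup>2 \<le> (hnorm E k)\<^sup>2"
    using k Z_contraction by (intro power_mono) (auto simp: hnorm_nonneg)
  then have "(hnorm E (moebius f))\<^sup>2 \<le> (hnorm E f)\<^sup>2"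
    using moebius_defect[OF k(1)] Z_defect[OF k(1)] k(2) by simp
  then show ?thesis using f by (auto intro: power2_le_imp_le hnorm_nonneg)
qed

lemma moebius_bounded: "bounded_op E E moebius"
  unfolding bounded_op_def
proof (intro conjI ballI allI exI)
  fix f assume f: "f \<in> hcarrier E"
  obtain k where k: "k \<in> hcarrier E" "f = k - A (Z k)" using solve[OF f] by metis
  show "hnorm E (moebius f) \<le> 1 * hnorm E f" using moebius_contraction[OF f] by simp
  show "moebius (f + g) = moebius f + moebius g" if g: "g \<in> hcarrier E" for g
  proof -
    obtain l where l: "l \<in> hcarrier E" "g = l - A (Z l)" using solve[OF g] by metis
    have "f + g = (k + l) - A (Z (k + l))"
      using k l by (simp add: bounded_opD[OF Z_bounded] bounded_opD[OF A_bounded])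
    then have "moebius (f + g) = Z (k + l) - A (k + l)"
      using moebius_eq[of "k + l"] k(1) l(1) by (simp only: add_carrier)
    then show ?thesis
      using k l by (simp add: bounded_opD[OF Z_bounded] bounded_opD[OF A_bounded] moebius_eq)
  qed
  show "moebius (c *\<^sub>C f) = c *\<^sub>C moebius f" for c
  proof -
    have "c *\<^sub>C f = (c *\<^sub>C k) - A (Z (c *\<^sub>C k))"
      using k by (simp add: bounded_opD[OF Z_bounded] bounded_opD[OF A_bounded] cvec.scale_right_diff_distrib)
    then have "moebius (c *\<^sub>C f) = Z (c *\<^sub>C k) - A (c *\<^sub>C k)"
      using moebius_eq[of "c *\<^sub>C k"] k(1) by (simp only: scaleC_carrier)
    then show ?thesis
      using k by (simp add: bounded_opD[OF Z_bounded] bounded_opD[OF A_bounded] moebius_eq cvec.scale_right_diff_distrib)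
  qed
qed simp

lemma moebius_adjoint:
  assumes f: "f \<in> hcarrier E" and h: "h \<in> hcarrier E"
  shows "hinner E (moebius f) h = hinner E f (moebius_pair.moebius E Z' A h)"
proof -
  interpret swap: moebius_pair E Z' Z A by (rule swap)
  obtain k where k: "k \<in> hcarrier E" "f = k - A (Z k)" using solve[OF f] by metis
  obtain l where l: "l \<in> hcarrier E" "h = l - A (Z' l)" using swap.solve[OF h] by metis
  have "hinner E (A k) (A (Z' l)) = hinner E (Z (A k)) (A l)"
    using k l Z_adjoint[of "A k" "A l"] A_Z'[of l] by simp
  then show ?thesis
    using k l
    by (simp add: moebius_eq swap.moebius_eq inner_diff_left inner_diff_right Z_adjoint[of k l]
        A_selfadjoint[of k l] A_selfadjoint[of "Z k" "Z' l"] A_Z[symmetric])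
qed

lemma adjoint_op_moebius:
  assumes T: "\<And>f. f \<in> hcarrier E \<Longrightarrow> T f = moebius f" and h: "h \<in> hcarrier E"
  shows "adjoint_op E E T h = moebius_pair.moebius E Z' A h"
  by (rule adjoint_op_eqI)
     (use h T moebius_adjoint moebius_pair.moebius_carrier[OF swap] in auto)

text \<open>In the description of the range by domination, \<open>g = (1 - AZ)k\<close> makes the pairing
  \<open>\<langle>f,g\<rangle> = \<langle>(1 - AZ')f, k\<rangle>\<close> and the form comparable to \<open>\<parallel>k\<parallel>\<^sup>2 - \<parallel>Zk\<parallel>\<^sup>2\<close>.\<close>

theorem range_sqrt_defect:
  assumes P: "\<And>f. f \<in> hcarrier E \<Longrightarrow> P f = f - moebius_pair.moebius E Z' A (moebius f)"
  shows "sqrt_op E P ` hcarrier E = {f \<in> hcarrier E.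
    dominated E (f - A (Z' f)) (\<lambda>k. (hnorm E k)\<^sup>2 - (hnorm E (Z k))\<^sup>2)}"
proof -
  interpret swap: moebius_pair E Z' Z A by (rule swap)
  let ?Y = "\<lambda>f. swap.moebius (moebius f)"
  have pos: "hinner E (?Y f) f = of_real ((hnorm E (moebius f))\<^sup>2)" if "f \<in> hcarrier E" for f
    using swap.moebius_adjoint[of "moebius f" f] that by (simp add: inner_self)
  interpret Y: positive_contraction E ?Y
  proof
    show "bounded_op E E ?Y"
      unfolding bounded_op_def
    proof (intro conjI ballI allI exI)
      show "hnorm E (?Y x) \<le> 1 * hnorm E x" if "x \<in> hcarrier E" for x
        using moebius_contraction[OF that] swap.moebius_contraction[of "moebius x"] that by simp
    qed (simp_all add: bounded_opD[OF moebius_bounded] bounded_opD[OF swap.moebius_bounded])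
    show "hnorm E (?Y x) \<le> hnorm E x" if "x \<in> hcarrier E" for x
      using moebius_contraction[OF that] swap.moebius_contraction[of "moebius x"] that by simp
    show "hinner E (?Y x) y = hinner E x (?Y y)" if "x \<in> hcarrier E" "y \<in> hcarrier E" for x y
      using that swap.moebius_adjoint[of "moebius x" y] moebius_adjoint[of x "moebius y"] by simp
    show "0 \<le> Re (hinner E (?Y x) x)" if "x \<in> hcarrier E" for x
      using pos[OF that] by simp
  qed
  let ?p = "\<lambda>k. (hnorm E k)\<^sup>2 - (hnorm E (Z k))\<^sup>2"
  have p_nonneg: "0 \<le> ?p k" if "k \<in> hcarrier E" for k
    using that Z_contraction[OF that] by (simp add: power_mono hnorm_nonneg)
  have form: "Re (hinner E (g - ?Y g) g) = ?p k - ?p (A k)"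
    if "k \<in> hcarrier E" "g = k - A (Z k)" for g k
    using that pos[of g] moebius_defect[of k] by (simp add: inner_diff_left hnorm_sq)
  have pair: "hinner E f (k - A (Z k)) = hinner E (f - A (Z' f)) k"
    if "f \<in> hcarrier E" "k \<in> hcarrier E" for f k
    using that by (simp add: inner_diff_left inner_diff_right A_selfadjoint Z'_adjoint A_Z)
  have "(\<exists>C\<ge>0. \<forall>g\<in>hcarrier E. (cmod (hinner E f g))\<^sup>2 \<le> C * Re (hinner E (g - ?Y g) g)) \<longleftrightarrow>
        (\<exists>C\<ge>0. \<forall>k\<in>hcarrier E. (cmod (hinner E (f - A (Z' f)) k))\<^sup>2 \<le> C * ?p k)"
    (is "(\<exists>C\<ge>0. ?L C) \<longleftrightarrow> (\<exists>C\<ge>0. ?R C)") if f: "f \<in> hcarrier E" for f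
  proof
    assume "\<exists>C\<ge>0. ?L C"
    then obtain C where C: "C \<ge> 0" "?L C" by blast
    have "(cmod (hinner E (f - A (Z' f)) k))\<^sup>2 \<le> C * ?p k" if k: "k \<in> hcarrier E" for k
    proof -
      let ?g = "k - A (Z k)"
      have "(cmod (hinner E f ?g))\<^sup>2 \<le> C * Re (hinner E (?g - ?Y ?g) ?g)"
        using bspec[OF C(2), of ?g] k by simp
      then have "(cmod (hinner E (f - A (Z' f)) k))\<^sup>2 \<le> C * (?p k - ?p (A k))"
        using form[OF k refl] pair[OF f k] by simp
      also have "\<dots> \<le> C * ?p k"
        using C(1) p_nonneg[of "A k"] k by (intro mult_left_mono) auto
      finally show ?thesis .
    qed
    then show "\<exists>C\<ge>0. ?R C" using C(1) by blast
  next
    assume "\<exists>C\<ge>0. ?R C"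
    then obtain C where C: "C \<ge> 0" "?R C" by blast
    have "(cmod (hinner E f g))\<^sup>2 \<le> (2 * C) * Re (hinner E (g - ?Y g) g)" if g: "g \<in> hcarrier E" for g
    proof -
      obtain k where k: "k \<in> hcarrier E" "g = k - A (Z k)" using solve[OF g] by metis
      have "(cmod (hinner E f g))\<^sup>2 \<le> C * ?p k"
        using bspec[OF C(2) k(1)] pair[OF f k(1)] k(2) by simp
      also have "\<dots> \<le> C * (2 * (?p k - ?p (A k)))"
        using C(1) Z_defect[OF k(1)] p_nonneg[OF k(1)] by (intro mult_left_mono) auto
      also have "\<dots> = (2 * C) * Re (hinner E (g - ?Y g) g)"
        using form[OF k] by simp
      finally show ?thesis .
    qed
    then show "\<exists>C\<ge>0. ?L C" using C(1) by (intro exI[of _ "2 * C"]) auto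
  qed
  then show ?thesis
    using Y.sqrt_op_eq_sqroot[of P] P Y.range_sqroot by (auto simp: dominated_def)
qed

text \<open>The operator \<open>T\<close> is determined on the carrier by the functional equation, because \<open>1 - AZ\<close> is onto.\<close>

theorem carrier_range_space_defect:
  assumes T: "\<And>k. k \<in> hcarrier E \<Longrightarrow> T (k - A (Z k)) = Z k - A k"
  shows "hcarrier (range_space E (sqrt_op E (\<lambda>f. f - adjoint_op E E T (T f)))) =
      {f \<in> hcarrier E. dominated E (f - A (Z' f)) (\<lambda>k. (hnorm E k)\<^sup>2 - (hnorm E (Z k))\<^sup>2)}"
    (is ?thesis1)
    and "hcarrier (range_space E (sqrt_op E (\<lambda>f. f - T (adjoint_op E E T f)))) =
      {f \<in> hcarrier E. dominated E (f - A (Z f)) (\<lambda>k. (hnorm E k)\<^sup>2 - (hnorm E (Z' k))\<^sup>2)}"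
    (is ?thesis2)
proof -
  interpret swap: moebius_pair E Z' Z A by (rule swap)
  have Tf: "T f = moebius f" if "f \<in> hcarrier E" for f using T that by (rule moebius_eqI)
  note adj = adjoint_op_moebius[OF Tf]
  show ?thesis1
    unfolding range_space_def hilbert.simps by (rule range_sqrt_defect) (simp add: Tf adj)
  show ?thesis2
    unfolding range_space_def hilbert.simps by (rule swap.range_sqrt_defect) (simp add: Tf adj)
qed

end

section \<open>Weighted square-summable sequences\<close>

lemma hilbert_spaceI:
  assumes "pre_hilbert_space E"
    and lim: "\<And>x. (\<And>n::nat. x n \<in> hcarrier E) \<Longrightarrow>
      (\<And>e. e > 0 \<Longrightarrow> \<exists>N. \<forall>m\<ge>N. \<forall>n\<ge>N. hnorm E (x m - x n) < e) \<Longrightarrow>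
      \<exists>l\<in>hcarrier E. (\<lambda>n. hnorm E (x n - l)) \<longlonglongrightarrow> 0"
  shows "hilbert_space E"
proof -
  interpret pre_hilbert_space E by fact
  interpret M: Metric_space "hcarrier E" "hdist E" by (rule Metric_space)
  show ?thesis
  proof
    show "M.mcomplete"
      unfolding M.mcomplete_def
    proof (intro allI impI)
      fix x assume x: "M.MCauchy x"
      then have c: "x n \<in> hcarrier E" for n by (auto simp: M.MCauchy_def)
      then have "\<exists>N. \<forall>m\<ge>N. \<forall>n\<ge>N. hnorm E (x m - x n) < e" if "e > 0" for e
        using x that unfolding M.MCauchy_def by (auto simp: hdist_def)
      from lim[OF c this] obtain l where "l \<in> hcarrier E" "(\<lambda>n. hnorm E (x n - l)) \<longlonglongrightarrow> 0"
        by blast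
      then show "\<exists>l. limitin M.mtopology x l sequentially"
        using limitinI[of l x sequentially] c unfolding htopology_def by blast
    qed
  qed
qed

text \<open>The division by \<open>c n\<close> matches the inner product of \<^const>\<open>bergman_space\<close>, which thereby becomes the
  inner product of the sequences of Taylor coefficients.\<close>

definition l2_space :: "(nat \<Rightarrow> real) \<Rightarrow> 'a::complex_vector hilbert \<Rightarrow> (nat \<Rightarrow> 'a) hilbert"
  where "l2_space c E =
    \<lparr> hcarrier = {a. (\<forall>n. a n \<in> hcarrier E) \<and> summable (\<lambda>n. (hnorm E (a n))\<^sup>2 / c n)},
      hinner = (\<lambda>a b. \<Sum>n. hinner E (a n) (b n) / of_real (c n)) \<rparr>"

locale weighted_l2 = hilbert_space E for E :: "'a::complex_vector hilbert" +
  fixes c :: "nat \<Rightarrow> real"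
  assumes c_pos: "0 < c n"
begin

abbreviation L where "L \<equiv> l2_space c E"

lemma l2_carrier_iff:
  "a \<in> hcarrier L \<longleftrightarrow> (\<forall>n. a n \<in> hcarrier E) \<and> summable (\<lambda>n. (hnorm E (a n))\<^sup>2 / c n)"
  by (simp add: l2_space_def)

lemma l2_carrierD:
  assumes "a \<in> hcarrier L"
  shows "a n \<in> hcarrier E" "summable (\<lambda>n. (hnorm E (a n))\<^sup>2 / c n)"
  using assms by (auto simp: l2_carrier_iff)

lemma l2_carrier_comparison:
  assumes "\<And>n. a n \<in> hcarrier E" and "summable g" and "\<And>n. (hnorm E (a n))\<^sup>2 / c n \<le> g n"
  shows "a \<in> hcarrier L"
  unfolding l2_carrier_iff using assms c_pos
  by (auto intro!: summable_comparison_test'[of g 0] simp: less_imp_le)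

lemma l2_inner_summable:
  assumes a: "a \<in> hcarrier L" and b: "b \<in> hcarrier L"
  shows "summable (\<lambda>n. norm (hinner E (a n) (b n) / of_real (c n)))"
proof (rule summable_comparison_test'[of "\<lambda>n. (hnorm E (a n))\<^sup>2 / c n + (hnorm E (b n))\<^sup>2 / c n" 0])
  show "summable (\<lambda>n. (hnorm E (a n))\<^sup>2 / c n + (hnorm E (b n))\<^sup>2 / c n)"
    using a b by (intro summable_add) (auto simp: l2_carrier_iff)
  fix n
  let ?x = "hnorm E (a n)" and ?y = "hnorm E (b n)"
  have "norm (hinner E (a n) (b n)) \<le> ?x * ?y" using a b by (auto simp: l2_carrier_iff intro: Cauchy_Schwarz)
  also have "?x * ?y \<le> ?x\<^sup>2 + ?y\<^sup>2"
    using sum_squares_bound[of ?x ?y] 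
      mult_nonneg_nonneg[OF hnorm_nonneg[OF l2_carrierD(1)[OF a]] hnorm_nonneg[OF l2_carrierD(1)[OF b]], of n n]
    by linarith
  finally show "norm (norm (hinner E (a n) (b n) / of_real (c n))) \<le> (hnorm E (a n))\<^sup>2 / c n + (hnorm E (b n))\<^sup>2 / c n"
    using c_pos[of n] by (simp add: norm_divide divide_right_mono flip: add_divide_distrib)
qed

lemma l2_inner_sums:
  assumes "a \<in> hcarrier L" "b \<in> hcarrier L"
  shows "(\<lambda>n. hinner E (a n) (b n) / of_real (c n)) sums hinner L a b"
  using summable_norm_cancel[OF l2_inner_summable[OF assms]] by (simp add: l2_space_def summable_sums)

lemma l2_add:
  assumes a: "a \<in> hcarrier L" and b: "b \<in> hcarrier L"
  shows "a + b \<in> hcarrier L"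
proof (rule l2_carrier_comparison)
  show "(a + b) n \<in> hcarrier E" for n using a b by (simp add: l2_carrier_iff plus_fun_apply)
  show "summable (\<lambda>n. 2 * ((hnorm E (a n))\<^sup>2 / c n) + 2 * ((hnorm E (b n))\<^sup>2 / c n))"
    using a b by (intro summable_add summable_mult) (auto simp: l2_carrier_iff)
  fix n
  let ?x = "hnorm E (a n)" and ?y = "hnorm E (b n)"
  have "(hnorm E (a n + b n))\<^sup>2 \<le> (?x + ?y)\<^sup>2"
    using a b by (intro power_mono hnorm_triangle hnorm_nonneg) (auto simp: l2_carrier_iff)
  also have "\<dots> \<le> 2 * ?x\<^sup>2 + 2 * ?y\<^sup>2"
    using sum_squares_bound[of ?x ?y] by (simp add: power2_sum)
  finally have "(hnorm E (a n + b n))\<^sup>2 / c n \<le> (2 * ?x\<^sup>2 + 2 * ?y\<^sup>2) / c n"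
    using c_pos[of n] by (simp add: divide_right_mono)
  then show "(hnorm E ((a + b) n))\<^sup>2 / c n \<le> 2 * ((hnorm E (a n))\<^sup>2 / c n) + 2 * ((hnorm E (b n))\<^sup>2 / c n)"
    by (simp add: plus_fun_apply add_divide_distrib)
qed

lemma l2_scale:
  assumes a: "a \<in> hcarrier L"
  shows "s *\<^sub>C a \<in> hcarrier L"
proof (rule l2_carrier_comparison)
  show "(s *\<^sub>C a) n \<in> hcarrier E" for n using a by (simp add: l2_carrier_iff scaleC_fun_def)
  show "summable (\<lambda>n. (cmod s)\<^sup>2 * ((hnorm E (a n))\<^sup>2 / c n))"
    using a by (intro summable_mult) (auto simp: l2_carrier_iff)
  show "(hnorm E ((s *\<^sub>C a) n))\<^sup>2 / c n \<le> (cmod s)\<^sup>2 * ((hnorm E (a n))\<^sup>2 / c n)" for n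
    using a by (simp add: scaleC_fun_def hnorm_scaleC l2_carrier_iff power_mult_distrib)
qed

lemma l2_norm_sq_sums:
  assumes a: "a \<in> hcarrier L"
  shows "(\<lambda>n. (hnorm E (a n))\<^sup>2 / c n) sums Re (hinner L a a)"
proof -
  have "Re (hinner E (a n) (a n) / of_real (c n)) = (hnorm E (a n))\<^sup>2 / c n" for n
    using a by (simp add: l2_carrier_iff hnorm_sq)
  then show ?thesis using sums_Re[OF l2_inner_sums[OF a a]] by (simp only:)
qed

lemma l2_pre_hilbert: "pre_hilbert_space L"
proof
  show "cvec.subspace (hcarrier L)"
  proof (rule cvec.subspaceI)
    show "0 \<in> hcarrier L" by (simp add: l2_carrier_iff zero_fun_apply)
  qed (auto intro: l2_add l2_scale)
  fix x y z s
  assume x: "x \<in> hcarrier L" and y: "y \<in> hcarrier L"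
  show "hinner L (s *\<^sub>C x) y = s * hinner L x y"
  proof (rule sums_unique2[OF l2_inner_sums[OF l2_scale[OF x] y]])
    have "hinner E ((s *\<^sub>C x) n) (y n) / of_real (c n) = s * (hinner E (x n) (y n) / of_real (c n))" for n
      using x y by (simp add: l2_carrier_iff scaleC_fun_def inner_scaleC_left)
    then show "(\<lambda>n. hinner E ((s *\<^sub>C x) n) (y n) / of_real (c n)) sums (s * hinner L x y)"
      using sums_mult[OF l2_inner_sums[OF x y], of s] by (simp only:)
  qed
  show "hinner L y x = cnj (hinner L x y)"
  proof (rule sums_unique2[OF l2_inner_sums[OF y x]])
    have "hinner E (y n) (x n) / of_real (c n) = cnj (hinner E (x n) (y n) / of_real (c n))" for n
      using x y by (simp add: l2_carrier_iff inner_commute[of "x n" "y n"])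
    then show "(\<lambda>n. hinner E (y n) (x n) / of_real (c n)) sums cnj (hinner L x y)"
      using l2_inner_sums[OF x y] by (simp only: sums_cnj)
  qed
  show "hinner L (x + y) z = hinner L x z + hinner L y z" if z: "z \<in> hcarrier L"
  proof (rule sums_unique2[OF l2_inner_sums[OF l2_add[OF x y] z]])
    have "hinner E ((x + y) n) (z n) / of_real (c n)
        = hinner E (x n) (z n) / of_real (c n) + hinner E (y n) (z n) / of_real (c n)" for n
      using x y z by (simp add: l2_carrier_iff plus_fun_apply inner_add_left add_divide_distrib)
    then show "(\<lambda>n. hinner E ((x + y) n) (z n) / of_real (c n)) sums (hinner L x z + hinner L y z)"
      using sums_add[OF l2_inner_sums[OF x z] l2_inner_sums[OF y z]] by simp
  qed
next
  fix x assume x: "x \<in> hcarrier L"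
  have nn: "0 \<le> (hnorm E (x n))\<^sup>2 / c n" for n using c_pos[of n] by (simp add: less_imp_le)
  show "0 \<le> Re (hinner L x x)"
    using suminf_nonneg[OF l2_carrierD(2)[OF x] nn] unfolding sums_unique[OF l2_norm_sq_sums[OF x]] .
  assume "hinner L x x = 0"
  then have "(\<Sum>n. (hnorm E (x n))\<^sup>2 / c n) = 0"
    using sums_unique[OF l2_norm_sq_sums[OF x]] by simp
  then have "(hnorm E (x n))\<^sup>2 / c n = 0" for n
    using suminf_eq_zero_iff[of "\<lambda>n. (hnorm E (x n))\<^sup>2 / c n"] nn l2_carrierD(2)[OF x] by simp
  then have "x n = 0" for n
    using less_imp_neq[OF c_pos[of n]] hnorm_eq_0_iff[OF l2_carrierD(1)[OF x, of n]] by auto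
  then show "x = 0" by (simp add: fun_eq_iff zero_fun_apply)
qed

sublocale l2: pre_hilbert_space L by (rule l2_pre_hilbert)

lemma l2_hnorm_sq_sums:
  "a \<in> hcarrier L \<Longrightarrow> (\<lambda>n. (hnorm E (a n))\<^sup>2 / c n) sums (hnorm L a)\<^sup>2"
  using l2_norm_sq_sums by (simp add: l2.hnorm_sq)

lemma l2_partial_le:
  assumes a: "a \<in> hcarrier L"
  shows "(\<Sum>n<N. (hnorm E (a n))\<^sup>2 / c n) \<le> (hnorm L a)\<^sup>2"
  unfolding sums_unique[OF l2_hnorm_sq_sums[OF a]]
  by (rule sum_le_suminf[OF l2_carrierD(2)[OF a]]) (auto simp: c_pos less_imp_le)

lemma l2_bounded_partial:
  assumes a: "\<And>n. a n \<in> hcarrier E" and b: "\<And>N. (\<Sum>n<N. (hnorm E (a n))\<^sup>2 / c n) \<le> M"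
  shows "a \<in> hcarrier L" "(hnorm L a)\<^sup>2 \<le> M"
proof -
  have "summable (\<lambda>n. (hnorm E (a n))\<^sup>2 / c n)"
    by (rule summableI_nonneg_bounded[OF _ b]) (simp add: c_pos less_imp_le)
  then show aL: "a \<in> hcarrier L" using a by (simp add: l2_carrier_iff)
  show "(hnorm L a)\<^sup>2 \<le> M"
    using l2_hnorm_sq_sums[OF aL] b unfolding sums_def by (intro LIMSEQ_le_const2) auto
qed

lemma l2_coordinate_le:
  assumes a: "a \<in> hcarrier L"
  shows "hnorm E (a n) \<le> sqrt (c n) * hnorm L a"
proof (rule power2_le_imp_le)
  have "(hnorm E (a n))\<^sup>2 / c n \<le> (\<Sum>k<Suc n. (hnorm E (a k))\<^sup>2 / c k)"
    by (rule member_le_sum) (auto simp: c_pos less_imp_le)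
  also have "\<dots> \<le> (hnorm L a)\<^sup>2" by (rule l2_partial_le[OF a])
  finally show "(hnorm E (a n))\<^sup>2 \<le> (sqrt (c n) * hnorm L a)\<^sup>2"
    using c_pos[of n] by (simp add: power_mult_distrib field_simps less_imp_le)
  show "0 \<le> sqrt (c n) * hnorm L a"
    using c_pos[of n] l2.hnorm_nonneg[OF a] by (simp add: less_imp_le)
qed

text \<open>Completeness: coordinates converge, and the partial sums of the squared norm pass to the limit.\<close>

theorem l2_hilbert: "hilbert_space L"
proof (rule hilbert_spaceI[OF l2_pre_hilbert])
  fix x :: "nat \<Rightarrow> nat \<Rightarrow> 'a"
  assume x [simp]: "\<And>m. x m \<in> hcarrier L"
    and cauchy: "\<And>e. e > 0 \<Longrightarrow> \<exists>N. \<forall>m\<ge>N. \<forall>n\<ge>N. hnorm L (x m - x n) < e"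
  have [simp]: "x m n \<in> hcarrier E" for m n using l2_carrierD(1)[OF x] .
  have "\<exists>l. limitin (htopology E) (\<lambda>m. x m n) l sequentially" for n
  proof (rule complete_limit)
    fix e :: real assume e: "e > 0"
    then obtain N where N: "\<And>m k. m \<ge> N \<Longrightarrow> k \<ge> N \<Longrightarrow> hnorm L (x m - x k) < e / sqrt (c n)"
      using cauchy[of "e / sqrt (c n)"] c_pos[of n] by auto
    have "hnorm E (x m n - x k n) < e" if "m \<ge> N" "k \<ge> N" for m k
      using l2_coordinate_le[of "x m - x k" n] N[OF that] c_pos[of n]
      by (simp add: pos_less_divide_eq mult.commute)
    then show "\<exists>N. \<forall>k\<ge>N. \<forall>m\<ge>k. hnorm E (x m n - x k n) < e" by (meson order_trans)
  qed simp
  then obtain l where l: "\<And>n. limitin (htopology E) (\<lambda>m. x m n) (l n) sequentially" by metis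
  have [simp]: "l n \<in> hcarrier E" for n using limitin_carrier[OF l] .
  have tail: "x m - l \<in> hcarrier L \<and> (hnorm L (x m - l))\<^sup>2 \<le> e\<^sup>2"
    if N: "\<And>k. k \<ge> N \<Longrightarrow> hnorm L (x m - x k) < e" for m N e
  proof -
    let ?S = "\<lambda>y K. \<Sum>n<K. (hnorm E (y n))\<^sup>2 / c n"
    have "?S (x m - l) K \<le> e\<^sup>2" for K
    proof (rule LIMSEQ_le_const2)
      have "limitin (htopology E) (\<lambda>k. x m n - x k n) (x m n - l n) sequentially" for n
      proof (rule limitinI)
        have "hnorm E (x m n - x k n - (x m n - l n)) = hnorm E (x k n - l n)" for k
          using hnorm_commute[of "l n" "x k n"] by simp
        then show "(\<lambda>k. hnorm E (x m n - x k n - (x m n - l n))) \<longlonglongrightarrow> 0"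
          using l[of n] by (simp only: limitin_iff)
      qed auto
      from limitin_hnorm[OF this]
      show "(\<lambda>k. \<Sum>n<K. (hnorm E ((x m - x k) n))\<^sup>2 / c n) \<longlonglongrightarrow> ?S (x m - l) K"
        by (intro tendsto_sum tendsto_divide tendsto_power tendsto_const)
           (auto simp: c_pos[THEN less_imp_neq, symmetric])
      have "?S (x m - x k) K \<le> e\<^sup>2" if "k \<ge> N" for k
      proof -
        have "?S (x m - x k) K \<le> (hnorm L (x m - x k))\<^sup>2"
          by (rule l2_partial_le[OF l2.diff_carrier[OF x x]])
        also have "\<dots> \<le> e\<^sup>2"
          using N[OF that] by (intro power_mono) (auto simp: l2.hnorm_nonneg)
        finally show ?thesis .
      qed
      then show "\<exists>N. \<forall>k\<ge>N. ?S (x m - x k) K \<le> e\<^sup>2" by blast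
    qed
    then show ?thesis using l2_bounded_partial[of "x m - l" "e\<^sup>2"] by simp
  qed
  have lL: "l \<in> hcarrier L"
  proof -
    obtain N where N: "\<And>m k. m \<ge> N \<Longrightarrow> k \<ge> N \<Longrightarrow> hnorm L (x m - x k) < 1"
      using cauchy[of 1] by auto
    have "x N - l \<in> hcarrier L" using tail[of N N 1] N by simp
    with x have "x N - (x N - l) \<in> hcarrier L" by (rule l2.diff_carrier)
    moreover have "x N - (x N - l) = l" by (simp add: fun_eq_iff)
    ultimately show ?thesis by (simp only:)
  qed
  show "\<exists>l\<in>hcarrier L. (\<lambda>m. hnorm L (x m - l)) \<longlonglongrightarrow> 0"
  proof (intro bexI[of _ l] lL LIMSEQ_I)
    fix e :: real assume e: "e > 0"
    then obtain N where N: "\<And>m k. m \<ge> N \<Longrightarrow> k \<ge> N \<Longrightarrow> hnorm L (x m - x k) < e / 2"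
      using cauchy[of "e/2"] by auto
    have "norm (hnorm L (x m - l) - 0) < e" if "m \<ge> N" for m
    proof -
      have "hnorm L (x m - l) \<le> e / 2"
      proof (rule power2_le_imp_le)
        show "(hnorm L (x m - l))\<^sup>2 \<le> (e / 2)\<^sup>2" using tail[OF N[OF that]] by blast
      qed (use e in simp)
      moreover have "0 \<le> hnorm L (x m - l)" by (intro l2.hnorm_nonneg l2.diff_carrier lL x)
      ultimately show ?thesis using e by simp
    qed
    then show "\<exists>N. \<forall>m\<ge>N. norm (hnorm L (x m - l) - 0) < e" by blast
  qed
qed

end

section \<open>Weighted Bergman spaces as sequence spaces\<close>

lemma bergman_coeff_pos: "\<beta> > -2 \<Longrightarrow> 0 < bergman_coeff \<beta> n"
  by (simp add: bergman_coeff_def Gamma_real_pos)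

lemma bergman_coeff_Suc:
  assumes "\<beta> > -2"
  shows "bergman_coeff \<beta> (Suc n) = bergman_coeff \<beta> n * ((real n + \<beta> + 2) / (real n + 1))"
proof -
  have "real n + \<beta> + 2 \<notin> \<int>\<^sub>\<le>\<^sub>0"
    using assms by (auto elim!: nonpos_Ints_cases)
  then have "Gamma (real (Suc n) + \<beta> + 2) = (real n + \<beta> + 2) * Gamma (real n + \<beta> + 2)"
    using Gamma_plus1[of "real n + \<beta> + 2"] by (simp add: add_ac)
  then show ?thesis by (simp add: bergman_coeff_def field_simps)
qed

lemma bergman_coeff_shift:
  assumes "\<alpha> > -1"
  shows "bergman_coeff (\<alpha> - 1) n = bergman_coeff \<alpha> n * ((\<alpha> + 1) / (real n + \<alpha> + 1))"
proof -
  have "real n + \<alpha> + 1 \<notin> \<int>\<^sub>\<le>\<^sub>0" "\<alpha> + 1 \<notin> \<int>\<^sub>\<le>\<^sub>0"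
    using assms by (auto elim!: nonpos_Ints_cases)
  then have "Gamma (real n + \<alpha> + 2) = (real n + \<alpha> + 1) * Gamma (real n + \<alpha> + 1)"
    "Gamma (\<alpha> + 2) = (\<alpha> + 1) * Gamma (\<alpha> + 1)"
    using Gamma_plus1[of "real n + \<alpha> + 1"] Gamma_plus1[of "\<alpha> + 1"] by (simp_all add: add_ac)
  moreover have "real n + (\<alpha> - 1) + 2 = real n + \<alpha> + 1" "\<alpha> - 1 + 2 = \<alpha> + 1" by auto
  moreover have "real n + \<alpha> + 1 \<noteq> 0" "\<alpha> + 1 \<noteq> 0" using assms by auto
  ultimately show ?thesis unfolding bergman_coeff_def by (simp only:) (simp only: divide_simps, simp)
qed

lemma summable_bergman_coeff:
  assumes "\<beta> > -2" "0 \<le> r" "r < 1"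
  shows "summable (\<lambda>n. bergman_coeff \<beta> n * r ^ n)"
proof -
  have "summable (\<lambda>n. complex_of_real (bergman_coeff \<beta> n * r ^ n))"
    using bergman_coeff_sums[OF assms(1), of "of_real r"] assms by (auto simp: sums_iff)
  then show ?thesis by (simp only: summable_of_real_iff)
qed

text \<open>Dividing by \<open>z\<^sup>m\<close> after the first \<open>m\<close> coefficients are known to vanish, let \<open>z\<close> tend to \<open>0\<close>.\<close>

lemma powser_zero_coeffs:
  fixes d :: "nat \<Rightarrow> complex"
  assumes sm: "\<And>z. norm z < 1 \<Longrightarrow> (\<lambda>n. d n * z ^ n) sums 0"
  shows "d m = 0"
proof (induction m rule: less_induct)
  case (less m)
  have "((\<lambda>_. 0) \<longlongrightarrow> d (0 + m)) (at (0::complex))"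
  proof (rule powser_limit_0_strong[of 1 "\<lambda>n. d (n + m)"])
    fix z :: complex assume z: "z \<noteq> 0" "norm z < 1"
    have "(\<lambda>n. d (n + m) * z ^ (n + m)) sums 0"
      using sm[OF z(2)] less by (subst sums_iff_shift) auto
    from sums_mult[OF this, of "inverse (z ^ m)"]
    show "(\<lambda>n. d (n + m) * z ^ n) sums 0" using z(1) by (simp add: power_add field_simps)
  qed simp
  then show ?case using tendsto_const_iff[of "at (0::complex)" "0::complex"] by simp
qed

context hilbert_space
begin

abbreviation psums where "psums z a \<equiv> (\<lambda>N::nat. \<Sum>n<N. z ^ n *\<^sub>C a n)"

lemma power_series_inner:
  assumes f: "has_power_series E f a" and z: "z \<in> unit_disk" and v: "v \<in> hcarrier E"
  shows "(\<lambda>n. hinner E (a n) v * z ^ n) sums hinner E (f z) v"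
  using limitin_inner_left[of "psums z a" "f z" sequentially v] assms
  by (simp add: has_power_series_def sums_def inner_sum_left inner_scaleC_left mult.commute)

lemma power_series_unique:
  assumes f: "has_power_series E f a" and g: "has_power_series E f b"
  shows "a = b"
proof
  fix m
  have ab: "a n \<in> hcarrier E" "b n \<in> hcarrier E" for n
    using f g by (auto simp: has_power_series_def)
  show "a m = b m"
  proof (rule inner_eqI[OF ab])
    fix v assume v: "v \<in> hcarrier E"
    have "(\<lambda>n. (hinner E (a n) v - hinner E (b n) v) * z ^ n) sums 0" if "norm z < 1" for z
      using sums_diff[OF power_series_inner[OF f _ v, of z] power_series_inner[OF g _ v, of z]] that
      by (simp add: algebra_simps)
    from powser_zero_coeffs[OF this, of m] show "hinner E (a m) v = hinner E (b m) v" by simp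
  qed
qed

lemma taylor_coeffs_eqI: "has_power_series E f a \<Longrightarrow> taylor_coeffs E f = a"
  unfolding taylor_coeffs_def using power_series_unique by blast

lemma power_series_add:
  assumes "has_power_series E f a" "has_power_series E g b"
  shows "has_power_series E (f + g) (a + b)"
  using assms limitin_add[of "psums z a" "f z" sequentially "psums z b" "g z" for z]
  by (simp add: has_power_series_def plus_fun_apply scaleC_add_right sum.distrib)

lemma power_series_op:
  assumes A: "bounded_op E E A" and f: "has_power_series E f a"
  shows "has_power_series E (\<lambda>z. A (f z)) (\<lambda>n. A (a n))"
  unfolding has_power_series_def
proof (intro conjI allI ballI)
  have a: "a n \<in> hcarrier E" for n using f by (auto simp: has_power_series_def)
  then show "A (a n) \<in> hcarrier E" for n by (simp add: bounded_opD(1)[OF A])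
  fix z assume z: "z \<in> unit_disk"
  have "A (psums z a N) = (\<Sum>n<N. z ^ n *\<^sub>C A (a n))" for N
    by (subst op_sum[OF A]) (auto simp: a bounded_opD(3)[OF A])
  then show "limitin (htopology E) (\<lambda>N. \<Sum>n<N. z ^ n *\<^sub>C A (a n)) (A (f z)) sequentially"
    using limitin_op[OF A, of "psums z a" "f z" sequentially] f z
    by (simp add: has_power_series_def)
qed

lemma scaleC_bounded: "bounded_op E E (\<lambda>x. s *\<^sub>C x)"
  unfolding bounded_op_def
  by (auto simp: scaleC_add_right scaleC_scaleC mult.commute hnorm_scaleC intro!: exI[of _ "cmod s"])

lemma power_series_scaleC: "has_power_series E f a \<Longrightarrow> has_power_series E (s *\<^sub>C f) (s *\<^sub>C a)"
  using power_series_op[OF scaleC_bounded, of f a s] by (simp add: scaleC_fun_def)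

lemma power_series_shift:
  assumes f: "has_power_series E f a"
  shows "has_power_series E (\<lambda>z. z *\<^sub>C f z) (case_nat 0 a)"
  unfolding has_power_series_def
proof (intro conjI allI ballI)
  have a: "a n \<in> hcarrier E" for n using f by (auto simp: has_power_series_def)
  then show aa: "case_nat 0 a n \<in> hcarrier E" for n by (cases n) auto
  fix z assume z: "z \<in> unit_disk"
  let ?s = "\<lambda>N. \<Sum>n<N. z ^ n *\<^sub>C case_nat 0 a n"
  have "z *\<^sub>C (psums z a N) = ?s (Suc N)" for N
    by (subst sum.lessThan_Suc_shift) (simp add: cvec.scale_sum_right scaleC_scaleC)
  then have "limitin (htopology E) (\<lambda>N. ?s (Suc N)) (z *\<^sub>C f z) sequentially"
    using limitin_op[OF scaleC_bounded, of "psums z a" "f z" sequentially z] f z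
    by (simp add: has_power_series_def)
  then show "limitin (htopology E) ?s (z *\<^sub>C f z) sequentially"
    using LIMSEQ_imp_Suc[of "\<lambda>N. hnorm E (?s N - z *\<^sub>C f z)"] aa
    by (auto simp: limitin_iff sum_carrier simp del: sum.lessThan_Suc)
qed

end

locale bergman = hilbert_space E for E :: "'a::complex_vector hilbert" +
  fixes \<beta> :: real
  assumes \<beta>: "\<beta> > -2"
begin

sublocale weighted_l2 E "bergman_coeff \<beta>"
  by unfold_locales (simp add: bergman_coeff_pos \<beta>)

abbreviation H where "H \<equiv> bergman_space \<beta> E"

abbreviation coeffs where "coeffs \<equiv> taylor_coeffs E"

lemma bergman_carrierI:
  assumes "has_power_series E f a" "a \<in> hcarrier L" "\<And>z. z \<notin> unit_disk \<Longrightarrow> f z = 0"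
  shows "f \<in> hcarrier H"
  using assms by (auto simp: bergman_space_def l2_carrier_iff)

lemma bergman_carrierD:
  assumes f: "f \<in> hcarrier H"
  shows "has_power_series E f (coeffs f)" "coeffs f \<in> hcarrier L" "z \<notin> unit_disk \<Longrightarrow> f z = 0"
proof -
  obtain a where a: "has_power_series E f a" "summable (\<lambda>n. (hnorm E (a n))\<^sup>2 / bergman_coeff \<beta> n)"
    using f by (auto simp: bergman_space_def)
  then show "has_power_series E f (coeffs f)" "coeffs f \<in> hcarrier L"
    using taylor_coeffs_eqI[OF a(1)] by (auto simp: l2_carrier_iff has_power_series_def)
  show "f z = 0" if "z \<notin> unit_disk" using f that by (simp add: bergman_space_def)
qed

lemma bergman_inner: "hinner H f g = hinner L (coeffs f) (coeffs g)"
  by (simp add: bergman_space_def l2_space_def)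

lemma bergman_hnorm: "hnorm H f = hnorm L (coeffs f)"
  by (simp add: hnorm_def bergman_inner)

lemma coeffs_carrier [simp]: "f \<in> hcarrier H \<Longrightarrow> coeffs f \<in> hcarrier L"
  by (rule bergman_carrierD)

lemma coeffs_inj:
  assumes "f \<in> hcarrier H" "g \<in> hcarrier H" "coeffs f = coeffs g"
  shows "f = g"
proof
  fix z show "f z = g z"
  proof (cases "z \<in> unit_disk")
    case True
    show ?thesis
      by (rule limit_unique[of "psums z (coeffs f)" _ sequentially])
         (use bergman_carrierD(1)[OF assms(1)] bergman_carrierD(1)[OF assms(2)] assms(3) True
           in \<open>auto simp: has_power_series_def\<close>)
  qed (use bergman_carrierD(3) assms in metis)
qed

lemma bergman_add:
  assumes "f \<in> hcarrier H" "g \<in> hcarrier H"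
  shows "f + g \<in> hcarrier H" "coeffs (f + g) = coeffs f + coeffs g"
proof -
  have "has_power_series E (f + g) (coeffs f + coeffs g)"
    using assms by (intro power_series_add bergman_carrierD)
  then show "f + g \<in> hcarrier H" "coeffs (f + g) = coeffs f + coeffs g"
    using bergman_carrierI[of "f + g", OF _ l2_add] bergman_carrierD(3)[OF assms(1)]
      bergman_carrierD(3)[OF assms(2)] assms
    by (simp_all add: taylor_coeffs_eqI plus_fun_apply)
qed

lemma bergman_scaleC:
  assumes "f \<in> hcarrier H"
  shows "s *\<^sub>C f \<in> hcarrier H" "coeffs (s *\<^sub>C f) = s *\<^sub>C coeffs f"
proof -
  have "has_power_series E (s *\<^sub>C f) (s *\<^sub>C coeffs f)"
    using assms by (intro power_series_scaleC bergman_carrierD)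
  moreover have "(s *\<^sub>C f) z = 0" if "z \<notin> unit_disk" for z
    using bergman_carrierD(3)[OF assms that] by (simp add: scaleC_fun_def)
  ultimately show "s *\<^sub>C f \<in> hcarrier H" "coeffs (s *\<^sub>C f) = s *\<^sub>C coeffs f"
    using bergman_carrierI[of "s *\<^sub>C f", OF _ l2_scale] assms by (simp_all add: taylor_coeffs_eqI)
qed

text \<open>The norm \<open>\<parallel>a\<^sub>n\<parallel> |z|\<^sup>n\<close> of a term is at most \<open>\<parallel>a\<^sub>n\<parallel>\<^sup>2/c\<^sub>n + c\<^sub>n (|z|\<^sup>2)\<^sup>n\<close> with
  \<open>c\<^sub>n = bergman_coeff \<beta> n\<close>, and the series of the \<open>c\<^sub>n (|z|\<^sup>2)\<^sup>n\<close> is the one of the reproducing kernel on the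
  diagonal.\<close>

lemma power_series_exists:
  assumes a: "a \<in> hcarrier L"
  shows "\<exists>f\<in>hcarrier H. coeffs f = a"
proof -
  have "\<exists>l. limitin (htopology E) (psums z a) l sequentially" if z: "z \<in> unit_disk" for z
  proof (rule summable_hnorm_limit)
    show "z ^ n *\<^sub>C a n \<in> hcarrier E" for n using l2_carrierD(1)[OF a] by simp
    let ?c = "bergman_coeff \<beta>"
    have "(cmod z)\<^sup>2 < 1" using z by (simp add: power_less_one_iff)
    then have sm: "summable (\<lambda>n. (hnorm E (a n))\<^sup>2 / ?c n + ?c n * ((cmod z)\<^sup>2) ^ n)"
      using l2_carrierD(2)[OF a] by (intro summable_add summable_bergman_coeff \<beta>) auto
    show "summable (\<lambda>n. hnorm E (z ^ n *\<^sub>C a n))"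
    proof (rule summable_comparison_test'[OF sm, of 0])
      fix n
      let ?x = "hnorm E (a n) / sqrt (?c n)" and ?y = "sqrt (?c n) * cmod z ^ n"
      have c: "?c n > 0" by (rule c_pos)
      have nn: "0 \<le> hnorm E (a n)" using l2_carrierD(1)[OF a] by (rule hnorm_nonneg)
      have "hnorm E (z ^ n *\<^sub>C a n) = ?x * ?y"
        using c l2_carrierD(1)[OF a] by (simp add: hnorm_scaleC norm_power)
      also have "\<dots> \<le> ?x\<^sup>2 + ?y\<^sup>2"
      proof -
        have "0 \<le> ?x * ?y" using c nn by (intro mult_nonneg_nonneg) auto
        then show ?thesis using sum_squares_bound[of ?x ?y] by linarith
      qed
      also have "\<dots> = (hnorm E (a n))\<^sup>2 / ?c n + ?c n * ((cmod z)\<^sup>2) ^ n"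
        using c by (simp add: power_divide power_mult_distrib power_mult[symmetric] mult.commute)
      finally show "norm (hnorm E (z ^ n *\<^sub>C a n)) \<le> (hnorm E (a n))\<^sup>2 / ?c n + ?c n * ((cmod z)\<^sup>2) ^ n"
        using l2_carrierD(1)[OF a] by (simp add: hnorm_nonneg)
    qed
  qed
  then obtain g where g: "\<And>z. z \<in> unit_disk \<Longrightarrow> limitin (htopology E) (psums z a) (g z) sequentially"
    by metis
  define f where "f z = (if z \<in> unit_disk then g z else 0)" for z
  have "has_power_series E f a"
    using g l2_carrierD(1)[OF a] by (simp add: has_power_series_def f_def)
  then show ?thesis
    using bergman_carrierI[of f a] taylor_coeffs_eqI a by (auto simp: f_def)
qed

lemma bergman_pre_hilbert: "pre_hilbert_space H"
proof
  show "cvec.subspace (hcarrier H)"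
  proof (rule cvec.subspaceI)
    obtain f where "f \<in> hcarrier H" using power_series_exists[OF l2.zero_carrier] by blast
    from bergman_scaleC(1)[OF this, of 0] show "0 \<in> hcarrier H" by simp
  qed (auto intro: bergman_add bergman_scaleC)
  fix x assume x: "x \<in> hcarrier H"
  show "hinner H (s *\<^sub>C x) y = s * hinner H x y" if "y \<in> hcarrier H" for y s
    using x that by (simp add: bergman_inner bergman_scaleC l2.inner_scaleC_left)
  show "hinner H y x = cnj (hinner H x y)" if "y \<in> hcarrier H" for y
    using x that unfolding bergman_inner by (intro l2.inner_commute) auto
  show "hinner H (x + y) z = hinner H x z + hinner H y z" if "y \<in> hcarrier H" "z \<in> hcarrier H" for y z
    using x that by (simp add: bergman_inner bergman_add l2.inner_add_left)
  show "0 \<le> Re (hinner H x x)" using x unfolding bergman_inner by (intro l2.inner_nonneg) auto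
  assume "hinner H x x = 0"
  then have "coeffs x = 0" using x unfolding bergman_inner by (intro l2.inner_eq_zero) auto
  then have "coeffs x = coeffs (0 *\<^sub>C x)" using bergman_scaleC(2)[OF x, of 0] by simp
  then show "x = 0" using coeffs_inj[OF x bergman_scaleC(1)[OF x, of 0]] by simp
qed

sublocale bs: pre_hilbert_space H by (rule bergman_pre_hilbert)

lemma bergman_diff:
  assumes "f \<in> hcarrier H" "g \<in> hcarrier H"
  shows "coeffs (f - g) = coeffs f - coeffs g"
  using bergman_add(2)[of "f - g" g] assms by simp

theorem bergman_hilbert: "hilbert_space H"
proof (rule hilbert_spaceI[OF bergman_pre_hilbert])
  interpret l2h: hilbert_space L by (rule l2_hilbert)
  fix x :: "nat \<Rightarrow> complex \<Rightarrow> 'a" assume x: "\<And>n. x n \<in> hcarrier H"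
    and cauchy: "\<And>e. e > 0 \<Longrightarrow> \<exists>N. \<forall>m\<ge>N. \<forall>n\<ge>N. hnorm H (x m - x n) < e"
  have "\<exists>l. limitin (htopology L) (\<lambda>n. coeffs (x n)) l sequentially"
  proof (rule l2h.complete_limit)
    fix e :: real assume "e > 0"
    then obtain N where "\<forall>m\<ge>N. \<forall>n\<ge>N. hnorm H (x m - x n) < e" using cauchy by blast
    then show "\<exists>N. \<forall>n\<ge>N. \<forall>m\<ge>n. hnorm L (coeffs (x m) - coeffs (x n)) < e"
      using x by (auto simp: bergman_hnorm bergman_diff intro!: exI[of _ N])
  qed (use x in simp)
  then obtain l where l: "limitin (htopology L) (\<lambda>n. coeffs (x n)) l sequentially" by blast
  obtain f where f: "f \<in> hcarrier H" "coeffs f = l"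
    using power_series_exists l2.limitin_carrier[OF l] by blast
  have "(\<lambda>n. hnorm H (x n - f)) \<longlonglongrightarrow> 0"
    using l f x by (simp add: bergman_hnorm bergman_diff l2.limitin_iff)
  then show "\<exists>l\<in>hcarrier H. (\<lambda>n. hnorm H (x n - l)) \<longlonglongrightarrow> 0" using f by blast
qed

end

section \<open>Recursive inequalities and weighted summability\<close>

lemma sq_half_add_le:
  fixes x y z :: real
  assumes "0 \<le> x" "x \<le> z / 2 + y"
  shows "x\<^sup>2 \<le> z\<^sup>2 / 2 + 2 * y\<^sup>2"
proof -
  have "x\<^sup>2 \<le> (z / 2 + y)\<^sup>2" using assms by (intro power_mono)
  also have "\<dots> \<le> z\<^sup>2 / 2 + 2 * y\<^sup>2"
    using zero_le_power2[of "z / 2 - y"] by (simp add: power2_sum power2_diff power_divide)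
  finally show ?thesis .
qed

text \<open>Squaring the recursion leaves the factor \<open>1/2\<close> in front of \<open>(x n)\<^sup>2\<close>; the growth \<open>3/2\<close> of the
  weights turns it into \<open>3/4 < 1\<close>, and the sum over \<open>x\<close> can be absorbed.\<close>

lemma summable_forward_recursion:
  fixes x y w :: "nat \<Rightarrow> real"
  assumes x: "\<And>n. 0 \<le> x n" and w: "\<And>n. 0 \<le> w n"
    and rec: "\<And>n. x (Suc n) \<le> x n / 2 + y (Suc n)"
    and ratio: "\<forall>\<^sub>F n in sequentially. w (Suc n) \<le> 3 / 2 * w n"
    and y: "summable (\<lambda>n. w n * (y n)\<^sup>2)"
  shows "summable (\<lambda>n. w n * (x n)\<^sup>2)"
proof -
  obtain N where N: "\<And>n. n \<ge> N \<Longrightarrow> w (Suc n) \<le> 3 / 2 * w n"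
    using ratio by (auto simp: eventually_sequentially)
  define s where "s n = w (n + N) * (x (n + N))\<^sup>2" for n
  define t where "t n = 2 * (w (n + Suc N) * (y (n + Suc N))\<^sup>2)" for n
  have t: "summable t"
    unfolding t_def using summable_ignore_initial_segment[OF y, of "Suc N"] by (rule summable_mult)
  have s0: "0 \<le> s n" and t0: "0 \<le> t n" for n by (simp_all add: s_def t_def w)
  have rs: "s (Suc n) \<le> 3 / 4 * s n + t n" for n
  proof -
    let ?i = "n + N"
    have "s (Suc n) \<le> w (Suc ?i) * ((x ?i)\<^sup>2 / 2 + 2 * (y (Suc ?i))\<^sup>2)"
      unfolding s_def using sq_half_add_le[OF x rec] by (simp add: w mult_left_mono)
    also have "\<dots> = w (Suc ?i) * ((x ?i)\<^sup>2 / 2) + t n" by (simp add: t_def algebra_simps)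
    also have "w (Suc ?i) * ((x ?i)\<^sup>2 / 2) \<le> (3 / 2 * w ?i) * ((x ?i)\<^sup>2 / 2)"
      by (intro mult_right_mono N) auto
    finally show ?thesis by (simp add: s_def)
  qed
  have "(\<Sum>n<M. s n) \<le> 4 * (s 0 + suminf t)" for M
  proof -
    have "(\<Sum>n<M. s n) \<le> (\<Sum>n<Suc M. s n)" using s0 by simp
    also have "\<dots> = s 0 + (\<Sum>n<M. s (Suc n))" by (rule sum.lessThan_Suc_shift)
    also have "\<dots> \<le> s 0 + (\<Sum>n<M. 3 / 4 * s n + t n)" by (intro add_left_mono sum_mono rs)
    also have "\<dots> = s 0 + 3 / 4 * (\<Sum>n<M. s n) + (\<Sum>n<M. t n)"
      by (simp only: sum.distrib sum_distrib_left add.assoc)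
    also have "(\<Sum>n<M. t n) \<le> suminf t" using t t0 by (intro sum_le_suminf) auto
    finally show ?thesis by simp
  qed
  then have "summable s" using s0 by (intro summableI_nonneg_bounded)
  then show ?thesis
    unfolding s_def using summable_iff_shift[of "\<lambda>n. w n * (x n)\<^sup>2" N] by simp
qed

text \<open>The recursion runs backwards, so partial sums of \<open>x\<close> are bounded by longer partial sums. The sum
  can be absorbed only when it is known to be finite, which is why summability with the weaker weight
  \<open>v\<close> is assumed.\<close>

lemma summable_backward_recursion:
  fixes x y v m \<rho> :: "nat \<Rightarrow> real"
  assumes x: "\<And>n. 0 \<le> x n" and v: "\<And>n. 0 \<le> v n"
    and \<rho>: "\<And>n. 0 \<le> \<rho> n" "\<And>n. \<rho> n \<le> 1" "\<And>n. v n * \<rho> n \<le> v (Suc n)"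
    and m: "\<And>n. 0 \<le> m n" "\<And>n. m n \<le> m (Suc n)"
    and rec: "\<And>n. x n \<le> \<rho> n * x (Suc n) / 2 + y n"
    and xs: "summable (\<lambda>n. v n * (x n)\<^sup>2)"
    and ys: "summable (\<lambda>n. v n * m n * (y n)\<^sup>2)"
  shows "summable (\<lambda>n. v n * m n * (x n)\<^sup>2)"
proof -
  let ?T = "\<Sum>n. v n * m n * (y n)\<^sup>2"
  have partial: "(\<Sum>n<N. v n * m n * (x n)\<^sup>2) \<le> 4 * ?T" for N
  proof -
    (* the truncated weight is bounded by a multiple of v, so the sum is finite beforehand *)
    define u where "u n = min (m n) (m N)" for n
    have u: "0 \<le> u n" "u n \<le> m n" "u n \<le> m N" "u n \<le> u (Suc n)" for n
      using m(1)[of n] m(1)[of N] m(2)[of n] by (auto simp: u_def)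
    define s where "s n = v n * u n * (x n)\<^sup>2" for n
    have s0: "0 \<le> s n" for n by (simp add: s_def u v)
    have ss: "summable s"
    proof (rule summable_comparison_test'[of "\<lambda>n. m N * (v n * (x n)\<^sup>2)" 0])
      show "summable (\<lambda>n. m N * (v n * (x n)\<^sup>2))" using xs by (rule summable_mult)
      have "u n * (v n * (x n)\<^sup>2) \<le> m N * (v n * (x n)\<^sup>2)" for n
        by (intro mult_right_mono u) (simp add: v)
      then show "norm (s n) \<le> m N * (v n * (x n)\<^sup>2)" for n
        using s0[of n] by (simp add: s_def mult_ac)
    qed
    have rs: "s n \<le> s (Suc n) / 2 + 2 * (v n * m n * (y n)\<^sup>2)" for n
    proof -
      have "s n \<le> v n * u n * ((\<rho> n * x (Suc n))\<^sup>2 / 2 + 2 * (y n)\<^sup>2)"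
        unfolding s_def using sq_half_add_le[OF x rec] by (simp add: u v mult_left_mono)
      also have "\<dots> = (v n * \<rho> n) * \<rho> n * u n * ((x (Suc n))\<^sup>2 / 2) + 2 * (v n * u n * (y n)\<^sup>2)"
        by (simp add: power2_eq_square algebra_simps)
      also have "\<dots> \<le> v (Suc n) * 1 * u (Suc n) * ((x (Suc n))\<^sup>2 / 2) + 2 * (v n * m n * (y n)\<^sup>2)"
        by (intro add_mono mult_mono \<rho> u v m mult_nonneg_nonneg order_refl) auto
      finally show ?thesis by (simp add: s_def)
    qed
    have s1: "suminf s = s 0 + (\<Sum>n. s (Suc n))" using suminf_split_head[OF ss] by simp
    have "suminf s \<le> (\<Sum>n. s (Suc n) / 2 + 2 * (v n * m n * (y n)\<^sup>2))"
      using ss ys by (intro suminf_le rs summable_add summable_mult summable_divide)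
        (auto simp: summable_Suc_iff)
    also have "\<dots> = (\<Sum>n. s (Suc n)) / 2 + 2 * ?T"
      using ss ys
      by (subst suminf_add[symmetric])
         (auto simp: summable_Suc_iff suminf_divide suminf_mult intro!: summable_mult summable_divide)
    finally have "suminf s \<le> 4 * ?T" using s1 s0[of 0] suminf_nonneg[OF ss s0] by simp
    moreover have "(\<Sum>n<N. s n) \<le> suminf s" using ss s0 by (intro sum_le_suminf) auto
    moreover have "m n \<le> m N" if "n < N" for n
      using lift_Suc_mono_le[of m n N] m(2) that by auto
    then have "(\<Sum>n<N. s n) = (\<Sum>n<N. v n * m n * (x n)\<^sup>2)"
      by (intro sum.cong) (auto simp: s_def u_def min_def)
    ultimately show ?thesis by simp
  qed
  show ?thesis by (rule summableI_nonneg_bounded[OF _ partial]) (simp add: v m)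
qed

section \<open>Weighted shifts\<close>

locale weighted_shift = weighted_l2 E c for E :: "'a::complex_vector hilbert" and c +
  fixes A :: "'a \<Rightarrow> 'a"
  assumes c_mono: "c n \<le> c (Suc n)"
    and A_bounded: "bounded_op E E A"
    and A_half: "x \<in> hcarrier E \<Longrightarrow> hnorm E (A x) \<le> hnorm E x / 2"
    and A_selfadjoint: "x \<in> hcarrier E \<Longrightarrow> y \<in> hcarrier E \<Longrightarrow> hinner E (A x) y = hinner E x (A y)"
begin

definition fshift :: "(nat \<Rightarrow> 'a) \<Rightarrow> nat \<Rightarrow> 'a"
  where "fshift a = case_nat 0 a"

text \<open>The adjoint of \<open>fshift\<close> for the inner product with weights \<open>1 / c n\<close>.\<close>

definition bshift :: "(nat \<Rightarrow> 'a) \<Rightarrow> nat \<Rightarrow> 'a"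
  where "bshift a n = of_real (c n / c (Suc n)) *\<^sub>C a (Suc n)"

definition diag :: "(nat \<Rightarrow> 'a) \<Rightarrow> nat \<Rightarrow> 'a"
  where "diag a n = A (a n)"

text \<open>The weights of the forms \<open>\<parallel>a\<parallel>\<^sup>2 - \<parallel>fshift a\<parallel>\<^sup>2\<close> and \<open>\<parallel>a\<parallel>\<^sup>2 - \<parallel>bshift a\<parallel>\<^sup>2\<close>, both of which are
  diagonal.\<close>

definition fdefect :: "nat \<Rightarrow> real"
  where "fdefect n = 1 / c n - 1 / c (Suc n)"

definition bdefect :: "nat \<Rightarrow> real"
  where "bdefect n = 1 / c n - (case n of 0 \<Rightarrow> 0 | Suc m \<Rightarrow> c m / (c n)\<^sup>2)"

lemma fdefect_nonneg: "0 \<le> fdefect n"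
  using c_mono[of n] c_pos[of n] c_pos[of "Suc n"] by (simp add: fdefect_def frac_le)

lemma bdefect_nonneg: "0 \<le> bdefect n"
proof (cases n)
  case (Suc m)
  have "c m / (c n)\<^sup>2 \<le> c n / (c n)\<^sup>2"
    using c_mono[of m] by (intro divide_right_mono) (auto simp: Suc)
  then show ?thesis using c_pos[of n] by (simp add: bdefect_def Suc power2_eq_square)
qed (simp add: bdefect_def c_pos less_imp_le)

lemma fshift_carrier:
  assumes a: "a \<in> hcarrier L"
  shows "fshift a \<in> hcarrier L" "(\<lambda>n. (hnorm E (a n))\<^sup>2 * fdefect n) sums ((hnorm L a)\<^sup>2 - (hnorm L (fshift a))\<^sup>2)"
proof -
  note aE = l2_carrierD(1)[OF a]
  have sm: "summable (\<lambda>n. (hnorm E (a n))\<^sup>2 / c (Suc n))"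
  proof (rule summable_comparison_test'[OF l2_carrierD(2)[OF a], of 0])
    show "norm ((hnorm E (a n))\<^sup>2 / c (Suc n)) \<le> (hnorm E (a n))\<^sup>2 / c n" for n
      using c_mono[of n] c_pos[of n] c_pos[of "Suc n"] by (simp add: divide_left_mono)
  qed
  have "summable (\<lambda>n. (hnorm E (fshift a n))\<^sup>2 / c n)"
    by (subst summable_Suc_iff[symmetric]) (simp add: fshift_def sm)
  moreover have "fshift a n \<in> hcarrier E" for n using aE by (cases n) (auto simp: fshift_def)
  ultimately show f: "fshift a \<in> hcarrier L" by (simp add: l2_carrier_iff)
  have "(\<lambda>n. (hnorm E (fshift a (Suc n)))\<^sup>2 / c (Suc n)) sums (hnorm L (fshift a))\<^sup>2"
    by (subst sums_Suc_iff) (use l2_hnorm_sq_sums[OF f] in \<open>simp add: fshift_def\<close>)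
  then have "(\<lambda>n. (hnorm E (a n))\<^sup>2 / c n - (hnorm E (a n))\<^sup>2 / c (Suc n)) sums ((hnorm L a)\<^sup>2 - (hnorm L (fshift a))\<^sup>2)"
    using sums_diff[OF l2_hnorm_sq_sums[OF a]] by (simp add: fshift_def)
  then show "(\<lambda>n. (hnorm E (a n))\<^sup>2 * fdefect n) sums ((hnorm L a)\<^sup>2 - (hnorm L (fshift a))\<^sup>2)"
    by (simp add: fdefect_def right_diff_distrib)
qed

lemma bshift_carrier:
  assumes a: "a \<in> hcarrier L"
  shows "bshift a \<in> hcarrier L" "(\<lambda>n. (hnorm E (a n))\<^sup>2 * bdefect n) sums ((hnorm L a)\<^sup>2 - (hnorm L (bshift a))\<^sup>2)"
proof -
  note aE = l2_carrierD(1)[OF a]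
  let ?b = "\<lambda>n. (hnorm E (bshift a n))\<^sup>2 / c n"
  have b: "?b n = (hnorm E (a (Suc n)))\<^sup>2 * (c n / (c (Suc n))\<^sup>2)" for n
    using c_pos[of n] c_pos[of "Suc n"] aE
    by (simp add: bshift_def hnorm_scaleC power_mult_distrib power2_eq_square del: of_real_divide)
  have sm: "summable ?b"
  proof (rule summable_comparison_test'[of "\<lambda>n. (hnorm E (a (Suc n)))\<^sup>2 / c (Suc n)" 0])
    show "summable (\<lambda>n. (hnorm E (a (Suc n)))\<^sup>2 / c (Suc n))"
      using l2_carrierD(2)[OF a] summable_Suc_iff[of "\<lambda>n. (hnorm E (a n))\<^sup>2 / c n"] by simp
    fix n
    have "c n / (c (Suc n))\<^sup>2 \<le> c (Suc n) / (c (Suc n))\<^sup>2" using c_mono[of n] by (intro divide_right_mono) auto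
    then have "c n / (c (Suc n))\<^sup>2 \<le> 1 / c (Suc n)"
      using less_imp_neq[OF c_pos[of "Suc n"]] by (simp add: power2_eq_square)
    then show "norm (?b n) \<le> (hnorm E (a (Suc n)))\<^sup>2 / c (Suc n)"
      unfolding b using mult_left_mono[of "c n / (c (Suc n))\<^sup>2" "1 / c (Suc n)" "(hnorm E (a (Suc n)))\<^sup>2"] c_pos[of n]
      by simp
  qed
  then show f: "bshift a \<in> hcarrier L" using aE by (simp add: l2_carrier_iff bshift_def)
  let ?d = "\<lambda>n. (hnorm E (a n))\<^sup>2 * (case n of 0 \<Rightarrow> 0 | Suc m \<Rightarrow> c m / (c n)\<^sup>2)"
  have "?d sums (hnorm L (bshift a))\<^sup>2"
    using l2_hnorm_sq_sums[OF f] sums_Suc_iff[of ?d "(hnorm L (bshift a))\<^sup>2"] by (simp add: b)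
  from sums_diff[OF l2_hnorm_sq_sums[OF a] this]
  show "(\<lambda>n. (hnorm E (a n))\<^sup>2 * bdefect n) sums ((hnorm L a)\<^sup>2 - (hnorm L (bshift a))\<^sup>2)"
    by (simp add: bdefect_def right_diff_distrib)
qed

lemma A_sq_le: "x \<in> hcarrier E \<Longrightarrow> (hnorm E (A x))\<^sup>2 \<le> (hnorm E x)\<^sup>2 / 4"
  using power_mono[OF A_half hnorm_nonneg[OF bounded_opD(1)[OF A_bounded]], of x 2]
  by (simp add: power_divide)

lemma diag_carrier:
  assumes a: "a \<in> hcarrier L"
  shows "diag a \<in> hcarrier L" "hnorm L (diag a) \<le> hnorm L a / 2"
proof -
  note aE = l2_carrierD(1)[OF a]
  have le: "(hnorm E (diag a n))\<^sup>2 / c n \<le> ((hnorm E (a n))\<^sup>2 / c n) / 4" for n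
    using divide_right_mono[OF A_sq_le[OF aE[of n]], of "c n"] c_pos[of n] by (simp add: diag_def)
  show d: "diag a \<in> hcarrier L"
    by (rule l2_carrier_comparison[OF _ summable_divide[OF l2_carrierD(2)[OF a]] le])
       (simp add: diag_def aE bounded_opD(1)[OF A_bounded])
  have "(hnorm L (diag a))\<^sup>2 \<le> (hnorm L a)\<^sup>2 / 4"
    by (rule sums_le[OF le l2_hnorm_sq_sums[OF d] sums_divide[OF l2_hnorm_sq_sums[OF a]]])
  then have "(hnorm L (diag a))\<^sup>2 \<le> (hnorm L a / 2)\<^sup>2" by (simp add: power_divide)
  then show "hnorm L (diag a) \<le> hnorm L a / 2"
    by (rule power2_le_imp_le) (simp add: l2.hnorm_nonneg a)
qed

lemma diag_defect:
  assumes a: "a \<in> hcarrier L" and e: "\<And>n. 0 \<le> e n"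
    and q: "\<And>a. a \<in> hcarrier L \<Longrightarrow> (\<lambda>n. (hnorm E (a n))\<^sup>2 * e n) sums q a"
  shows "q (diag a) \<le> q a / 4"
proof (rule sums_le[OF _ q[OF diag_carrier(1)[OF a]] sums_divide[OF q[OF a]]])
  show "(hnorm E (diag a n))\<^sup>2 * e n \<le> (hnorm E (a n))\<^sup>2 * e n / 4" for n
    using mult_right_mono[OF A_sq_le[OF l2_carrierD(1)[OF a]] e] by (simp add: diag_def)
qed

lemma fshift_bshift_adjoint:
  assumes a: "a \<in> hcarrier L" and b: "b \<in> hcarrier L"
  shows "hinner L (fshift a) b = hinner L a (bshift b)"
proof -
  have "(\<lambda>n. hinner E (a n) (b (Suc n)) / of_real (c (Suc n))) sums hinner L (fshift a) b"
    using l2_inner_sums[OF fshift_carrier(1)[OF a] b] l2_carrierD(1)[OF b]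
      sums_Suc_iff[of "\<lambda>n. hinner E (fshift a n) (b n) / of_real (c n)" "hinner L (fshift a) b"]
    by (simp add: fshift_def)
  moreover have "hinner E (a n) (bshift b n) / of_real (c n) = hinner E (a n) (b (Suc n)) / of_real (c (Suc n))" for n
    using l2_carrierD(1)[OF a] l2_carrierD(1)[OF b] c_pos[of n]
    by (simp add: bshift_def inner_scaleC_right)
  ultimately have "(\<lambda>n. hinner E (a n) (bshift b n) / of_real (c n)) sums hinner L (fshift a) b" by simp
  then show ?thesis using l2_inner_sums[OF a bshift_carrier(1)[OF b]] sums_unique2 by blast
qed

lemma norm_le_of_defect:
  assumes "a \<in> hcarrier L" "(\<lambda>n. (hnorm E (a n))\<^sup>2 * e n) sums ((hnorm L a)\<^sup>2 - r\<^sup>2)" "\<And>n. 0 \<le> e n"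
  shows "r \<le> hnorm L a"
proof -
  have "0 \<le> (hnorm L a)\<^sup>2 - r\<^sup>2"
    by (rule sums_le[OF _ sums_zero assms(2)]) (simp add: assms(3))
  then show ?thesis by (intro power2_le_imp_le[OF _ l2.hnorm_nonneg[OF assms(1)]]) simp
qed

theorem weighted_shift_moebius: "moebius_pair L fshift bshift diag"
proof (intro moebius_pair.intro moebius_pair_axioms.intro l2_hilbert)
  note fc = norm_le_of_defect[OF _ fshift_carrier(2) fdefect_nonneg]
  note bc = norm_le_of_defect[OF _ bshift_carrier(2) bdefect_nonneg]
  note aE = l2_carrierD(1)
  show "bounded_op L L fshift"
    unfolding bounded_op_def
  proof (intro conjI ballI allI exI)
    show "hnorm L (fshift x) \<le> 1 * hnorm L x" if "x \<in> hcarrier L" for x using fc[OF that that] by simp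
  next
    show "fshift x \<in> hcarrier L" if "x \<in> hcarrier L" for x by (rule fshift_carrier(1)[OF that])
  qed (auto simp: fshift_def fun_eq_iff plus_fun_apply scaleC_fun_def split: nat.split)
  show "bounded_op L L bshift"
    unfolding bounded_op_def
  proof (intro conjI ballI allI exI)
    show "hnorm L (bshift x) \<le> 1 * hnorm L x" if "x \<in> hcarrier L" for x using bc[OF that that] by simp
  qed (auto simp: bshift_carrier(1) bshift_def fun_eq_iff plus_fun_apply scaleC_fun_def scaleC_add_right
      scaleC_scaleC mult.commute)
  show "bounded_op L L diag"
    unfolding bounded_op_def
  proof (intro conjI ballI allI exI)
    show "hnorm L (diag x) \<le> 1 * hnorm L x" if "x \<in> hcarrier L" for x
      using diag_carrier(2)[OF that] l2.hnorm_nonneg[OF that] by simp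
  qed (auto simp: diag_carrier(1) diag_def fun_eq_iff plus_fun_apply scaleC_fun_def bounded_opD[OF A_bounded] aE)
  fix x assume x: "x \<in> hcarrier L"
  show "hnorm L (fshift x) \<le> hnorm L x" "hnorm L (bshift x) \<le> hnorm L x"
    using fc[OF x x] bc[OF x x] by auto
  show "hnorm L (diag x) \<le> hnorm L x / 2" by (rule diag_carrier(2)[OF x])
  show "diag (fshift x) = fshift (diag x)"
    by (auto simp: diag_def fshift_def fun_eq_iff op_zero[OF A_bounded] split: nat.split)
  show "(hnorm L (diag x))\<^sup>2 - (hnorm L (fshift (diag x)))\<^sup>2 \<le> ((hnorm L x)\<^sup>2 - (hnorm L (fshift x))\<^sup>2) / 4"
    by (rule diag_defect[OF x fdefect_nonneg fshift_carrier(2)])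
  show "(hnorm L (diag x))\<^sup>2 - (hnorm L (bshift (diag x)))\<^sup>2 \<le> ((hnorm L x)\<^sup>2 - (hnorm L (bshift x))\<^sup>2) / 4"
    by (rule diag_defect[OF x bdefect_nonneg bshift_carrier(2)])
  fix y assume y: "y \<in> hcarrier L"
  show "hinner L (fshift x) y = hinner L x (bshift y)" by (rule fshift_bshift_adjoint[OF x y])
  have "(\<lambda>n. hinner E (diag x n) (y n) / of_real (c n)) = (\<lambda>n. hinner E (x n) (diag y n) / of_real (c n))"
    by (simp add: diag_def A_selfadjoint aE[OF x] aE[OF y])
  then show "hinner L (diag x) y = hinner L x (diag y)"
    using l2_inner_sums[OF diag_carrier(1)[OF x] y] l2_inner_sums[OF x diag_carrier(1)[OF y]]
    by (metis sums_unique2)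
qed

end

context weighted_l2
begin

text \<open>Cauchy-Schwarz with weights in one direction. In the other, the test vector
  \<open>k\<^sub>n = f\<^sub>n / (c\<^sub>n e\<^sub>n)\<close> for \<open>n < N\<close> attains equality: the pairing and the form are then both equal to the
  partial sum of the series.\<close>

lemma dominated_iff_summable:
  assumes f: "f \<in> hcarrier L" and e: "\<And>n. 0 < e n"
    and q: "\<And>k. k \<in> hcarrier L \<Longrightarrow> (\<lambda>n. (hnorm E (k n))\<^sup>2 * e n) sums q k"
  shows "dominated L f q \<longleftrightarrow> summable (\<lambda>n. (hnorm E (f n))\<^sup>2 / ((c n)\<^sup>2 * e n))"
  unfolding dominated_def
proof
  note fE = l2_carrierD(1)[OF f]
  assume "\<exists>C\<ge>0. \<forall>k\<in>hcarrier L. (cmod (hinner L f k))\<^sup>2 \<le> C * q k"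
  then obtain C where C: "C \<ge> 0" "\<And>k. k \<in> hcarrier L \<Longrightarrow> (cmod (hinner L f k))\<^sup>2 \<le> C * q k" by blast
  let ?t = "\<lambda>n. (hnorm E (f n))\<^sup>2 / ((c n)\<^sup>2 * e n)"
  have "(\<Sum>n<N. ?t n) \<le> C" for N
  proof -
    define k where "k n = (if n < N then of_real (1 / (c n * e n)) *\<^sub>C f n else 0)" for n
    have kE: "k n \<in> hcarrier E" for n using fE by (simp add: k_def)
    have "summable (\<lambda>n. (hnorm E (k n))\<^sup>2 / c n)"
      by (rule summable_finite[of "{..<N}"]) (auto simp: k_def)
    then have kL: "k \<in> hcarrier L" using kE by (simp add: l2_carrier_iff)
    have "(\<lambda>n. hinner E (f n) (k n) / of_real (c n)) sums (\<Sum>n<N. hinner E (f n) (k n) / of_real (c n))"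
      by (rule sums_finite) (auto simp: k_def fE)
    then have "hinner L f k = (\<Sum>n<N. hinner E (f n) (k n) / of_real (c n))"
      using l2_inner_sums[OF f kL] sums_unique2 by blast
    also have "\<dots> = (\<Sum>n<N. of_real (?t n))"
      using fE by (intro sum.cong) (auto simp: k_def inner_scaleC_right inner_self power2_eq_square)
    finally have inner: "hinner L f k = of_real (\<Sum>n<N. ?t n)" by simp
    have "(\<lambda>n. (hnorm E (k n))\<^sup>2 * e n) sums (\<Sum>n<N. (hnorm E (k n))\<^sup>2 * e n)"
      by (rule sums_finite) (auto simp: k_def)
    then have "q k = (\<Sum>n<N. (hnorm E (k n))\<^sup>2 * e n)"
      using q[OF kL] sums_unique2 by blast
    also have "\<dots> = (\<Sum>n<N. ?t n)"
      using fE e by (intro sum.cong)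
        (auto simp: k_def hnorm_scaleC power_mult_distrib power_divide power2_eq_square norm_divide norm_mult
          abs_mult field_simps)
    finally have "(\<Sum>n<N. ?t n)\<^sup>2 \<le> C * (\<Sum>n<N. ?t n)"
      using C(2)[OF kL] inner by (simp only: norm_of_real power2_abs)
    moreover have "0 \<le> (\<Sum>n<N. ?t n)" using e by (intro sum_nonneg) (simp add: less_imp_le)
    ultimately show ?thesis
      using C(1) by (cases "(\<Sum>n<N. ?t n) = 0") (auto simp: power2_eq_square)
  qed
  then show "summable ?t" using e by (intro summableI_nonneg_bounded) (auto simp: less_imp_le)
next
  note fE = l2_carrierD(1)[OF f]
  let ?t = "\<lambda>n. (hnorm E (f n))\<^sup>2 / ((c n)\<^sup>2 * e n)"
  assume t: "summable ?t"
  have t0: "0 \<le> ?t n" for n using e[of n] by (simp add: less_imp_le)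
  have "(cmod (hinner L f k))\<^sup>2 \<le> suminf ?t * q k" if k: "k \<in> hcarrier L" for k
  proof (rule LIMSEQ_le_const2)
    note kE = l2_carrierD(1)[OF k]
    show "(\<lambda>N. (cmod (\<Sum>n<N. hinner E (f n) (k n) / of_real (c n)))\<^sup>2) \<longlonglongrightarrow> (cmod (hinner L f k))\<^sup>2"
      using l2_inner_sums[OF f k] unfolding sums_def by (intro tendsto_power tendsto_norm)
    have "(cmod (\<Sum>n<N. hinner E (f n) (k n) / of_real (c n)))\<^sup>2 \<le> suminf ?t * q k" for N
    proof -
      let ?x = "\<lambda>n. hnorm E (f n) / (c n * sqrt (e n))" and ?y = "\<lambda>n. hnorm E (k n) * sqrt (e n)"
      have "cmod (\<Sum>n<N. hinner E (f n) (k n) / of_real (c n)) \<le> (\<Sum>n<N. ?x n * ?y n)"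
      proof (rule sum_norm_le)
        fix n
        have "cmod (hinner E (f n) (k n) / of_real (c n)) \<le> hnorm E (f n) * hnorm E (k n) / c n"
          using Cauchy_Schwarz[OF fE kE] c_pos[of n] by (simp add: norm_divide divide_right_mono)
        also have "\<dots> = ?x n * ?y n" using e[of n] by simp
        finally show "cmod (hinner E (f n) (k n) / of_real (c n)) \<le> ?x n * ?y n" .
      qed
      then have "(cmod (\<Sum>n<N. hinner E (f n) (k n) / of_real (c n)))\<^sup>2 \<le> (\<Sum>n<N. ?x n * ?y n)\<^sup>2"
        by (intro power_mono) auto
      also have "\<dots> \<le> (\<Sum>n<N. (?x n)\<^sup>2) * (\<Sum>n<N. (?y n)\<^sup>2)" by (rule Cauchy_Schwarz_ineq_sum)
      also have "\<dots> = (\<Sum>n<N. ?t n) * (\<Sum>n<N. (hnorm E (k n))\<^sup>2 * e n)"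
        using e by (simp add: power_divide power_mult_distrib less_imp_le)
      also have "\<dots> \<le> suminf ?t * q k"
      proof (rule mult_mono)
        show "(\<Sum>n<N. ?t n) \<le> suminf ?t" using t t0 by (intro sum_le_suminf) auto
        show "(\<Sum>n<N. (hnorm E (k n))\<^sup>2 * e n) \<le> q k"
          unfolding sums_unique[OF q[OF k]] using sums_summable[OF q[OF k]] e
          by (intro sum_le_suminf) (auto simp: less_imp_le)
        show "0 \<le> suminf ?t" using t t0 by (rule suminf_nonneg)
        show "0 \<le> (\<Sum>n<N. (hnorm E (k n))\<^sup>2 * e n)" using e by (intro sum_nonneg) (simp add: less_imp_le)
      qed
      finally show ?thesis .
    qed
    then show "\<exists>M. \<forall>N\<ge>M. (cmod (\<Sum>n<N. hinner E (f n) (k n) / of_real (c n)))\<^sup>2 \<le> suminf ?t * q k" by blast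
  qed
  then show "\<exists>C\<ge>0. \<forall>k\<in>hcarrier L. (cmod (hinner L f k))\<^sup>2 \<le> C * q k"
    using suminf_nonneg[OF t t0] by blast
qed

end

section \<open>Moebius transforms on Bergman spaces\<close>

context bergman
begin

lemma represented_bounded:
  assumes M: "bounded_op L L M"
    and T: "\<And>f. f \<in> hcarrier H \<Longrightarrow> T f \<in> hcarrier H" "\<And>f. f \<in> hcarrier H \<Longrightarrow> coeffs (T f) = M (coeffs f)"
  shows "bounded_op H H T"
proof -
  obtain K where K: "\<And>a. a \<in> hcarrier L \<Longrightarrow> hnorm L (M a) \<le> K * hnorm L a"
    using M unfolding bounded_op_def by blast
  show ?thesis
    unfolding bounded_op_def
  proof (intro conjI ballI allI exI)
    fix f assume f: "f \<in> hcarrier H"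
    show "T f \<in> hcarrier H" by (rule T(1)[OF f])
    show "hnorm H (T f) \<le> K * hnorm H f" using f by (simp add: bergman_hnorm T K)
    show "T (f + g) = T f + T g" if g: "g \<in> hcarrier H" for g
      using f g by (intro coeffs_inj) (simp_all add: T bergman_add bounded_opD[OF M])
    show "T (s *\<^sub>C f) = s *\<^sub>C T f" for s
      using f by (intro coeffs_inj) (simp_all add: T bergman_scaleC bounded_opD[OF M])
  qed
qed

lemma moebius_pair_transport:
  assumes "moebius_pair L Zc Zc' Ac"
    and Z: "\<And>f. f \<in> hcarrier H \<Longrightarrow> Z f \<in> hcarrier H" "\<And>f. f \<in> hcarrier H \<Longrightarrow> coeffs (Z f) = Zc (coeffs f)"
    and Z': "\<And>f. f \<in> hcarrier H \<Longrightarrow> Z' f \<in> hcarrier H" "\<And>f. f \<in> hcarrier H \<Longrightarrow> coeffs (Z' f) = Zc' (coeffs f)"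
    and A: "\<And>f. f \<in> hcarrier H \<Longrightarrow> A f \<in> hcarrier H" "\<And>f. f \<in> hcarrier H \<Longrightarrow> coeffs (A f) = Ac (coeffs f)"
  shows "moebius_pair H Z Z' A"
proof -
  interpret M: moebius_pair L Zc Zc' Ac by fact
  show ?thesis
  proof (intro moebius_pair.intro moebius_pair_axioms.intro bergman_hilbert)
    show "bounded_op H H Z" by (rule represented_bounded[OF M.Z_bounded Z])
    show "bounded_op H H Z'" by (rule represented_bounded[OF M.Z'_bounded Z'])
    show "bounded_op H H A" by (rule represented_bounded[OF M.A_bounded A])
    fix f assume f: "f \<in> hcarrier H"
    then have c: "coeffs f \<in> hcarrier L" by simp
    show "hnorm H (Z f) \<le> hnorm H f" "hnorm H (Z' f) \<le> hnorm H f" "hnorm H (A f) \<le> hnorm H f / 2"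
      using M.Z_contraction[OF c] M.Z'_contraction[OF c] M.A_half[OF c] f
      by (simp_all only: bergman_hnorm Z Z' A)
    show "A (Z f) = Z (A f)"
      using f M.A_Z[OF c] by (intro coeffs_inj) (simp_all add: Z A)
    show "(hnorm H (A f))\<^sup>2 - (hnorm H (Z (A f)))\<^sup>2 \<le> ((hnorm H f)\<^sup>2 - (hnorm H (Z f))\<^sup>2) / 4"
      using M.Z_defect[OF c] f by (simp only: bergman_hnorm Z A)
    show "(hnorm H (A f))\<^sup>2 - (hnorm H (Z' (A f)))\<^sup>2 \<le> ((hnorm H f)\<^sup>2 - (hnorm H (Z' f))\<^sup>2) / 4"
      using M.Z'_defect[OF c] f by (simp only: bergman_hnorm Z' A)
    fix g assume g: "g \<in> hcarrier H"
    then have d: "coeffs g \<in> hcarrier L" by simp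
    show "hinner H (Z f) g = hinner H f (Z' g)" "hinner H (A f) g = hinner H f (A g)"
      using M.Z_adjoint[OF c d] M.A_selfadjoint[OF c d] f g by (simp_all only: bergman_inner Z Z' A)
  qed
qed

end

lemma bergman_coeff_mono:
  assumes "\<alpha> > -1"
  shows "bergman_coeff \<alpha> n \<le> bergman_coeff \<alpha> (Suc n)"
proof -
  have "bergman_coeff \<alpha> n * 1 \<le> bergman_coeff \<alpha> n * ((real n + \<alpha> + 2) / (real n + 1))"
    using bergman_coeff_pos[of \<alpha> n] assms by (intro mult_left_mono) (auto simp: pos_le_divide_eq)
  then show ?thesis using assms by (simp add: bergman_coeff_Suc)
qed

locale bergman_shift = bergman E \<alpha> for E :: "'a::complex_vector hilbert" and \<alpha> +
  fixes A :: "'a \<Rightarrow> 'a"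
  assumes \<alpha>: "\<alpha> > -1"
    and bounded: "bounded_op E E A"
    and half: "x \<in> hcarrier E \<Longrightarrow> hnorm E (A x) \<le> hnorm E x / 2"
    and selfadjoint: "x \<in> hcarrier E \<Longrightarrow> y \<in> hcarrier E \<Longrightarrow> hinner E (A x) y = hinner E x (A y)"
begin

sublocale weighted_shift E "bergman_coeff \<alpha>" A
  by unfold_locales (fact bergman_coeff_mono[OF \<alpha>] bounded half selfadjoint)+

abbreviation c where "c \<equiv> bergman_coeff \<alpha>"

text \<open>The weights of the norm of \<open>A\<^sup>2\<^sub>\<alpha>\<^sub>-\<^sub>1\<close>.\<close>

abbreviation w where "w n \<equiv> 1 / bergman_coeff (\<alpha> - 1) n"

abbreviation w_summable where "w_summable a \<equiv> summable (\<lambda>n. w n * (hnorm E (a n))\<^sup>2)"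

lemma c_Suc: "c (Suc n) = c n * ((real n + \<alpha> + 2) / (real n + 1))"
  using bergman_coeff_Suc[of \<alpha> n] \<alpha> by simp

lemma w_eq: "w n = 1 / c n * ((real n + \<alpha> + 1) / (\<alpha> + 1))"
  by (simp add: bergman_coeff_shift[OF \<alpha>])

lemma w_pos: "0 < w n"
  using bergman_coeff_pos[of "\<alpha> - 1" n] \<alpha> by simp

lemma norm_w_mult_sq: "norm (w n * x\<^sup>2) = w n * x\<^sup>2"
  unfolding real_norm_def by (intro abs_of_nonneg mult_nonneg_nonneg less_imp_le[OF w_pos]) simp

text \<open>The ratio tends to \<open>1\<close>, but for \<open>\<alpha> < 0\<close> it exceeds \<open>1\<close>, and its value \<open>1/(\<alpha> + 1)\<close> at \<open>n = 0\<close>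
  is not bounded uniformly in \<open>\<alpha>\<close>. So only an eventual bound can be asked for in the forward
  recursion.\<close>

lemma w_ratio: "\<forall>\<^sub>F n in sequentially. w (Suc n) \<le> 3 / 2 * w n"
proof -
  obtain N :: nat where N: "- 3 * \<alpha> - 1 \<le> real N" using real_arch_simple by blast
  have "w (Suc n) \<le> 3 / 2 * w n" if n: "n \<ge> N" for n
  proof -
    have p: "real n + \<alpha> + 1 > 0" "real n + \<alpha> + 2 > 0" "\<alpha> + 1 > 0" using \<alpha> by auto
    have "w (Suc n) = 1 / c n * ((real n + 1) / (\<alpha> + 1))"
      unfolding w_eq c_Suc using p by (simp add: add_ac)
    also have "\<dots> \<le> 1 / c n * ((3 / 2 * (real n + \<alpha> + 1)) / (\<alpha> + 1))"
      using N n c_pos[of n] p by (intro mult_left_mono divide_right_mono) auto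
    also have "\<dots> = 3 / 2 * w n" unfolding w_eq by simp
    finally show ?thesis .
  qed
  then show ?thesis by (auto simp: eventually_sequentially)
qed

text \<open>The coefficients of \<open>d = (1 - AZ)a\<close> are \<open>d\<^sub>n\<^sub>+\<^sub>1 = a\<^sub>n\<^sub>+\<^sub>1 - A a\<^sub>n\<close>: the forward recursion leads from
  \<open>d\<close> to \<open>a\<close>, the triangle inequality back.\<close>

lemma forward_iff:
  assumes a: "a \<in> hcarrier L"
  shows "w_summable (a - diag (fshift a)) \<longleftrightarrow> w_summable a"
proof -
  let ?d = "a - diag (fshift a)"
  note aE = l2_carrierD(1)[OF a] and AE = bounded_opD(1)[OF bounded]
  have d: "?d (Suc n) = a (Suc n) - A (a n)" for n
    by (simp add: diag_def fshift_def)
  have dE: "?d n \<in> hcarrier E" for n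
    by (cases n) (simp_all add: diag_def fshift_def aE AE op_zero[OF bounded])
  have le: "hnorm E (a (Suc n)) \<le> hnorm E (a n) / 2 + hnorm E (?d (Suc n))" for n
    using hnorm_triangle[of "a (Suc n) - A (a n)" "A (a n)"] half[OF aE[of n]]
    unfolding d by (simp add: aE AE)
  have ge: "hnorm E (?d (Suc n)) \<le> hnorm E (a n) / 2 + hnorm E (a (Suc n))" for n
    using hnorm_diff_triangle[of "a (Suc n)" "A (a n)"] half[OF aE[of n]] unfolding d by (simp add: aE AE)
  show ?thesis
  proof
    assume "w_summable ?d"
    then show "w_summable a"
      by (rule summable_forward_recursion[where x = "\<lambda>n. hnorm E (a n)" and y = "\<lambda>n. hnorm E (?d n)" and w = w,
            OF hnorm_nonneg[OF aE] less_imp_le[OF w_pos] le w_ratio])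
  next
    assume s: "w_summable a"
    then have s': "summable (\<lambda>n. w (Suc n) * (hnorm E (a (Suc n)))\<^sup>2)"
      using summable_Suc_iff[of "\<lambda>n. w n * (hnorm E (a n))\<^sup>2"] by simp
    have "\<forall>\<^sub>F n in sequentially. norm (w (Suc n) * (hnorm E (?d (Suc n)))\<^sup>2)
        \<le> 3 / 4 * (w n * (hnorm E (a n))\<^sup>2) + 2 * (w (Suc n) * (hnorm E (a (Suc n)))\<^sup>2)"
      using w_ratio
    proof eventually_elim
      case (elim n)
      have "w (Suc n) * (hnorm E (?d (Suc n)))\<^sup>2 \<le> w (Suc n) * ((hnorm E (a n))\<^sup>2 / 2 + 2 * (hnorm E (a (Suc n)))\<^sup>2)"
        by (intro mult_left_mono sq_half_add_le[OF hnorm_nonneg[OF dE] ge] less_imp_le[OF w_pos])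
      also have "\<dots> = w (Suc n) * ((hnorm E (a n))\<^sup>2 / 2) + 2 * (w (Suc n) * (hnorm E (a (Suc n)))\<^sup>2)"
        by (simp add: distrib_left)
      also have "w (Suc n) * ((hnorm E (a n))\<^sup>2 / 2) \<le> (3 / 2 * w n) * ((hnorm E (a n))\<^sup>2 / 2)"
        by (intro mult_right_mono elim) simp
      finally show ?case unfolding norm_w_mult_sq by simp
    qed
    then have "summable (\<lambda>n. w (Suc n) * (hnorm E (?d (Suc n)))\<^sup>2)"
      by (rule summable_comparison_test_ev) (intro summable_add summable_mult s s')
    then show "w_summable ?d"
      using summable_Suc_iff[of "\<lambda>n. w n * (hnorm E (?d n))\<^sup>2"] by simp
  qed
qed

text \<open>The coefficients of \<open>d = (1 - AZ\<^sup>*)a\<close> are \<open>d\<^sub>n = a\<^sub>n - (c\<^sub>n/c\<^sub>n\<^sub>+\<^sub>1) A a\<^sub>n\<^sub>+\<^sub>1\<close>. Going from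
  \<open>d\<close> to \<open>a\<close> is possible because \<open>a\<close> is known to lie in \<open>L\<close>, where the weights are \<open>1 / c n\<close>.\<close>

lemma backward_iff:
  assumes a: "a \<in> hcarrier L"
  shows "w_summable (a - diag (bshift a)) \<longleftrightarrow> w_summable a"
proof -
  let ?d = "a - diag (bshift a)" and ?\<rho> = "\<lambda>n. c n / c (Suc n)"
  let ?v = "\<lambda>n. 1 / c n" and ?m = "\<lambda>n. (real n + \<alpha> + 1) / (\<alpha> + 1)"
  note aE = l2_carrierD(1)[OF a] and AE = bounded_opD(1)[OF bounded]
  note cp = c_pos less_imp_le[OF c_pos] less_imp_neq[OF c_pos, symmetric]
  have bE: "bshift a n \<in> hcarrier E" for n by (simp add: bshift_def aE)
  have b: "hnorm E (bshift a n) = ?\<rho> n * hnorm E (a (Suc n))" for n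
    unfolding bshift_def hnorm_scaleC[OF aE] norm_of_real by (simp add: cp)
  have d: "?d n = a n - A (bshift a n)" for n by (simp add: diag_def)
  have dE: "?d n \<in> hcarrier E" for n unfolding d by (simp add: aE AE bE)
  have le: "hnorm E (a n) \<le> ?\<rho> n * hnorm E (a (Suc n)) / 2 + hnorm E (?d n)" for n
    using hnorm_triangle[of "a n - A (bshift a n)" "A (bshift a n)"] half[OF bE[of n]]
    unfolding d b[symmetric] by (simp add: aE AE bE)
  have ge: "hnorm E (?d n) \<le> ?\<rho> n * hnorm E (a (Suc n)) / 2 + hnorm E (a n)" for n
    using hnorm_diff_triangle[of "a n" "A (bshift a n)"] half[OF bE[of n]]
    unfolding d b[symmetric] by (simp add: aE AE bE)
  have \<rho>: "0 \<le> ?\<rho> n" "?\<rho> n \<le> 1" "?v n * ?\<rho> n = ?v (Suc n)" for n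
    using c_mono[of n] by (simp_all add: cp)
  have m: "0 \<le> ?m n" "?m n \<le> ?m (Suc n)" for n
    using \<alpha> by (auto intro!: divide_right_mono)
  show ?thesis
  proof
    assume y: "w_summable ?d"
    have xs: "summable (\<lambda>n. ?v n * (hnorm E (a n))\<^sup>2)" using l2_carrierD(2)[OF a] by simp
    have "summable (\<lambda>n. ?v n * ?m n * (hnorm E (a n))\<^sup>2)"
      by (rule summable_backward_recursion[of _ ?v ?\<rho> ?m])
         (use hnorm_nonneg[OF aE] cp \<rho> m le xs y in \<open>simp_all only: w_eq zero_le_divide_1_iff order_refl\<close>)
    then show "w_summable a" by (simp only: w_eq)
  next
    assume s: "w_summable a"
    then have s': "summable (\<lambda>n. w (Suc n) * (hnorm E (a (Suc n)))\<^sup>2)"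
      using summable_Suc_iff[of "\<lambda>n. w n * (hnorm E (a n))\<^sup>2"] by simp
    have "norm (w n * (hnorm E (?d n))\<^sup>2)
        \<le> 1 / 2 * (w (Suc n) * (hnorm E (a (Suc n)))\<^sup>2) + 2 * (w n * (hnorm E (a n))\<^sup>2)" for n
    proof -
      have "w n * (?\<rho> n)\<^sup>2 = ?v (Suc n) * (?\<rho> n * ?m n)"
        unfolding w_eq \<rho>(3)[symmetric] by (simp add: power2_eq_square mult_ac)
      also have "\<dots> \<le> ?v (Suc n) * (1 * ?m (Suc n))"
        by (intro mult_left_mono mult_mono \<rho> m) (simp_all add: cp)
      also have "\<dots> = w (Suc n)" unfolding w_eq by simp
      finally have wr: "w n * (?\<rho> n)\<^sup>2 \<le> w (Suc n)" .
      have "w n * (hnorm E (?d n))\<^sup>2 \<le> w n * ((?\<rho> n * hnorm E (a (Suc n)))\<^sup>2 / 2 + 2 * (hnorm E (a n))\<^sup>2)"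
        by (intro mult_left_mono sq_half_add_le[OF hnorm_nonneg[OF dE] ge] less_imp_le[OF w_pos])
      also have "\<dots> = (w n * (?\<rho> n)\<^sup>2) * ((hnorm E (a (Suc n)))\<^sup>2 / 2) + 2 * (w n * (hnorm E (a n))\<^sup>2)"
        by (simp add: distrib_left power_mult_distrib power_divide)
      also have "\<dots> \<le> w (Suc n) * ((hnorm E (a (Suc n)))\<^sup>2 / 2) + 2 * (w n * (hnorm E (a n))\<^sup>2)"
        by (intro add_right_mono mult_right_mono wr) auto
      finally show ?thesis unfolding norm_w_mult_sq by simp
    qed
    then show "w_summable ?d"
      by (rule summable_comparison_test'[of _ 0, rotated]) (intro summable_add summable_mult s s')
  qed
qed

lemma fdefect_eq: "fdefect n = 1 / c n * ((\<alpha> + 1) / (real n + \<alpha> + 2))"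
proof -
  have "real n + \<alpha> + 2 > 0" using \<alpha> by simp
  then show ?thesis
    using c_pos[of n] by (simp add: fdefect_def c_Suc divide_simps)
qed

lemma bdefect_eq: "bdefect n = 1 / c n * ((\<alpha> + 1) / (real n + \<alpha> + 1))"
proof (cases n)
  case 0
  then show ?thesis using \<alpha> by (simp add: bdefect_def)
next
  case (Suc m)
  have "real m + \<alpha> + 2 > 0" using \<alpha> by simp
  then show ?thesis
    using c_pos[of m] unfolding bdefect_def Suc nat.case c_Suc[of m]
    by (simp add: power2_eq_square divide_simps) (simp add: algebra_simps)
qed

lemma bdefect_dominated_iff:
  assumes a: "a \<in> hcarrier L"
  shows "dominated L a (\<lambda>k. (hnorm L k)\<^sup>2 - (hnorm L (bshift k))\<^sup>2) \<longleftrightarrow> w_summable a"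
proof -
  have p: "0 < real n + \<alpha> + 1" "0 < \<alpha> + 1" for n using \<alpha> by auto
  have pos: "0 < bdefect n" for n unfolding bdefect_eq using c_pos p by simp
  have eq: "(hnorm E (a n))\<^sup>2 / ((c n)\<^sup>2 * bdefect n) = w n * (hnorm E (a n))\<^sup>2" for n
    unfolding bdefect_eq w_eq using c_pos[of n] p by (simp add: power2_eq_square)
  show ?thesis
    using dominated_iff_summable[OF a pos bshift_carrier(2)] unfolding eq .
qed

text \<open>Here the weight of the series is not \<open>w\<close> itself but has \<open>n + \<alpha> + 2\<close> in place of \<open>n + \<alpha> + 1\<close>; the
  difference is a multiple of \<open>1 / c n\<close>.\<close>

lemma fdefect_dominated_iff:
  assumes a: "a \<in> hcarrier L"
  shows "dominated L a (\<lambda>k. (hnorm L k)\<^sup>2 - (hnorm L (fshift k))\<^sup>2) \<longleftrightarrow> w_summable a"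
proof -
  have p: "0 < real n + \<alpha> + 1" "0 < real n + \<alpha> + 2" "0 < \<alpha> + 1" for n using \<alpha> by auto
  let ?w' = "\<lambda>n. 1 / c n * ((real n + \<alpha> + 2) / (\<alpha> + 1))"
  have pos: "0 < fdefect n" for n unfolding fdefect_eq using c_pos p by simp
  have eq: "(hnorm E (a n))\<^sup>2 / ((c n)\<^sup>2 * fdefect n) = ?w' n * (hnorm E (a n))\<^sup>2" for n
    unfolding fdefect_eq using c_pos[of n] p by (simp add: power2_eq_square)
  have "summable (\<lambda>n. ?w' n * (hnorm E (a n))\<^sup>2) \<longleftrightarrow> w_summable a"
  proof
    assume s: "summable (\<lambda>n. ?w' n * (hnorm E (a n))\<^sup>2)"
    have "w n \<le> ?w' n" for n
      unfolding w_eq using c_pos[of n] p by (intro mult_left_mono divide_right_mono) auto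
    then have "w n * (hnorm E (a n))\<^sup>2 \<le> ?w' n * (hnorm E (a n))\<^sup>2" for n
      by (rule mult_right_mono) simp
    then show "w_summable a"
      by (intro summable_comparison_test'[OF s, of 0]) (simp only: norm_w_mult_sq)
  next
    assume s: "w_summable a"
    have "?w' n = w n + 1 / c n * (1 / (\<alpha> + 1))" for n
      unfolding w_eq by (simp add: add_divide_distrib[symmetric] distrib_left[symmetric] add_ac)
    then have "?w' n * (hnorm E (a n))\<^sup>2 = w n * (hnorm E (a n))\<^sup>2 + (1 / (\<alpha> + 1)) * ((hnorm E (a n))\<^sup>2 / c n)" for n
      by (simp only: distrib_right) simp
    then show "summable (\<lambda>n. ?w' n * (hnorm E (a n))\<^sup>2)"
      using summable_add[OF s summable_mult[OF l2_carrierD(2)[OF a], of "1 / (\<alpha> + 1)"]] by simp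
  qed
  then show ?thesis
    using dominated_iff_summable[OF a pos fshift_carrier(2)] unfolding eq by (rule trans[rotated])
qed

definition mulz :: "(complex \<Rightarrow> 'a) \<Rightarrow> complex \<Rightarrow> 'a"
  where "mulz f = (\<lambda>z. z *\<^sub>C f z)"

definition mulz_adj :: "(complex \<Rightarrow> 'a) \<Rightarrow> complex \<Rightarrow> 'a"
  where "mulz_adj f = (SOME g. g \<in> hcarrier H \<and> coeffs g = bshift (coeffs f))"

definition pointwise :: "(complex \<Rightarrow> 'a) \<Rightarrow> complex \<Rightarrow> 'a"
  where "pointwise f = (\<lambda>z. A (f z))"

lemma mulz_carrier:
  assumes f: "f \<in> hcarrier H"
  shows "mulz f \<in> hcarrier H" "coeffs (mulz f) = fshift (coeffs f)"
proof -
  have "has_power_series E (mulz f) (fshift (coeffs f))"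
    unfolding mulz_def fshift_def by (rule power_series_shift[OF bergman_carrierD(1)[OF f]])
  then show "mulz f \<in> hcarrier H" "coeffs (mulz f) = fshift (coeffs f)"
    using f bergman_carrierD(3)[OF f]
    by (auto intro!: bergman_carrierI fshift_carrier taylor_coeffs_eqI simp: mulz_def)
qed

lemma pointwise_carrier:
  assumes f: "f \<in> hcarrier H"
  shows "pointwise f \<in> hcarrier H" "coeffs (pointwise f) = diag (coeffs f)"
proof -
  have "has_power_series E (pointwise f) (diag (coeffs f))"
    unfolding pointwise_def diag_def by (rule power_series_op[OF bounded bergman_carrierD(1)[OF f]])
  then show "pointwise f \<in> hcarrier H" "coeffs (pointwise f) = diag (coeffs f)"
    using f bergman_carrierD(3)[OF f] op_zero[OF bounded]
    by (auto intro!: bergman_carrierI diag_carrier taylor_coeffs_eqI simp: pointwise_def)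
qed

lemma mulz_adj_carrier:
  assumes f: "f \<in> hcarrier H"
  shows "mulz_adj f \<in> hcarrier H" "coeffs (mulz_adj f) = bshift (coeffs f)"
proof -
  have "\<exists>g. g \<in> hcarrier H \<and> coeffs g = bshift (coeffs f)"
    using power_series_exists[OF bshift_carrier(1)[OF coeffs_carrier[OF f]]] by blast
  from someI_ex[OF this] show "mulz_adj f \<in> hcarrier H" "coeffs (mulz_adj f) = bshift (coeffs f)"
    by (auto simp: mulz_adj_def)
qed

sublocale mp: moebius_pair H mulz mulz_adj pointwise
  by (rule moebius_pair_transport[OF weighted_shift_moebius mulz_carrier mulz_adj_carrier pointwise_carrier])

lemma bergman_carrier_shift:
  "hcarrier (bergman_space (\<alpha> - 1) E) =
    {f \<in> hcarrier H. w_summable (coeffs f)}"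
proof -
  interpret B: bergman E "\<alpha> - 1" by unfold_locales (use \<alpha> in simp)
  have "1 / c n \<le> w n" for n
  proof -
    have "1 / c n * 1 \<le> 1 / c n * ((real n + \<alpha> + 1) / (\<alpha> + 1))"
      using c_pos[of n] \<alpha> by (intro mult_left_mono) (auto simp: pos_le_divide_eq)
    then show ?thesis unfolding w_eq by simp
  qed
  then have le: "(hnorm E (a n))\<^sup>2 / c n \<le> w n * (hnorm E (a n))\<^sup>2" for a :: "nat \<Rightarrow> 'a" and n
    using mult_right_mono[of "1 / c n" "w n" "(hnorm E (a n))\<^sup>2"] by simp
  have "f \<in> hcarrier H" if f: "f \<in> hcarrier B.H" for f
  proof (rule bergman_carrierI)
    show "has_power_series E f (coeffs f)" by (rule B.bergman_carrierD(1)[OF f])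
    show "f z = 0" if "z \<notin> unit_disk" for z by (rule B.bergman_carrierD(3)[OF f that])
    show "coeffs f \<in> hcarrier L"
      by (rule l2_carrier_comparison[OF _ _ le])
         (use B.l2_carrierD[OF B.coeffs_carrier[OF f]] in auto)
  qed
  moreover have "f \<in> hcarrier B.H \<longleftrightarrow> w_summable (coeffs f)" if f: "f \<in> hcarrier H" for f
  proof
    assume "f \<in> hcarrier B.H"
    then show "w_summable (coeffs f)"
      using B.l2_carrierD(2)[OF B.coeffs_carrier] by simp
  next
    assume "w_summable (coeffs f)"
    then have "coeffs f \<in> hcarrier B.L"
      using l2_carrierD(1)[OF coeffs_carrier[OF f]] by (simp add: B.l2_carrier_iff)
    then show "f \<in> hcarrier B.H" using bergman_carrierD[OF f] by (intro B.bergman_carrierI)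
  qed
  ultimately show ?thesis by blast
qed

lemma ball_coeffs:
  "(\<forall>k\<in>hcarrier H. P (coeffs k)) \<longleftrightarrow> (\<forall>a\<in>hcarrier L. P a)"
  using power_series_exists coeffs_carrier by metis

text \<open>The functional equation says \<open>B(z) = (z - A)(1 - zA)\<^sup>-\<^sup>1\<close>.\<close>

theorem sub_bergman_carrier:
  assumes B: "\<And>z x. z \<in> unit_disk \<Longrightarrow> x \<in> hcarrier E \<Longrightarrow> B z (x - z *\<^sub>C A x) = z *\<^sub>C x - A x"
  shows "hcarrier (sub_bergman \<alpha> E B) = hcarrier (bergman_space (\<alpha> - 1) E)"
    and "hcarrier (sub_bergman_star \<alpha> E B) = hcarrier (bergman_space (\<alpha> - 1) E)"
proof -
  have T: "mult_op B (k - pointwise (mulz k)) = mulz k - pointwise k" if k: "k \<in> hcarrier H" for k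
  proof
    fix z
    show "mult_op B (k - pointwise (mulz k)) z = (mulz k - pointwise k) z"
    proof (cases "z \<in> unit_disk")
      case True
      then have "k z \<in> hcarrier E"
        using bergman_carrierD(1)[OF k] limitin_carrier unfolding has_power_series_def by blast
      then show ?thesis
        using B[OF True, of "k z"] True
        by (simp add: mult_op_def pointwise_def mulz_def bounded_opD(3)[OF bounded])
    next
      case False
      then show ?thesis
        using bergman_carrierD(3)[OF k False]
        by (simp add: mult_op_def pointwise_def mulz_def op_zero[OF bounded])
    qed
  qed
  note range = mp.carrier_range_space_defect[where T = "mult_op B", OF T]
  have dom: "dominated H (f - pointwise (S f)) (\<lambda>k. (hnorm H k)\<^sup>2 - (hnorm H (R k))\<^sup>2) \<longleftrightarrow>
      dominated L (coeffs f - diag (s (coeffs f))) (\<lambda>k. (hnorm L k)\<^sup>2 - (hnorm L (r k))\<^sup>2)"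
    if "f \<in> hcarrier H" "S f \<in> hcarrier H" "coeffs (S f) = s (coeffs f)"
      "\<And>k. k \<in> hcarrier H \<Longrightarrow> coeffs (R k) = r (coeffs k)" for f S R s r
    unfolding dominated_def ball_coeffs[symmetric] using that
    by (simp add: bergman_inner bergman_hnorm bergman_diff pointwise_carrier)
  have 1: "dominated H (f - pointwise (mulz_adj f)) (\<lambda>k. (hnorm H k)\<^sup>2 - (hnorm H (mulz k))\<^sup>2)
      \<longleftrightarrow> w_summable (coeffs f)" if f: "f \<in> hcarrier H" for f
  proof (rule trans[OF dom[where s = bshift and r = fshift]])
    show "dominated L (coeffs f - diag (bshift (coeffs f))) (\<lambda>k. (hnorm L k)\<^sup>2 - (hnorm L (fshift k))\<^sup>2)
        \<longleftrightarrow> w_summable (coeffs f)"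
      using f by (simp only: fdefect_dominated_iff backward_iff l2.diff_carrier diag_carrier(1) bshift_carrier(1) coeffs_carrier)
  qed (use f mulz_carrier mulz_adj_carrier in auto)
  have 2: "dominated H (f - pointwise (mulz f)) (\<lambda>k. (hnorm H k)\<^sup>2 - (hnorm H (mulz_adj k))\<^sup>2)
      \<longleftrightarrow> w_summable (coeffs f)" if f: "f \<in> hcarrier H" for f
  proof (rule trans[OF dom[where s = fshift and r = bshift]])
    show "dominated L (coeffs f - diag (fshift (coeffs f))) (\<lambda>k. (hnorm L k)\<^sup>2 - (hnorm L (bshift k))\<^sup>2)
        \<longleftrightarrow> w_summable (coeffs f)"
      using f by (simp only: bdefect_dominated_iff forward_iff l2.diff_carrier diag_carrier(1) fshift_carrier(1) coeffs_carrier)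
  qed (use f mulz_carrier mulz_adj_carrier in auto)
  show "hcarrier (sub_bergman \<alpha> E B) = hcarrier (bergman_space (\<alpha> - 1) E)"
    unfolding sub_bergman_def mult_op_adj_def bergman_carrier_shift
    by (rule trans[OF range(2)]) (use 2 in auto)
  show "hcarrier (sub_bergman_star \<alpha> E B) = hcarrier (bergman_space (\<alpha> - 1) E)"
    unfolding sub_bergman_star_def mult_op_adj_def bergman_carrier_shift
    by (rule trans[OF range(1)]) (use 1 in auto)
qed

end

section \<open>A diagonal function with infinitely many zeros\<close>

definition complex_hilbert :: "complex hilbert"
  where "complex_hilbert = \<lparr> hcarrier = UNIV, hinner = (\<lambda>x y. x * cnj y) \<rparr>"

lemma hnorm_complex [simp]: "hnorm complex_hilbert x = cmod x"
  by (simp add: hnorm_def complex_hilbert_def complex_norm_square[symmetric] flip: of_real_power)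

interpretation complex_hilbert: hilbert_space complex_hilbert
proof (rule hilbert_spaceI)
  show "pre_hilbert_space complex_hilbert"
  proof
    fix x :: complex
    have "x * cnj x = of_real ((cmod x)\<^sup>2)" by (rule complex_norm_square[symmetric])
    then show "0 \<le> Re (hinner complex_hilbert x x)" by (simp add: complex_hilbert_def del: of_real_power)
  qed (auto simp: complex_hilbert_def scaleC_complex_def algebra_simps cvec.subspace_UNIV)
  fix x :: "nat \<Rightarrow> complex"
  assume "\<And>e. e > 0 \<Longrightarrow> \<exists>N. \<forall>m\<ge>N. \<forall>n\<ge>N. hnorm complex_hilbert (x m - x n) < e"
  then have "Cauchy x" by (simp add: Cauchy_def dist_norm)
  then obtain l where "x \<longlonglongrightarrow> l" by (auto simp: Cauchy_convergent_iff convergent_def)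
  then have "(\<lambda>n. hnorm complex_hilbert (x n - l)) \<longlonglongrightarrow> 0"
    by (simp add: LIM_zero tendsto_norm_zero)
  then show "\<exists>l\<in>hcarrier complex_hilbert. (\<lambda>n. hnorm complex_hilbert (x n - l)) \<longlonglongrightarrow> 0"
    by (auto simp: complex_hilbert_def)
qed

definition ell2 :: "(nat \<Rightarrow> complex) hilbert"
  where "ell2 = l2_space (\<lambda>_. 1) complex_hilbert"

interpretation W: weighted_l2 complex_hilbert "\<lambda>_. 1"
  by unfold_locales simp

interpretation ell2: hilbert_space ell2
  unfolding ell2_def by (rule W.l2_hilbert)

lemma ell2_carrier: "x \<in> hcarrier ell2 \<longleftrightarrow> summable (\<lambda>n. (cmod (x n))\<^sup>2)"
  by (simp add: ell2_def W.l2_carrier_iff) (simp add: complex_hilbert_def)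

lemma ell2_inner_sums:
  "x \<in> hcarrier ell2 \<Longrightarrow> y \<in> hcarrier ell2 \<Longrightarrow> (\<lambda>n. x n * cnj (y n)) sums hinner ell2 x y"
  using W.l2_inner_sums[of x y] by (simp add: ell2_def) (simp add: complex_hilbert_def)

lemma ell2_norm_sums: "x \<in> hcarrier ell2 \<Longrightarrow> (\<lambda>n. (cmod (x n))\<^sup>2) sums (hnorm ell2 x)\<^sup>2"
  using W.l2_hnorm_sq_sums[of x] by (simp add: ell2_def)

definition unit_vec :: "nat \<Rightarrow> nat \<Rightarrow> complex"
  where "unit_vec j = (\<lambda>n. if n = j then 1 else 0)"

lemma unit_vec_carrier: "unit_vec j \<in> hcarrier ell2"
  unfolding ell2_carrier by (rule summable_finite[of "{j}"]) (auto simp: unit_vec_def)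

lemma unit_vec_nonzero: "unit_vec j \<noteq> 0"
  by (auto simp: unit_vec_def fun_eq_iff zero_fun_apply)

lemma sum_fun_apply: "(\<Sum>i\<in>I. f i) x = (\<Sum>i\<in>I. f i x)"
  for f :: "'i \<Rightarrow> 'a \<Rightarrow> 'b::comm_monoid_add"
  by (induction I rule: infinite_finite_induct) (auto simp: plus_fun_apply zero_fun_apply)

lemma ell2_infinite_dimensional: "infinite_dimensional ell2"
  unfolding infinite_dimensional_def
proof
  assume "\<exists>S. finite S \<and> hcarrier ell2 \<subseteq> cvec.span S"
  then obtain S where S: "finite S" "hcarrier ell2 \<subseteq> cvec.span S" by blast
  let ?U = "unit_vec ` {..card S}"
  have inj: "inj_on unit_vec A" for A
    by (rule inj_onI) (auto simp: unit_vec_def fun_eq_iff split: if_splits)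
  have "cvec.independent ?U"
  proof (rule cvec.independent_if_scalars_zero)
    fix f x assume sum: "(\<Sum>x\<in>?U. f x *\<^sub>C x) = 0" and "x \<in> ?U"
    then obtain j where j: "j \<le> card S" "x = unit_vec j" by auto
    have "0 = (\<Sum>x\<in>?U. f x *\<^sub>C x) j" unfolding sum by (simp add: zero_fun_apply)
    also have "\<dots> = (\<Sum>i\<le>card S. f (unit_vec i) * unit_vec i j)"
      by (simp add: sum_fun_apply sum.reindex[OF inj] scaleC_fun_def scaleC_complex_def)
    also have "\<dots> = (\<Sum>i\<le>card S. if i = j then f (unit_vec j) else 0)"
      by (intro sum.cong) (auto simp: unit_vec_def)
    also have "\<dots> = f x" using j by simp
    finally show "f x = 0" by simp
  qed simp
  then have "card ?U \<le> card S"
    using cvec.independent_span_bound[OF S(1)] S(2) unit_vec_carrier by blast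
  then show False by (simp add: card_image[OF inj])
qed

text \<open>Finite lists of complex numbers with rational real and imaginary parts, padded with zeros, are dense.\<close>

lemma ell2_separable: "separable_space (htopology ell2)"
proof -
  interpret M: Metric_space "hcarrier ell2" "hdist ell2" by (rule ell2.Metric_space)
  define q :: "rat \<times> rat \<Rightarrow> complex" where "q p = Complex (of_rat (fst p)) (of_rat (snd p))" for p
  define emb where "emb xs = (\<lambda>n. if n < length xs then q (xs ! n) else 0)" for xs
  have embE: "emb xs \<in> hcarrier ell2" for xs
    unfolding ell2_carrier by (rule summable_finite[of "{..<length xs}"]) (auto simp: emb_def)
  have dense: "\<exists>p. cmod (z - q p) < e" if e: "e > 0" for z e
  proof -
    obtain a where a: "Re z < real_of_rat a" "real_of_rat a < Re z + e / 2"
      using of_rat_dense[of "Re z" "Re z + e / 2"] e by auto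
    obtain b where b: "Im z < real_of_rat b" "real_of_rat b < Im z + e / 2"
      using of_rat_dense[of "Im z" "Im z + e / 2"] e by auto
    have "cmod (z - q (a, b)) \<le> \<bar>Re (z - q (a, b))\<bar> + \<bar>Im (z - q (a, b))\<bar>" by (rule cmod_le)
    also have "\<dots> < e" using a b by (simp add: q_def)
    finally show ?thesis by blast
  qed
  have "M.mtopology closure_of (range emb) = hcarrier ell2"
  proof (intro equalityI subsetI)
    fix x assume "x \<in> M.mtopology closure_of (range emb)"
    then show "x \<in> hcarrier ell2" by (simp add: M.metric_closure_of)
  next
    fix x assume x: "x \<in> hcarrier ell2"
    have "\<exists>xs. emb xs \<in> M.mball x r" if r: "r > 0" for r
    proof -
      have "(\<lambda>N. \<Sum>n<N. (cmod (x n))\<^sup>2) \<longlonglongrightarrow> (hnorm ell2 x)\<^sup>2"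
        using ell2_norm_sums[OF x] by (simp only: sums_def)
      then have "\<forall>\<^sub>F N in sequentially. (hnorm ell2 x)\<^sup>2 - r\<^sup>2 / 2 < (\<Sum>n<N. (cmod (x n))\<^sup>2)"
        by (rule order_tendstoD(1)) (use r in simp)
      then obtain N where N: "(hnorm ell2 x)\<^sup>2 - r\<^sup>2 / 2 < (\<Sum>n<N. (cmod (x n))\<^sup>2)"
        by (auto simp: eventually_sequentially)
      define d where "d = r / sqrt (2 * (real N + 1))"
      have d: "d > 0" using r by (simp add: d_def)
      have "\<forall>n. \<exists>p. cmod (x n - q p) < d" using dense[OF d] by blast
      then obtain p where p: "\<And>n. cmod (x n - q (p n)) < d" by metis
      define xs where "xs = map p [0..<N]"
      have emb: "emb xs n = (if n < N then q (p n) else 0)" for n by (simp add: emb_def xs_def)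
      let ?y = "x - emb xs"
      have yE: "?y \<in> hcarrier ell2" using x embE by simp
      have split: "(\<lambda>n. (if n < N then (cmod (x n - q (p n)))\<^sup>2 - (cmod (x n))\<^sup>2 else 0) + (cmod (x n))\<^sup>2)
          = (\<lambda>n. (cmod (?y n))\<^sup>2)"
        by (rule ext) (simp only: minus_apply emb, simp)
      have "(\<lambda>n. (if n < N then (cmod (x n - q (p n)))\<^sup>2 - (cmod (x n))\<^sup>2 else 0))
          sums (\<Sum>n<N. if n < N then (cmod (x n - q (p n)))\<^sup>2 - (cmod (x n))\<^sup>2 else 0)"
        by (rule sums_finite) auto
      from sums_add[OF this ell2_norm_sums[OF x]]
      have "(hnorm ell2 ?y)\<^sup>2 = (\<Sum>n<N. (cmod (x n - q (p n)))\<^sup>2 - (cmod (x n))\<^sup>2) + (hnorm ell2 x)\<^sup>2"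
        using ell2_norm_sums[OF yE] unfolding split by (simp add: sums_unique2)
      also have "\<dots> = (\<Sum>n<N. (cmod (x n - q (p n)))\<^sup>2) + ((hnorm ell2 x)\<^sup>2 - (\<Sum>n<N. (cmod (x n))\<^sup>2))"
        by (simp add: sum_subtractf)
      also have "\<dots> < r\<^sup>2"
      proof -
        have "(\<Sum>n<N. (cmod (x n - q (p n)))\<^sup>2) \<le> (\<Sum>n<N. d\<^sup>2)"
          by (intro sum_mono power_mono less_imp_le[OF p]) simp
        also have "\<dots> = real N * (r\<^sup>2 / (2 * (real N + 1)))"
          by (simp add: d_def power_divide)
        also have "\<dots> \<le> r\<^sup>2 / 2" using r by (simp add: field_simps)
        finally show ?thesis using N by simp
      qed
      finally have "hnorm ell2 ?y < r" using r by (intro power_less_imp_less_base[of _ 2 r]) auto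
      then show ?thesis using x embE by (auto simp: M.in_mball hdist_def)
    qed
    then show "x \<in> M.mtopology closure_of (range emb)"
      using x by (auto simp: M.metric_closure_of)
  qed
  moreover have "countable (range emb)" by (rule countable_image) (rule countableI_type)
  ultimately show ?thesis
    unfolding separable_space_def htopology_def using embE by (intro exI[of _ "range emb"]) auto
qed

definition diag_op :: "(nat \<Rightarrow> complex) \<Rightarrow> (nat \<Rightarrow> complex) \<Rightarrow> nat \<Rightarrow> complex"
  where "diag_op d x = (\<lambda>n. d n * x n)"

lemma diag_op_bound:
  assumes d: "\<And>n. cmod (d n) \<le> M" and x: "x \<in> hcarrier ell2"
  shows "diag_op d x \<in> hcarrier ell2" "hnorm ell2 (diag_op d x) \<le> M * hnorm ell2 x"
proof -
  have M: "0 \<le> M" using d[of 0] norm_ge_zero order_trans by blast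
  have le: "(cmod (diag_op d x n))\<^sup>2 \<le> M\<^sup>2 * (cmod (x n))\<^sup>2" for n
    unfolding diag_op_def norm_mult power_mult_distrib[symmetric]
    by (intro power_mono mult_right_mono d) auto
  have xs: "summable (\<lambda>n. (cmod (x n))\<^sup>2)" using x by (simp add: ell2_carrier)
  show c: "diag_op d x \<in> hcarrier ell2"
    unfolding ell2_carrier
    by (rule summable_comparison_test'[OF summable_mult[OF xs, of "M\<^sup>2"], of 0]) (use le in simp)
  have "(hnorm ell2 (diag_op d x))\<^sup>2 \<le> (M * hnorm ell2 x)\<^sup>2"
    unfolding power_mult_distrib
    by (rule sums_le[OF le ell2_norm_sums[OF c] sums_mult[OF ell2_norm_sums[OF x]]])
  then show "hnorm ell2 (diag_op d x) \<le> M * hnorm ell2 x"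
    by (rule power2_le_imp_le) (simp add: M ell2.hnorm_nonneg x)
qed

lemma diag_op_bounded:
  assumes d: "\<And>n. cmod (d n) \<le> M"
  shows "bounded_op ell2 ell2 (diag_op d)"
  unfolding bounded_op_def
proof (intro conjI ballI allI exI)
  fix x assume x: "x \<in> hcarrier ell2"
  show "diag_op d x \<in> hcarrier ell2" "hnorm ell2 (diag_op d x) \<le> M * hnorm ell2 x"
    by (rule diag_op_bound[where d = d, OF d x])+
qed (auto simp: diag_op_def fun_eq_iff plus_fun_apply scaleC_fun_def scaleC_complex_def algebra_simps)

lemma diag_op_inner:
  assumes d: "\<And>n. cmod (d n) \<le> M" and x: "x \<in> hcarrier ell2" and y: "y \<in> hcarrier ell2"
  shows "hinner ell2 (diag_op d x) y = hinner ell2 x (diag_op (\<lambda>n. cnj (d n)) y)"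
proof -
  have d': "cmod (cnj (d n)) \<le> M" for n using d by simp
  have "(\<lambda>n. diag_op d x n * cnj (y n)) = (\<lambda>n. x n * cnj (diag_op (\<lambda>n. cnj (d n)) y n))"
    by (simp add: diag_op_def mult_ac)
  with ell2_inner_sums[OF diag_op_bound(1)[where d = d, OF d x] y]
  have "(\<lambda>n. x n * cnj (diag_op (\<lambda>n. cnj (d n)) y n)) sums hinner ell2 (diag_op d x) y"
    by (simp only:)
  then show ?thesis
    by (rule sums_unique2[OF _ ell2_inner_sums[OF x diag_op_bound(1)[where d = "\<lambda>n. cnj (d n)", OF d' y]]])
qed

lemma op_norm_bounds:
  assumes T0: "T 0 = 0" and M: "0 \<le> M"
    and le: "\<And>x. x \<in> hcarrier ell2 \<Longrightarrow> hnorm ell2 (T x) \<le> M * hnorm ell2 x"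
  shows "op_norm ell2 ell2 T \<le> M" "0 \<le> op_norm ell2 ell2 T"
proof -
  let ?N = "{hnorm ell2 (T x) |x. x \<in> hcarrier ell2 \<and> hnorm ell2 x \<le> 1}"
  have bd: "r \<le> M" if "r \<in> ?N" for r
  proof -
    obtain x where x: "x \<in> hcarrier ell2" "hnorm ell2 x \<le> 1" "r = hnorm ell2 (T x)" using \<open>r \<in> ?N\<close> by blast
    then have "r \<le> M * hnorm ell2 x" using le by simp
    also have "\<dots> \<le> M" using mult_left_mono[OF x(2) M] by simp
    finally show ?thesis .
  qed
  have 0: "0 \<in> ?N" by (rule CollectI, rule exI[of _ 0]) (simp add: T0)
  show "op_norm ell2 ell2 T \<le> M" unfolding op_norm_def by (rule cSup_least) (use 0 bd in auto)
  show "0 \<le> op_norm ell2 ell2 T"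
    unfolding op_norm_def by (rule cSup_upper[OF 0 bdd_aboveI]) (rule bd)
qed

lemma diag_op_zero: "diag_op d 0 = 0"
  by (simp add: diag_op_def fun_eq_iff zero_fun_apply)

definition zero_at :: "nat \<Rightarrow> complex"
  where "zero_at n = of_real (1 / (real n + 2))"

lemma zero_at_props:
  "cmod (zero_at n) \<le> 1/2" "cnj (zero_at n) = zero_at n" "inj zero_at"
  by (auto simp: zero_at_def norm_divide field_simps inj_def simp flip: of_real_divide)

definition entries :: "complex \<Rightarrow> nat \<Rightarrow> complex"
  where "entries z n = blaschke (zero_at n) z"

definition blaschke_diag :: "complex \<Rightarrow> (nat \<Rightarrow> complex) \<Rightarrow> nat \<Rightarrow> complex"
  where "blaschke_diag z = diag_op (entries z)"

lemma denominator:
  assumes z: "cmod z \<le> 1"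
  shows "1 / 2 \<le> cmod (1 - zero_at n * z)" "1 - zero_at n * z \<noteq> 0"
proof -
  have "cmod (zero_at n * z) \<le> 1/2 * 1"
    unfolding norm_mult using zero_at_props(1) z by (intro mult_mono) auto
  then show "1 / 2 \<le> cmod (1 - zero_at n * z)"
    using norm_triangle_ineq2[of 1 "zero_at n * z"] by simp
  then show "1 - zero_at n * z \<noteq> 0" by auto
qed

lemma entries_eq: "entries z n = (z - zero_at n) / (1 - zero_at n * z)"
  by (simp add: entries_def blaschke_def zero_at_props)

lemma blaschke_norm_defect:
  "(cmod (1 - zero_at n * z))\<^sup>2 - (cmod (z - zero_at n))\<^sup>2 = (1 - (cmod (zero_at n))\<^sup>2) * (1 - (cmod z)\<^sup>2)"
proof -
  have "(cmod (1 - of_real r * z))\<^sup>2 - (cmod (z - of_real r))\<^sup>2 = (1 - (cmod (of_real r))\<^sup>2) * (1 - (cmod z)\<^sup>2)"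
    for r :: real
    unfolding norm_of_real power2_abs cmod_power2 by (simp add: power2_eq_square algebra_simps)
  then show ?thesis unfolding zero_at_def .
qed

lemma blaschke_norm_le:
  assumes z: "cmod z \<le> 1"
  shows "cmod (entries z n) \<le> 1"
proof -
  have "(cmod (zero_at n))\<^sup>2 \<le> 1\<^sup>2" "(cmod z)\<^sup>2 \<le> 1\<^sup>2"
    using zero_at_props(1)[of n] z by (intro power_mono; simp)+
  then have "(cmod (z - zero_at n))\<^sup>2 \<le> (cmod (1 - zero_at n * z))\<^sup>2"
    using blaschke_norm_defect[of n z] mult_nonneg_nonneg[of "1 - (cmod (zero_at n))\<^sup>2" "1 - (cmod z)\<^sup>2"]
    unfolding power_one by linarith
  then have "cmod (z - zero_at n) \<le> cmod (1 - zero_at n * z)"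
    by (rule power2_le_imp_le) simp
  then show ?thesis
    using denominator[OF z, of n] by (simp add: entries_eq norm_divide divide_le_eq)
qed

lemma blaschke_norm_circle:
  assumes z: "cmod z = 1"
  shows "entries z n * cnj (entries z n) = 1"
proof -
  have "(cmod (z - zero_at n))\<^sup>2 = (cmod (1 - zero_at n * z))\<^sup>2"
    using blaschke_norm_defect[of n z] z by simp
  then have "cmod (entries z n) = 1"
    using denominator[of z n] z by (simp add: entries_eq norm_divide)
  then show ?thesis by (simp add: complex_norm_square[symmetric])
qed

text \<open>The quotient on the right is bounded by \<open>4\<close> uniformly in \<open>n\<close>; this gives analyticity and the radial
  limits in all coordinates at once.\<close>

lemma blaschke_difference:
  assumes z: "cmod z \<le> 1" and w: "cmod w \<le> 1"
  shows "entries w n - entries z n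
    = (w - z) * ((1 - (zero_at n)\<^sup>2) / ((1 - zero_at n * w) * (1 - zero_at n * z)))"
  using denominator(2)[OF z, of n] denominator(2)[OF w, of n]
  by (simp add: entries_eq divide_simps) (simp add: power2_eq_square algebra_simps)

lemma norm_one_minus_zero_at_sq: "cmod (1 - (zero_at n)\<^sup>2) \<le> 1"
proof -
  have "1 - (zero_at n)\<^sup>2 = of_real (1 - (1 / (real n + 2))\<^sup>2)" by (simp add: zero_at_def)
  moreover have "(1 / (real n + 2))\<^sup>2 \<le> 1\<^sup>2" by (intro power_mono) auto
  ultimately show ?thesis by (simp only: norm_of_real) simp
qed

lemma norm_inverse_denominators:
  assumes z: "cmod z \<le> 1" and w: "cmod w \<le> 1"
  shows "cmod ((1 - (zero_at n)\<^sup>2) / ((1 - zero_at n * w) * (1 - zero_at n * z))) \<le> 4"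
proof -
  have "1 / 2 * (1 / 2) \<le> cmod (1 - zero_at n * w) * cmod (1 - zero_at n * z)"
    by (intro mult_mono denominator z w) auto
  then have "cmod ((1 - (zero_at n)\<^sup>2)) / (cmod (1 - zero_at n * w) * cmod (1 - zero_at n * z)) \<le> 1 / (1 / 2 * (1 / 2))"
    by (intro frac_le norm_one_minus_zero_at_sq) auto
  then show ?thesis by (simp add: norm_divide norm_mult)
qed

definition blaschke_deriv :: "complex \<Rightarrow> nat \<Rightarrow> complex"
  where "blaschke_deriv z n = (1 - (zero_at n)\<^sup>2) / (1 - zero_at n * z)\<^sup>2"

lemma blaschke_difference_quotient:
  assumes z: "cmod z \<le> 1" and w: "cmod w \<le> 1" and wz: "w \<noteq> z"
  shows "cmod ((1 / (w - z)) * (entries w n - entries z n) - blaschke_deriv z n) \<le> 4 * cmod (w - z)"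
proof -
  let ?a = "zero_at n"
  let ?g = "(1 - ?a\<^sup>2) / ((1 - ?a * w) * (1 - ?a * z))"
  have "(1 / (w - z)) * (entries w n - entries z n) - blaschke_deriv z n = ?g - blaschke_deriv z n"
    using wz by (simp add: blaschke_difference[OF z w])
  also have "\<dots> = ?g * (?a / (1 - ?a * z)) * (w - z)"
    using denominator(2)[OF z, of n] denominator(2)[OF w, of n]
    by (simp add: blaschke_deriv_def divide_simps) (simp add: power2_eq_square algebra_simps)
  finally have eq: "(1 / (w - z)) * (entries w n - entries z n) - blaschke_deriv z n
      = ?g * (?a / (1 - ?a * z)) * (w - z)" .
  have "cmod ?a / cmod (1 - ?a * z) \<le> (1 / 2) / (1 / 2)"
    by (intro frac_le zero_at_props denominator z) auto
  then have "cmod (?a / (1 - ?a * z)) \<le> 1" by (simp add: norm_divide)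
  then have "cmod ?g * cmod (?a / (1 - ?a * z)) \<le> 4 * 1"
    by (intro mult_mono norm_inverse_denominators z w) auto
  then have "cmod ?g * cmod (?a / (1 - ?a * z)) * cmod (w - z) \<le> 4 * cmod (w - z)"
    by (intro mult_right_mono) auto
  then show ?thesis unfolding eq norm_mult .
qed

lemma blaschke_diag_schur: "schur_class ell2 blaschke_diag"
  unfolding schur_class_def
proof (intro conjI ballI)
  fix z :: complex assume "z \<in> unit_disk"
  then have z1: "cmod z < 1" and z: "cmod z \<le> 1" by auto
  show "bounded_op ell2 ell2 (blaschke_diag z)"
    unfolding blaschke_diag_def by (rule diag_op_bounded[where d = "entries z", OF blaschke_norm_le[OF z]])
  show "op_norm ell2 ell2 (blaschke_diag z) \<le> 1"
    unfolding blaschke_diag_def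
    by (rule op_norm_bounds(1)[OF diag_op_zero _ diag_op_bound(2)[where d = "entries z", OF blaschke_norm_le[OF z]]]) auto
  let ?D = "diag_op (blaschke_deriv z)"
  have D: "cmod (blaschke_deriv z n) \<le> 4" for n
    using norm_inverse_denominators[OF z z, of n] by (simp add: blaschke_deriv_def power2_eq_square)
  let ?Q = "\<lambda>w x. (1 / (w - z)) *\<^sub>C (blaschke_diag w x - blaschke_diag z x) - ?D x"
  have Q: "?Q w = diag_op (\<lambda>n. (1 / (w - z)) * (entries w n - entries z n) - blaschke_deriv z n)" for w
    by (simp add: fun_eq_iff blaschke_diag_def diag_op_def scaleC_fun_def scaleC_complex_def algebra_simps)
  have lim: "((\<lambda>w. op_norm ell2 ell2 (?Q w)) \<longlongrightarrow> 0) (at z)"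
  proof (rule Lim_null_comparison)
    have "open unit_disk" by simp
    then have "\<forall>\<^sub>F w in at z. w \<in> unit_disk \<and> w \<noteq> z"
      using z1 by (intro eventually_conj eventually_at_in_open' eventually_neq_at_within) auto
    then show "\<forall>\<^sub>F w in at z. norm (op_norm ell2 ell2 (?Q w)) \<le> 4 * cmod (w - z)"
    proof eventually_elim
      case (elim w)
      then have w: "cmod w \<le> 1" "w \<noteq> z" by auto
      note b = diag_op_bound(2)[where d = "\<lambda>n. (1 / (w - z)) * (entries w n - entries z n) - blaschke_deriv z n",
          OF blaschke_difference_quotient[OF z w]]
      have "op_norm ell2 ell2 (?Q w) \<le> 4 * cmod (w - z)"
        unfolding Q by (rule op_norm_bounds(1)[OF diag_op_zero _ b]) auto
      moreover have "0 \<le> op_norm ell2 ell2 (?Q w)"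
        unfolding Q by (rule op_norm_bounds(2)[OF diag_op_zero _ b]) auto
      ultimately show ?case by simp
    qed
    have "((\<lambda>w. 4 * cmod (w - z)) \<longlongrightarrow> 4 * cmod (z - z)) (at z)" by (intro tendsto_intros)
    then show "((\<lambda>w. 4 * cmod (w - z)) \<longlongrightarrow> 0) (at z)" by simp
  qed
  show "\<exists>D. bounded_op ell2 ell2 D \<and>
      ((\<lambda>w. op_norm ell2 ell2 (\<lambda>x. (1 / (w - z)) *\<^sub>C (blaschke_diag w x - blaschke_diag z x) - D x)) \<longlongrightarrow> 0) (at z)"
    by (rule exI[of _ ?D], rule conjI[OF diag_op_bounded[where d = "blaschke_deriv z", OF D] lim])
qed

lemma blaschke_diag_radial:
  assumes z: "cmod z = 1"
  shows "has_radial_limit ell2 blaschke_diag z (blaschke_diag z)"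
  unfolding has_radial_limit_def
proof (intro conjI ballI)
  have z': "cmod z \<le> 1" using z by simp
  show "bounded_op ell2 ell2 (blaschke_diag z)"
    unfolding blaschke_diag_def by (rule diag_op_bounded[where d = "entries z", OF blaschke_norm_le[OF z']])
  fix x assume x: "x \<in> hcarrier ell2"
  have bE: "blaschke_diag w x \<in> hcarrier ell2" if "cmod w \<le> 1" for w
    unfolding blaschke_diag_def by (rule diag_op_bound(1)[where d = "entries w", OF blaschke_norm_le[OF that] x])
  have ev: "\<forall>\<^sub>F r in at_left (1::real). 0 < r \<and> r < 1"
    by (rule eventually_at_leftI[of 0]) auto
  have le: "hnorm ell2 (blaschke_diag (of_real r * z) x - blaschke_diag z x) \<le> (4 * \<bar>r - 1\<bar>) * hnorm ell2 x"
    if r: "0 < r" "r < 1" for r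
  proof -
    let ?w = "of_real r * z"
    have w: "cmod ?w \<le> 1" using r z by (simp add: norm_mult)
    have "?w - z = of_real (r - 1) * z" by (simp add: algebra_simps)
    then have wz: "cmod (?w - z) = \<bar>r - 1\<bar>" by (simp add: norm_mult z del: of_real_diff)
    have "cmod (entries ?w n - entries z n) \<le> \<bar>r - 1\<bar> * 4" for n
      unfolding blaschke_difference[OF z' w] norm_mult wz
      using norm_inverse_denominators[OF z' w, of n] by (intro mult_left_mono) auto
    then have "cmod (entries ?w n - entries z n) \<le> 4 * \<bar>r - 1\<bar>" for n
      by (simp add: mult.commute)
    from diag_op_bound(2)[where d = "\<lambda>n. entries (of_real r * z) n - entries z n", OF this x]
    show ?thesis
      by (simp add: blaschke_diag_def diag_op_def fun_diff_def left_diff_distrib)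
  qed
  show "limitin (htopology ell2) (\<lambda>r. blaschke_diag (of_real r * z) x) (blaschke_diag z x) (at_left (1::real))"
    unfolding ell2.limitin_iff
  proof (intro conjI bE z')
    show "\<forall>\<^sub>F r in at_left (1::real). blaschke_diag (of_real r * z) x \<in> hcarrier ell2"
      using ev by eventually_elim (auto intro!: bE simp: norm_mult z)
    show "((\<lambda>r. hnorm ell2 (blaschke_diag (of_real r * z) x - blaschke_diag z x)) \<longlongrightarrow> 0) (at_left (1::real))"
    proof (rule Lim_null_comparison)
      show "\<forall>\<^sub>F r in at_left (1::real). norm (hnorm ell2 (blaschke_diag (of_real r * z) x - blaschke_diag z x))
          \<le> (4 * \<bar>r - 1\<bar>) * hnorm ell2 x"
        using ev
      proof eventually_elim
        case (elim r)
        then have "0 \<le> hnorm ell2 (blaschke_diag (of_real r * z) x - blaschke_diag z x)"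
          by (intro ell2.hnorm_nonneg ell2.diff_carrier bE z') (simp add: norm_mult z)
        then show ?case using le elim by simp
      qed
      have "((\<lambda>r. (4 * \<bar>r - 1\<bar>) * hnorm ell2 x) \<longlongrightarrow> (4 * \<bar>1 - 1\<bar>) * hnorm ell2 x) (at_left (1::real))"
        by (intro tendsto_intros)
      then show "((\<lambda>r. (4 * \<bar>r - 1\<bar>) * hnorm ell2 x) \<longlongrightarrow> 0) (at_left (1::real))" by simp
    qed
  qed
qed

lemma blaschke_diag_unitary:
  assumes z: "cmod z = 1" and x: "x \<in> hcarrier ell2"
  shows "adjoint_op ell2 ell2 (blaschke_diag z) (blaschke_diag z x) = x"
    and "blaschke_diag z (adjoint_op ell2 ell2 (blaschke_diag z) x) = x"
proof -
  have b: "cmod (entries z n) \<le> 1" for n using z by (intro blaschke_norm_le) simp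
  then have b': "cmod (cnj (entries z n)) \<le> 1" for n by simp
  have adj: "adjoint_op ell2 ell2 (blaschke_diag z) y = diag_op (\<lambda>n. cnj (entries z n)) y"
    if y: "y \<in> hcarrier ell2" for y
    unfolding blaschke_diag_def
    by (rule ell2.adjoint_op_eqI[OF y diag_op_bound(1)[where d = "\<lambda>n. cnj (entries z n)", OF b' y]
          diag_op_inner[where d = "entries z", OF b _ y]])
  have bx: "blaschke_diag z x \<in> hcarrier ell2"
    unfolding blaschke_diag_def by (rule diag_op_bound(1)[where d = "entries z", OF b x])
  show "adjoint_op ell2 ell2 (blaschke_diag z) (blaschke_diag z x) = x"
    unfolding adj[OF bx] using blaschke_norm_circle[OF z]
    by (simp add: fun_eq_iff blaschke_diag_def diag_op_def mult.assoc[symmetric] mult.commute[of "cnj _"])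
  show "blaschke_diag z (adjoint_op ell2 ell2 (blaschke_diag z) x) = x"
    unfolding adj[OF x] using blaschke_norm_circle[OF z]
    by (simp add: fun_eq_iff blaschke_diag_def diag_op_def mult.assoc[symmetric])
qed

subsection \<open>Injectivity of finite products\<close>

lemma blaschke_eq_0_iff:
  assumes "a \<in> unit_disk" "z \<in> unit_disk"
  shows "blaschke a z = 0 \<longleftrightarrow> z = a"
proof -
  have "cmod a * cmod z \<le> 1 * cmod z" using assms by (intro mult_right_mono) auto
  then have "cmod (cnj a * z) < 1" using assms by (simp add: norm_mult)
  then have "1 - cnj a * z \<noteq> 0" by auto
  then show ?thesis by (simp add: blaschke_def)
qed

context hilbert_space
begin

lemma proj_op:
  assumes "closed_subspace E F" "x \<in> hcarrier E"
  shows "proj_op E F x \<in> F" "v \<in> F \<Longrightarrow> hinner E (x - proj_op E F x) v = 0"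
  using theI'[OF projection_exists[OF assms]] by (auto simp: proj_op_def)

text \<open>The inner product of the factor with \<open>x - P\<^sub>F x\<close> isolates \<open>\<phi>\<^sub>a(z) \<parallel>x - P\<^sub>F x\<parallel>\<^sup>2\<close>, and
  \<open>\<phi>\<^sub>a(z) \<noteq> 0\<close> for \<open>z \<noteq> a\<close>.\<close>

lemma bp_factor_injective:
  assumes F: "closed_subspace E F" and a: "a \<in> unit_disk" and z: "z \<in> unit_disk" "z \<noteq> a"
    and x: "x \<in> hcarrier E"
  shows "bp_factor E a F z x \<in> hcarrier E" "bp_factor E a F z x = 0 \<Longrightarrow> x = 0"
proof -
  let ?p = "proj_op E F x" let ?y = "x - ?p"
  have pE: "?p \<in> hcarrier E" using proj_op(1)[OF F x] F by (auto simp: closed_subspace_def)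
  then show "bp_factor E a F z x \<in> hcarrier E" using x by (simp add: bp_factor_def)
  assume 0: "bp_factor E a F z x = 0"
  have yE: "?y \<in> hcarrier E" using x pE by simp
  have orth: "hinner E ?y ?p = 0" using proj_op(2)[OF F x proj_op(1)[OF F x]] .
  then have "hinner E ?p ?y = 0" using inner_commute[OF yE pE] by simp
  then have "blaschke a z * hinner E ?y ?y = hinner E (bp_factor E a F z x) ?y"
    using pE yE by (simp add: bp_factor_def inner_add_left inner_scaleC_left)
  also have "\<dots> = 0" using 0 yE by simp
  finally have "?y = 0" using blaschke_eq_0_iff[OF a z(1)] z(2) inner_eq_zero[OF yE] by simp
  then show "x = 0" using 0 by (simp add: bp_factor_def)
qed

lemma foldr_bp_factor_injective:
  assumes "\<forall>(a, F)\<in>set ps. a \<in> unit_disk \<and> closed_subspace E F \<and> z \<noteq> a"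
    and z: "z \<in> unit_disk" and x: "x \<in> hcarrier E"
  shows "foldr (\<lambda>(a, F). bp_factor E a F z) ps x \<in> hcarrier E \<and>
    (foldr (\<lambda>(a, F). bp_factor E a F z) ps x = 0 \<longrightarrow> x = 0)"
  using assms(1)
proof (induction ps)
  case (Cons p ps)
  obtain a F where p: "p = (a, F)" by force
  then show ?case using Cons bp_factor_injective[of F a z] z by simp
qed (simp add: x)

lemma finite_bp_product_injective:
  assumes "finite_bp_product E B"
  shows "\<exists>Z. finite Z \<and> (\<forall>z\<in>unit_disk - Z. \<forall>x\<in>hcarrier E. B z x = 0 \<longrightarrow> x = 0)"
proof -
  obtain U ps where U: "unitary_op E U"
    and ps: "\<forall>(a, F)\<in>set ps. a \<in> unit_disk \<and> closed_subspace E F \<and> F \<noteq> hcarrier E"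
    and B: "\<And>z x. z \<in> unit_disk \<Longrightarrow> x \<in> hcarrier E \<Longrightarrow> B z x = U (foldr (\<lambda>(a, F). bp_factor E a F z) ps x)"
    using assms unfolding finite_bp_product_def by blast
  have bU: "bounded_op E E U" and inv: "\<And>x. x \<in> hcarrier E \<Longrightarrow> adjoint_op E E U (U x) = x"
    using U by (auto simp: unitary_op_def)
  have U_inj: "y = 0" if y: "y \<in> hcarrier E" "U y = 0" for y
    using inv[OF y(1)] inv[OF zero_carrier] y(2) op_zero[OF bU] by simp
  show ?thesis
  proof (intro exI[of _ "fst ` set ps"] conjI ballI impI)
    fix z x assume "z \<in> unit_disk - fst ` set ps" and x: "x \<in> hcarrier E" and 0: "B z x = 0"
    then have z: "z \<in> unit_disk" "z \<notin> fst ` set ps" by auto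
    have "\<forall>(a, F)\<in>set ps. a \<in> unit_disk \<and> closed_subspace E F \<and> z \<noteq> a"
      using ps z(2) by force
    from foldr_bp_factor_injective[OF this z(1) x] show "x = 0"
      using U_inj 0 B[OF z(1) x] by simp
  qed simp
qed

end

text \<open>The zeros are infinitely many, so one of them lies outside any given finite exceptional set.\<close>

lemma blaschke_diag_not_finite_bp: "\<not> finite_bp_product ell2 blaschke_diag"
proof
  assume "finite_bp_product ell2 blaschke_diag"
  then obtain Z where Z: "finite Z"
    and inj: "\<And>z x. z \<in> unit_disk \<Longrightarrow> z \<notin> Z \<Longrightarrow> x \<in> hcarrier ell2 \<Longrightarrow> blaschke_diag z x = 0 \<Longrightarrow> x = 0"
    using ell2.finite_bp_product_injective[of blaschke_diag] by (auto simp del: mem_ball)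
  have "infinite (range zero_at)" using zero_at_props(3) by (simp add: finite_image_iff)
  then obtain n where n: "zero_at n \<notin> Z" using Z by (meson finite_subset image_subsetI)
  have "zero_at n \<in> unit_disk" using zero_at_props(1)[of n] by simp
  moreover have "blaschke_diag (zero_at n) (unit_vec n) = 0"
    by (auto simp: blaschke_diag_def diag_op_def unit_vec_def fun_eq_iff zero_fun_apply entries_def blaschke_def)
  ultimately show False using inj n unit_vec_carrier unit_vec_nonzero by blast
qed

lemma op_norm_blaschke_diag_0: "op_norm ell2 ell2 (blaschke_diag 0) < 1"
proof -
  have "cmod (entries 0 n) \<le> 1/2" for n
    using zero_at_props(1)[of n] by (simp add: entries_def blaschke_def)
  then have "op_norm ell2 ell2 (blaschke_diag 0) \<le> 1/2"
    unfolding blaschke_diag_def by (intro op_norm_bounds(1) diag_op_zero diag_op_bound(2)[where d = "entries 0"]) auto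
  then show ?thesis by simp
qed

lemma blaschke_diag_sub_bergman:
  assumes "\<alpha> > -1"
  shows "hcarrier (sub_bergman \<alpha> ell2 blaschke_diag) = hcarrier (bergman_space (\<alpha> - 1) ell2)"
    and "hcarrier (sub_bergman_star \<alpha> ell2 blaschke_diag) = hcarrier (bergman_space (\<alpha> - 1) ell2)"
proof -
  interpret bergman_shift ell2 \<alpha> "diag_op zero_at"
  proof
    show "bounded_op ell2 ell2 (diag_op zero_at)" by (rule diag_op_bounded[where d = zero_at, OF zero_at_props(1)])
    show "hnorm ell2 (diag_op zero_at x) \<le> hnorm ell2 x / 2" if "x \<in> hcarrier ell2" for x
      using diag_op_bound(2)[where d = zero_at, OF zero_at_props(1) that] by simp
    show "hinner ell2 (diag_op zero_at x) y = hinner ell2 x (diag_op zero_at y)"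
      if "x \<in> hcarrier ell2" "y \<in> hcarrier ell2" for x y
      using diag_op_inner[where d = zero_at, OF zero_at_props(1) that] by (simp add: zero_at_props(2))
  qed (use assms in auto)
  have B: "blaschke_diag z (x - z *\<^sub>C diag_op zero_at x) = z *\<^sub>C x - diag_op zero_at x"
    if z: "z \<in> unit_disk" for z x
  proof
    fix n
    have "1 - zero_at n * z \<noteq> 0" using z by (intro denominator) simp
    then show "blaschke_diag z (x - z *\<^sub>C diag_op zero_at x) n = (z *\<^sub>C x - diag_op zero_at x) n"
      by (simp add: blaschke_diag_def diag_op_def entries_eq scaleC_fun_def scaleC_complex_def field_simps)
  qed
  show "hcarrier (sub_bergman \<alpha> ell2 blaschke_diag) = hcarrier (bergman_space (\<alpha> - 1) ell2)"
    "hcarrier (sub_bergman_star \<alpha> ell2 blaschke_diag) = hcarrier (bergman_space (\<alpha> - 1) ell2)"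
    using sub_bergman_carrier[of blaschke_diag] B by auto
qed

theorem theorem3p2:
  shows "\<exists>(E :: (nat \<Rightarrow> complex) hilbert) (B :: complex \<Rightarrow> (nat \<Rightarrow> complex) \<Rightarrow> (nat \<Rightarrow> complex)).
    hilbert_space E \<and> infinite_dimensional E \<and> separable_space (htopology E) \<and>
    schur_class E B \<and>
    (\<forall>\<alpha>::real. \<alpha> > -1 \<longrightarrow>
       hcarrier (sub_bergman \<alpha> E B) = hcarrier (bergman_space (\<alpha> - 1) E) \<and>
       hcarrier (sub_bergman_star \<alpha> E B) = hcarrier (bergman_space (\<alpha> - 1) E)) \<and>
    \<not> finite_bp_product E B \<and>
    op_norm E E (B 0) < 1 \<and>
    (AE t in lebesgue_on {0..2 * pi}. \<exists>T. has_radial_limit E B (cis t) T \<and>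
       (\<forall>x\<in>hcarrier E. adjoint_op E E T (T x) = x \<and> T (adjoint_op E E T x) = x))"
proof (intro exI conjI allI impI)
  show "AE t in lebesgue_on {0..2 * pi}. \<exists>T. has_radial_limit ell2 blaschke_diag (cis t) T \<and>
       (\<forall>x\<in>hcarrier ell2. adjoint_op ell2 ell2 T (T x) = x \<and> T (adjoint_op ell2 ell2 T x) = x)"
  proof (intro AE_I2 exI conjI ballI)
    fix t show "has_radial_limit ell2 blaschke_diag (cis t) (blaschke_diag (cis t))"
      by (rule blaschke_diag_radial) simp
    fix x assume x: "x \<in> hcarrier ell2"
    show "adjoint_op ell2 ell2 (blaschke_diag (cis t)) (blaschke_diag (cis t) x) = x"
      "blaschke_diag (cis t) (adjoint_op ell2 ell2 (blaschke_diag (cis t)) x) = x"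
      by (rule blaschke_diag_unitary[OF _ x], simp)+
  qed
qed (use ell2.hilbert_space_axioms ell2_infinite_dimensional ell2_separable blaschke_diag_schur
    blaschke_diag_sub_bergman blaschke_diag_not_finite_bp op_norm_blaschke_diag_0 in auto)

end
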